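(* Let $A=M_2(\mathbb{C})\oplus M_2(\mathbb{C})$ and let $E_\sigma\subset A$ be the operator system $$E_\sigma=\mathrm{span}_{\mathbb{C}}\{\mathbb{I}_2\oplus\mathbb{I}_2,\ X,\ Y\},\qquad X=\sigma_1\oplus 2\sigma_1,\qquad Y=\sigma_2\oplus\tfrac12\sigma_2 .$$ Then: (1) the $C^*$-envelope of $E_\sigma$ is $A$ (with the inclusion map); (2) $|\pi_0((E_\sigma)_h^\times)|=11$, whereas $|\pi_0(A_h^\times)|=9$; (3) $\pi_0((E_\sigma)^\times)$ and $\pi_0(A^\times)$ each consist of a single element.
   Context: $\mathbb{I}_2$ is the $2\times2$ identity matrix, and $\sigma_1=\begin{pmatrix}0&1\\1&0\end{pmatrix}$, $\sigma_2=\begin{pmatrix}0&-i\\ i&0\end{pmatrix}$ are Pauli matrices. A (concrete) operator system is a $*$-closed, norm-closed linear space of bounded operators on a Hilbert space containing the unit. Its $C^*$-envelope $C^*_{\mathrm{env}}(E)$, with a unital complete order embedding $\imath_E:E\to C^*_{\mathrm{env}}(E)$ whose image generates it, is the smallest $C^*$-algebra generated by a unital completely order isomorphic copy of $E$: for any unital complete order embedding $j:E\to B$ into a $C^*$-algebra $B$ generated by $j(E)$, there is a surjective $*$-homomorphism $\rho: B\to C^*_{\mathrm{env}}(E)$ with $\rho\circ j=\imath_E$. For an operator system $E$, $E^\times$ denotes the set of $x\in E$ such that $\imath_E(x)$ is invertible in $C^*_{\mathrm{env}}(E)$, and $E_h^\times$ denotes the set of self-adjoint elements of $E^\times$; both carry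 the norm topology. For a unital $C^*$-algebra $A$, its $C^*$-envelope is $A$ itself, so $A^\times$ is the set of invertible elements and $A_h^\times$ the set of invertible self-adjoint elements. $\pi_0$ denotes the set of path components. *)

theory Defs
  imports "HOL-Analysis.Analysis"
begin

section \<open>Unital C*-algebras\<close>

text \<open>
  Nonzero unital complex C*-algebras. The zero algebra (excluded by \<open>norm 1 = 1\<close>) admits no unital
  embedding of a nonzero operator system.
\<close>

class cstar_algebra = real_normed_algebra_1 + banach +
  fixes scaleC :: "complex \<Rightarrow> 'a \<Rightarrow> 'a"  (infixr \<open>*\<^sub>C\<close> 75)
    and star :: "'a \<Rightarrow> 'a"  (\<open>_\<^sup>\<star>\<close> [1000] 999)
  assumes scaleC_add_right: "c *\<^sub>C (x + y) = c *\<^sub>C x + c *\<^sub>C y"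
    and scaleC_add_left: "(c + d) *\<^sub>C x = c *\<^sub>C x + d *\<^sub>C x"
    and scaleC_scaleC: "c *\<^sub>C d *\<^sub>C x = (c * d) *\<^sub>C x"
    and scaleR_scaleC: "r *\<^sub>R x = complex_of_real r *\<^sub>C x"
    and mult_scaleC_left: "(c *\<^sub>C x) * y = c *\<^sub>C (x * y)"
    and mult_scaleC_right: "x * (c *\<^sub>C y) = c *\<^sub>C (x * y)"
    and norm_scaleC: "norm (c *\<^sub>C x) = cmod c * norm x"
    and star_add: "(x + y)\<^sup>\<star> = x\<^sup>\<star> + y\<^sup>\<star>"
    and star_scaleC: "(c *\<^sub>C x)\<^sup>\<star> = cnj c *\<^sub>C x\<^sup>\<star>"
    and star_mult: "(x * y)\<^sup>\<star> = y\<^sup>\<star> * x\<^sup>\<star>"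
    and star_star: "(x\<^sup>\<star>)\<^sup>\<star> = x"
    and cstar_identity: "norm (x\<^sup>\<star> * x) = (norm x)\<^sup>2"

lemma vector_space_scaleC: "vector_space (scaleC :: complex \<Rightarrow> 'a::cstar_algebra \<Rightarrow> 'a)"
proof
  fix c d :: complex and x y :: 'a
  show "c *\<^sub>C (x + y) = c *\<^sub>C x + c *\<^sub>C y" by (rule scaleC_add_right)
  show "(c + d) *\<^sub>C x = c *\<^sub>C x + d *\<^sub>C x" by (rule scaleC_add_left)
  show "c *\<^sub>C d *\<^sub>C x = (c * d) *\<^sub>C x" by (rule scaleC_scaleC)
  show "1 *\<^sub>C x = x" using scaleR_scaleC[of 1 x] by simp
qed

interpretation complex_vector: vector_space "scaleC :: complex \<Rightarrow> 'a::cstar_algebra \<Rightarrow> 'a"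
  by (rule vector_space_scaleC)

abbreviation cspan :: "'a::cstar_algebra set \<Rightarrow> 'a set"
  where "cspan \<equiv> module.span scaleC"

abbreviation csubspace :: "'a::cstar_algebra set \<Rightarrow> bool"
  where "csubspace \<equiv> module.subspace scaleC"

definition invertible_elem :: "'a::cstar_algebra \<Rightarrow> bool"
  where "invertible_elem x \<longleftrightarrow> (\<exists>y. x * y = 1 \<and> y * x = 1)"

definition cstar_subalgebra :: "'a::cstar_algebra set \<Rightarrow> bool"
  where "cstar_subalgebra S \<longleftrightarrow>
    csubspace S \<and> (\<forall>x\<in>S. \<forall>y\<in>S. x * y \<in> S) \<and> (\<forall>x\<in>S. x\<^sup>\<star> \<in> S) \<and> closed S"

definition generates :: "'a::cstar_algebra set \<Rightarrow> bool"
  where "generates S \<longleftrightarrow> cstar_subalgebra hull S = UNIV"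

definition star_hom :: "('a::cstar_algebra \<Rightarrow> 'b::cstar_algebra) \<Rightarrow> bool"
  where "star_hom \<rho> \<longleftrightarrow>
    (\<forall>x y. \<rho> (x + y) = \<rho> x + \<rho> y) \<and> (\<forall>c x. \<rho> (c *\<^sub>C x) = c *\<^sub>C \<rho> x) \<and>
    (\<forall>x y. \<rho> (x * y) = \<rho> x * \<rho> y) \<and> (\<forall>x. \<rho> (x\<^sup>\<star>) = (\<rho> x)\<^sup>\<star>)"


section \<open>Operator systems and C*-envelopes\<close>

definition operator_system :: "'a::cstar_algebra set \<Rightarrow> bool"
  where "operator_system E \<longleftrightarrow> csubspace E \<and> 1 \<in> E \<and> (\<forall>x\<in>E. x\<^sup>\<star> \<in> E) \<and> closed E"

text \<open>
  An \<open>n \<times> n\<close> matrix over a C*-algebra is a function of two indices, of which only the values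
  at indices below \<open>n\<close> matter. It is positive in the C*-algebra of \<open>n \<times> n\<close> matrices iff it is of
  the form \<open>Z\<^sup>\<star> Z\<close>.
\<close>

definition matrix_pos :: "nat \<Rightarrow> (nat \<Rightarrow> nat \<Rightarrow> 'a::cstar_algebra) \<Rightarrow> bool"
  where "matrix_pos n M \<longleftrightarrow>
    (\<exists>Z :: nat \<Rightarrow> nat \<Rightarrow> 'a. \<forall>i<n. \<forall>j<n. M i j = (\<Sum>k<n. (Z k i)\<^sup>\<star> * Z k j))"

definition unital_complete_order_embedding ::
    "'a::cstar_algebra set \<Rightarrow> ('a \<Rightarrow> 'b::cstar_algebra) \<Rightarrow> bool"
  where "unital_complete_order_embedding E j \<longleftrightarrow>
    (\<forall>x\<in>E. \<forall>y\<in>E. j (x + y) = j x + j y) \<and> (\<forall>c. \<forall>x\<in>E. j (c *\<^sub>C x) = c *\<^sub>C j x) \<and>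
    j 1 = 1 \<and> inj_on j E \<and>
    (\<forall>n M. (\<forall>i<n. \<forall>k<n. M i k \<in> E) \<longrightarrow>
      (matrix_pos n M \<longleftrightarrow> matrix_pos n (\<lambda>i k. j (M i k))))"

text \<open>
  The C*-algebra \<open>'c\<close> with the map \<open>\<iota>\<close> is a C*-envelope of \<open>E\<close>. A definition cannot quantify over
  types, so the type \<open>'b\<close> over which the competing C*-algebras range is a parameter; a theorem
  stating this for a type variable \<open>'b\<close> states it for all C*-algebras.
\<close>

definition is_cstar_envelope ::
    "'b::cstar_algebra itself \<Rightarrow> 'a::cstar_algebra set \<Rightarrow> ('a \<Rightarrow> 'c::cstar_algebra) \<Rightarrow> bool"
  where "is_cstar_envelope (_ :: 'b itself) E \<iota> \<longleftrightarrow>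
    operator_system E \<and> unital_complete_order_embedding E \<iota> \<and> generates (\<iota> ` E) \<and>
    (\<forall>j :: 'a \<Rightarrow> 'b. unital_complete_order_embedding E j \<and> generates (j ` E) \<longrightarrow>
      (\<exists>\<rho> :: 'b \<Rightarrow> 'c. star_hom \<rho> \<and> surj \<rho> \<and> (\<forall>x\<in>E. \<rho> (j x) = \<iota> x)))"

text \<open>
  \<open>E\<^sup>\<times>\<close> and its self-adjoint part, relative to the embedding \<open>\<iota>\<close> of \<open>E\<close> into its C*-envelope.
\<close>

definition env_units :: "('a::cstar_algebra \<Rightarrow> 'c::cstar_algebra) \<Rightarrow> 'a set \<Rightarrow> 'a set"
  where "env_units \<iota> E = {x \<in> E. invertible_elem (\<iota> x)}"

definition env_units_h :: "('a::cstar_algebra \<Rightarrow> 'c::cstar_algebra) \<Rightarrow> 'a set \<Rightarrow> 'a set"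
  where "env_units_h \<iota> E = {x \<in> env_units \<iota> E. x\<^sup>\<star> = x}"

definition pi0 :: "'a::topological_space set \<Rightarrow> 'a set set"
  where "pi0 S = path_components_of (top_of_set S)"


section \<open>Matrix algebras with the operator norm\<close>

text \<open>
  The type \<open>complex^'n^'n\<close> carries componentwise multiplication and the Frobenius norm, hence the copy.
\<close>

typedef 'n cmat = "UNIV :: (complex^'n^'n) set"
  morphisms entries CMat ..

setup_lifting type_definition_cmat

definition adjoint_matrix :: "complex^'n^'n \<Rightarrow> complex^'n^'n"
  where "adjoint_matrix A = (\<chi> i j. cnj (A $ j $ i))"

lemma adjoint_matrix_inner: "inner (A *v v) w = inner v (adjoint_matrix A *v w)"
proof -
  have "inner (A *v v) w = (\<Sum>i\<in>UNIV. \<Sum>j\<in>UNIV. inner (A $ i $ j * v $ j) (w $ i))"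
    by (simp add: inner_vec_def matrix_vector_mult_def inner_sum_left)
  also have "\<dots> = (\<Sum>j\<in>UNIV. \<Sum>i\<in>UNIV. inner (A $ i $ j * v $ j) (w $ i))"
    by (rule sum.swap)
  also have "\<dots> = (\<Sum>j\<in>UNIV. \<Sum>i\<in>UNIV. inner (v $ j) (cnj (A $ i $ j) * w $ i))"
    by (intro sum.cong refl) (simp add: inner_complex_def algebra_simps)
  also have "\<dots> = inner v (adjoint_matrix A *v w)"
    by (simp add: inner_vec_def matrix_vector_mult_def inner_sum_right adjoint_matrix_def)
  finally show ?thesis .
qed

instantiation cmat :: (finite) real_normed_algebra_1
begin

lift_definition zero_cmat :: "'a cmat" is 0 .
lift_definition one_cmat :: "'a cmat" is "mat 1" .
lift_definition plus_cmat :: "'a cmat \<Rightarrow> 'a cmat \<Rightarrow> 'a cmat" is "(+)" .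
lift_definition minus_cmat :: "'a cmat \<Rightarrow> 'a cmat \<Rightarrow> 'a cmat" is "(-)" .
lift_definition uminus_cmat :: "'a cmat \<Rightarrow> 'a cmat" is uminus .
lift_definition times_cmat :: "'a cmat \<Rightarrow> 'a cmat \<Rightarrow> 'a cmat" is "(**)" .
lift_definition scaleR_cmat :: "real \<Rightarrow> 'a cmat \<Rightarrow> 'a cmat" is scaleR .
lift_definition norm_cmat :: "'a cmat \<Rightarrow> real" is "\<lambda>A. onorm (\<lambda>v. A *v v)" .

definition sgn_cmat :: "'a cmat \<Rightarrow> 'a cmat" where "sgn_cmat x = inverse (norm x) *\<^sub>R x"
definition dist_cmat :: "'a cmat \<Rightarrow> 'a cmat \<Rightarrow> real" where "dist_cmat x y = norm (x - y)"
definition uniformity_cmat :: "('a cmat \<times> 'a cmat) filter"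
  where "uniformity_cmat = (INF e\<in>{0<..}. principal {(x, y). dist x y < e})"
definition open_cmat :: "'a cmat set \<Rightarrow> bool"
  where "open_cmat U \<longleftrightarrow> (\<forall>x\<in>U. eventually (\<lambda>(x', y). x' = x \<longrightarrow> y \<in> U) uniformity)"

instance
proof
  fix a b c :: "'a cmat" and r s :: real and U :: "'a cmat set"
  show "a + b + c = a + (b + c)" "a + b = b + a" "0 + a = a" "- a + a = 0" "a - b = a + - b"
    by (transfer; simp)+
  show "r *\<^sub>R (a + b) = r *\<^sub>R a + r *\<^sub>R b" "(r + s) *\<^sub>R a = r *\<^sub>R a + s *\<^sub>R a"
    "r *\<^sub>R s *\<^sub>R a = (r * s) *\<^sub>R a" "1 *\<^sub>R a = a"
    by (transfer; simp add: scaleR_add_right scaleR_add_left)+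
  show "a * b * c = a * (b * c)" by transfer (simp add: matrix_mul_assoc)
  show "(a + b) * c = a * c + b * c" 
    by transfer (simp add: vec_eq_iff matrix_matrix_mult_def distrib_right sum.distrib)
  show "a * (b + c) = a * b + a * c" 
    by transfer (simp add: vec_eq_iff matrix_matrix_mult_def distrib_left sum.distrib)
  show "1 * a = a" "a * 1 = a" by (transfer; simp)+
  show "r *\<^sub>R a * b = r *\<^sub>R (a * b)"
    by transfer (simp add: vec_eq_iff matrix_matrix_mult_def scaleR_sum_right)
  show "a * r *\<^sub>R b = r *\<^sub>R (a * b)"
    by transfer (simp add: vec_eq_iff matrix_matrix_mult_def scaleR_sum_right)
  show "(0 :: 'a cmat) \<noteq> 1"
    by transfer (auto simp: vec_eq_iff mat_def)
  show "sgn a = inverse (norm a) *\<^sub>R a" by (rule sgn_cmat_def)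
  show "dist a b = norm (a - b)" by (rule dist_cmat_def)
  show "(uniformity :: ('a cmat \<times> 'a cmat) filter) = (INF e\<in>{0<..}. principal {(x, y). dist x y < e})"
    by (rule uniformity_cmat_def)
  show "open U \<longleftrightarrow> (\<forall>x\<in>U. \<forall>\<^sub>F (x', y) in uniformity. x' = x \<longrightarrow> y \<in> U)"
    by (rule open_cmat_def)
  show "norm a = 0 \<longleftrightarrow> a = 0"
  proof transfer
    fix A :: "complex^'a^'a"
    have "onorm ((*v) A) = 0 \<longleftrightarrow> (\<forall>x. A *v x = 0)"
      by (rule onorm_eq_0) simp
    then show "onorm ((*v) A) = 0 \<longleftrightarrow> A = 0"
      by (metis matrix_eq matrix_vector_mult_0)
  qed
  show "norm (a + b) \<le> norm a + norm b"
  proof transfer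
    fix A B :: "complex^'a^'a"
    have "(*v) (A + B) = (\<lambda>x. A *v x + B *v x)"
      by (simp add: fun_eq_iff matrix_vector_mult_add_rdistrib)
    then show "onorm ((*v) (A + B)) \<le> onorm ((*v) A) + onorm ((*v) B)"
      by (simp add: onorm_triangle)
  qed
  show "norm (r *\<^sub>R a) = \<bar>r\<bar> * norm a"
  proof transfer
    fix r and A :: "complex^'a^'a"
    have "(*v) (r *\<^sub>R A) = (\<lambda>x. r *\<^sub>R (A *v x))"
      by (simp add: fun_eq_iff vec_eq_iff matrix_vector_mult_def scaleR_sum_right)
    then show "onorm ((*v) (r *\<^sub>R A)) = \<bar>r\<bar> * onorm ((*v) A)"
      by (simp add: onorm_scaleR)
  qed
  show "norm (a * b) \<le> norm a * norm b"
  proof transfer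
    fix A B :: "complex^'a^'a"
    have "(*v) (A ** B) = (*v) A \<circ> (*v) B"
      by (simp add: fun_eq_iff matrix_vector_mul_assoc)
    then show "onorm ((*v) (A ** B)) \<le> onorm ((*v) A) * onorm ((*v) B)"
      by (simp add: onorm_compose)
  qed
  show "norm (1 :: 'a cmat) = 1"
  proof transfer
    have "(*v) (mat 1) = (\<lambda>x :: complex^'a. x)" by (simp add: fun_eq_iff)
    moreover have "onorm (\<lambda>x :: complex^'a. x) = 1" by (rule onorm_id)
    ultimately show "onorm ((*v) (mat 1 :: complex^'a^'a)) = 1" by simp
  qed
qed

end

lemma norm_cmat_entry_le: "cmod (entries a $ i $ j) \<le> norm a"
proof transfer
  fix A :: "complex^'n^'n" and i j
  have "A $ i $ k * axis j 1 $ k = (if k = j then A $ i $ j else 0)" for k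
    by (simp add: axis_def)
  then have "A $ i $ j = (A *v axis j 1) $ i"
    by (simp add: matrix_vector_mult_def)
  then have "cmod (A $ i $ j) \<le> norm (A *v axis j 1)"
    by (metis Finite_Cartesian_Product.norm_nth_le)
  also have "\<dots> \<le> onorm ((*v) A) * norm (axis j 1 :: complex^'n)"
    by (rule onorm) simp
  finally show "cmod (A $ i $ j) \<le> onorm ((*v) A)" by simp
qed

lemma norm_cmat_le_sum: "norm a \<le> (\<Sum>i\<in>UNIV. \<Sum>j\<in>UNIV. cmod (entries a $ i $ j))"
proof transfer
  fix A :: "complex^'n^'n"
  show "onorm ((*v) A) \<le> (\<Sum>i\<in>UNIV. \<Sum>j\<in>UNIV. cmod (A $ i $ j))"
  proof (rule onorm_le)
    fix x :: "complex^'n"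
    have "norm (A *v x) \<le> (\<Sum>i\<in>UNIV. cmod ((A *v x) $ i))"
      unfolding norm_vec_def by (rule L2_set_le_sum) simp
    also have "\<dots> \<le> (\<Sum>i\<in>UNIV. \<Sum>j\<in>UNIV. cmod (A $ i $ j) * norm x)"
    proof (rule sum_mono)
      fix i
      have "cmod ((A *v x) $ i) \<le> (\<Sum>j\<in>UNIV. cmod (A $ i $ j * x $ j))"
        by (simp add: matrix_vector_mult_def norm_sum)
      also have "\<dots> \<le> (\<Sum>j\<in>UNIV. cmod (A $ i $ j) * norm x)"
        by (intro sum_mono)
          (simp add: norm_mult mult_left_mono Finite_Cartesian_Product.norm_nth_le)
      finally show "cmod ((A *v x) $ i) \<le> (\<Sum>j\<in>UNIV. cmod (A $ i $ j) * norm x)" .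
    qed
    finally show "norm (A *v x) \<le> (\<Sum>i\<in>UNIV. \<Sum>j\<in>UNIV. cmod (A $ i $ j)) * norm x"
      by (simp add: sum_distrib_right)
  qed
qed

instance cmat :: (finite) banach
proof
  fix X :: "nat \<Rightarrow> 'a cmat"
  assume X: "Cauchy X"
  have entries_diff: "entries (a - b) = entries a - entries b" for a b :: "'a cmat"
    by (rule minus_cmat.rep_eq)
  have "Cauchy (\<lambda>n. entries (X n) $ i $ j)" for i j
  proof (rule metric_CauchyI)
    fix e :: real assume "e > 0"
    with X obtain M where M: "\<And>m n. m \<ge> M \<Longrightarrow> n \<ge> M \<Longrightarrow> dist (X m) (X n) < e"
      using metric_CauchyD by blast
    have "dist (entries (X m) $ i $ j) (entries (X n) $ i $ j) < e" if "m \<ge> M" "n \<ge> M" for m n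
      using M[OF that] norm_cmat_entry_le[of "X m - X n" i j]
      by (simp add: dist_norm entries_diff)
    then show "\<exists>M. \<forall>m\<ge>M. \<forall>n\<ge>M. dist (entries (X m) $ i $ j) (entries (X n) $ i $ j) < e"
      by blast
  qed
  then have conv: "convergent (\<lambda>n. entries (X n) $ i $ j)" for i j
    by (rule Cauchy_convergent)
  define l where "l = (\<lambda>i j. lim (\<lambda>n. entries (X n) $ i $ j))"
  have l: "(\<lambda>n. entries (X n) $ i $ j) \<longlonglongrightarrow> l i j" for i j
    using conv unfolding l_def by (simp only: convergent_LIMSEQ_iff)
  define L where "L = CMat (\<chi> i j. l i j)"
  have L: "entries L $ i $ j = l i j" for i j
    by (simp add: L_def CMat_inverse)
  have "(\<lambda>n. \<Sum>i\<in>UNIV. \<Sum>j\<in>UNIV. cmod (entries (X n - L) $ i $ j)) \<longlonglongrightarrow>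
      (\<Sum>i\<in>(UNIV::'a set). \<Sum>j\<in>(UNIV::'a set). cmod (l i j - l i j))"
    unfolding entries_diff vector_minus_component L
    by (intro tendsto_sum tendsto_norm tendsto_diff tendsto_const l)
  then have lim: "(\<lambda>n. \<Sum>i\<in>UNIV. \<Sum>j\<in>UNIV. cmod (entries (X n - L) $ i $ j)) \<longlonglongrightarrow> 0"
    by simp
  have "(\<lambda>n. X n - L) \<longlonglongrightarrow> 0"
    by (rule Lim_null_comparison[OF always_eventually lim]) (simp add: norm_cmat_le_sum)
  then have "X \<longlonglongrightarrow> L" by (rule LIM_zero_cancel)
  then show "convergent X" by (auto simp: convergent_def)
qed

instantiation cmat :: (finite) cstar_algebra
begin

lift_definition scaleC_cmat :: "complex \<Rightarrow> 'a cmat \<Rightarrow> 'a cmat" is "\<lambda>c A. \<chi> i j. c * A $ i $ j" .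
lift_definition star_cmat :: "'a cmat \<Rightarrow> 'a cmat" is adjoint_matrix .

instance
proof
  fix a b :: "'a cmat" and c d :: complex and r :: real
  show "c *\<^sub>C (a + b) = c *\<^sub>C a + c *\<^sub>C b" "(c + d) *\<^sub>C a = c *\<^sub>C a + d *\<^sub>C a"
    "c *\<^sub>C d *\<^sub>C a = (c * d) *\<^sub>C a"
    by (transfer; simp add: vec_eq_iff algebra_simps)+
  show "r *\<^sub>R a = complex_of_real r *\<^sub>C a"
    by transfer (simp only: vec_eq_iff vector_scaleR_component vec_lambda_beta
        scaleR_conv_of_real[where 'a = complex], simp)
  show "(c *\<^sub>C a) * b = c *\<^sub>C (a * b)" "a * (c *\<^sub>C b) = c *\<^sub>C (a * b)"
    by (transfer; simp add: vec_eq_iff matrix_matrix_mult_def sum_distrib_left mult.assoc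
        mult.left_commute)+
  show "norm (c *\<^sub>C a) = cmod c * norm a"
  proof transfer
    fix c and A :: "complex^'a^'a"
    let ?B = "\<chi> i j. c * A $ i $ j"
    have 1: "norm (?B *v x) = cmod c * norm (A *v x)" for x
    proof -
      have "norm ((?B *v x) $ i) = cmod c * norm ((A *v x) $ i)" for i
      proof -
        have "(?B *v x) $ i = c * (A *v x) $ i"
          by (simp add: matrix_vector_mult_def sum_distrib_left mult.assoc)
        then show ?thesis by (simp add: norm_mult)
      qed
      then show ?thesis by (simp add: norm_vec_def L2_set_right_distrib)
    qed
    have "onorm ((*v) ?B) = onorm (\<lambda>x. cmod c *\<^sub>R (A *v x))"
      by (simp add: onorm_def 1)
    also have "\<dots> = cmod c * onorm ((*v) A)"
      by (subst onorm_scaleR) auto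
    finally show "onorm ((*v) ?B) = cmod c * onorm ((*v) A)" .
  qed
  show "(a + b)\<^sup>\<star> = a\<^sup>\<star> + b\<^sup>\<star>" "(c *\<^sub>C a)\<^sup>\<star> = cnj c *\<^sub>C a\<^sup>\<star>" "(a\<^sup>\<star>)\<^sup>\<star> = a"
    by (transfer; simp add: adjoint_matrix_def vec_eq_iff)+
  show "(a * b)\<^sup>\<star> = b\<^sup>\<star> * a\<^sup>\<star>"
    by transfer (simp add: adjoint_matrix_def vec_eq_iff matrix_matrix_mult_def mult.commute)
  have sq: "(norm a)\<^sup>2 \<le> norm (a\<^sup>\<star> * a)" for a :: "'a cmat"
  proof transfer
    fix A :: "complex^'a^'a"
    let ?C = "adjoint_matrix A ** A"
    have "onorm ((*v) A) \<le> sqrt (onorm ((*v) ?C))"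
    proof (rule onorm_le)
      fix x
      have "(norm (A *v x))\<^sup>2 = inner x (?C *v x)"
        by (simp add: power2_norm_eq_inner adjoint_matrix_inner matrix_vector_mul_assoc)
      also have "\<dots> \<le> norm x * norm (?C *v x)" by (rule norm_cauchy_schwarz)
      also have "\<dots> \<le> norm x * (onorm ((*v) ?C) * norm x)"
        by (intro mult_left_mono onorm) auto
      also have "\<dots> = (sqrt (onorm ((*v) ?C)) * norm x)\<^sup>2"
        using onorm_pos_le[of "(*v) ?C"] by (simp add: power_mult_distrib power2_eq_square)
      finally show "norm (A *v x) \<le> sqrt (onorm ((*v) ?C)) * norm x"
        by (rule power2_le_imp_le) (simp add: onorm_pos_le)
    qed
    then have "(onorm ((*v) A))\<^sup>2 \<le> (sqrt (onorm ((*v) ?C)))\<^sup>2"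
      by (rule power_mono) (simp add: onorm_pos_le)
    also have "\<dots> = onorm ((*v) ?C)" by (simp add: onorm_pos_le)
    finally show "(onorm ((*v) A))\<^sup>2 \<le> onorm ((*v) ?C)" .
  qed
  have le: "norm a \<le> norm (a\<^sup>\<star>)" for a :: "'a cmat"
  proof (cases "norm a = 0")
    case False
    have "norm a * norm a \<le> norm (a\<^sup>\<star>) * norm a"
      using sq[of a] norm_mult_ineq[of "a\<^sup>\<star>" a] by (simp add: power2_eq_square)
    moreover have "norm a > 0" using False norm_ge_zero[of a] by linarith
    ultimately show ?thesis by (rule mult_right_le_imp_le)
  qed simp
  have "(a\<^sup>\<star>)\<^sup>\<star> = a" by (transfer; simp add: adjoint_matrix_def vec_eq_iff)
  with le[of a] le[of "a\<^sup>\<star>"] have "norm (a\<^sup>\<star>) = norm a" by simp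
  with sq[of a] norm_mult_ineq[of "a\<^sup>\<star>" a] show "norm (a\<^sup>\<star> * a) = (norm a)\<^sup>2"
    by (simp add: power2_eq_square)
qed

end


section \<open>Direct sums\<close>

text \<open>A new type, because the product type carries the \<open>\<ell>\<^sup>2\<close>-norm instead of the maximum norm.\<close>

datatype ('a, 'b) dsum = DSum (dfst: 'a) (dsnd: 'b)  (infixr \<open>\<oplus>\<close> 60)

instantiation dsum :: (cstar_algebra, cstar_algebra) real_normed_algebra_1
begin

definition zero_dsum :: "('a, 'b) dsum" where "zero_dsum = 0 \<oplus> 0"
definition one_dsum :: "('a, 'b) dsum" where "one_dsum = 1 \<oplus> 1"
definition plus_dsum :: "('a, 'b) dsum \<Rightarrow> ('a, 'b) dsum \<Rightarrow> ('a, 'b) dsum"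
  where "plus_dsum x y = (dfst x + dfst y) \<oplus> (dsnd x + dsnd y)"
definition minus_dsum :: "('a, 'b) dsum \<Rightarrow> ('a, 'b) dsum \<Rightarrow> ('a, 'b) dsum"
  where "minus_dsum x y = (dfst x - dfst y) \<oplus> (dsnd x - dsnd y)"
definition uminus_dsum :: "('a, 'b) dsum \<Rightarrow> ('a, 'b) dsum"
  where "uminus_dsum x = (- dfst x) \<oplus> (- dsnd x)"
definition times_dsum :: "('a, 'b) dsum \<Rightarrow> ('a, 'b) dsum \<Rightarrow> ('a, 'b) dsum"
  where "times_dsum x y = (dfst x * dfst y) \<oplus> (dsnd x * dsnd y)"
definition scaleR_dsum :: "real \<Rightarrow> ('a, 'b) dsum \<Rightarrow> ('a, 'b) dsum"
  where "scaleR_dsum r x = (r *\<^sub>R dfst x) \<oplus> (r *\<^sub>R dsnd x)"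
definition norm_dsum :: "('a, 'b) dsum \<Rightarrow> real"
  where "norm_dsum x = max (norm (dfst x)) (norm (dsnd x))"
definition sgn_dsum :: "('a, 'b) dsum \<Rightarrow> ('a, 'b) dsum"
  where "sgn_dsum x = inverse (norm x) *\<^sub>R x"
definition dist_dsum :: "('a, 'b) dsum \<Rightarrow> ('a, 'b) dsum \<Rightarrow> real"
  where "dist_dsum x y = norm (x - y)"
definition uniformity_dsum :: "(('a, 'b) dsum \<times> ('a, 'b) dsum) filter"
  where "uniformity_dsum = (INF e\<in>{0<..}. principal {(x, y). dist x y < e})"
definition open_dsum :: "('a, 'b) dsum set \<Rightarrow> bool"
  where "open_dsum U \<longleftrightarrow> (\<forall>x\<in>U. eventually (\<lambda>(x', y). x' = x \<longrightarrow> y \<in> U) uniformity)"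

lemmas dsum_defs = zero_dsum_def one_dsum_def plus_dsum_def minus_dsum_def uminus_dsum_def
  times_dsum_def scaleR_dsum_def norm_dsum_def

instance
proof
  fix a b c :: "('a, 'b) dsum" and r s :: real and U :: "('a, 'b) dsum set"
  show "a + b + c = a + (b + c)" "a + b = b + a" "0 + a = a" "- a + a = 0" "a - b = a + - b"
    "r *\<^sub>R (a + b) = r *\<^sub>R a + r *\<^sub>R b" "(r + s) *\<^sub>R a = r *\<^sub>R a + s *\<^sub>R a"
    "r *\<^sub>R s *\<^sub>R a = (r * s) *\<^sub>R a" "1 *\<^sub>R a = a"
    "a * b * c = a * (b * c)" "(a + b) * c = a * c + b * c" "a * (b + c) = a * b + a * c"
    "1 * a = a" "a * 1 = a" "r *\<^sub>R a * b = r *\<^sub>R (a * b)" "a * r *\<^sub>R b = r *\<^sub>R (a * b)"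
    "(0 :: ('a, 'b) dsum) \<noteq> 1" "norm (1 :: ('a, 'b) dsum) = 1"
    by (simp_all add: dsum_defs algebra_simps)
  show "sgn a = inverse (norm a) *\<^sub>R a" by (rule sgn_dsum_def)
  show "dist a b = norm (a - b)" by (rule dist_dsum_def)
  show "(uniformity :: (('a, 'b) dsum \<times> ('a, 'b) dsum) filter) =
      (INF e\<in>{0<..}. principal {(x, y). dist x y < e})"
    by (rule uniformity_dsum_def)
  show "open U \<longleftrightarrow> (\<forall>x\<in>U. \<forall>\<^sub>F (x', y) in uniformity. x' = x \<longrightarrow> y \<in> U)"
    by (rule open_dsum_def)
  show "norm a = 0 \<longleftrightarrow> a = 0"
    by (cases a) (auto simp: dsum_defs max_def split: if_splits)
  have "norm (dfst a + dfst b) \<le> norm (dfst a) + norm (dfst b)"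
    "norm (dsnd a + dsnd b) \<le> norm (dsnd a) + norm (dsnd b)"
    by (rule norm_triangle_ineq)+
  then show "norm (a + b) \<le> norm a + norm b"
    by (auto simp: dsum_defs max_def)
  show "norm (r *\<^sub>R a) = \<bar>r\<bar> * norm a"
    by (simp add: dsum_defs max_mult_distrib_left)
  have "norm (dfst a * dfst b) \<le> norm a * norm b"
    by (rule order_trans[OF norm_mult_ineq mult_mono]) (simp_all add: norm_dsum_def le_max_iff_disj)
  moreover have "norm (dsnd a * dsnd b) \<le> norm a * norm b"
    by (rule order_trans[OF norm_mult_ineq mult_mono]) (simp_all add: norm_dsum_def le_max_iff_disj)
  moreover have "norm (a * b) = max (norm (dfst a * dfst b)) (norm (dsnd a * dsnd b))"
    by (simp add: dsum_defs)
  ultimately show "norm (a * b) \<le> norm a * norm b" by simp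
qed

end

instance dsum :: (cstar_algebra, cstar_algebra) banach
proof
  fix X :: "nat \<Rightarrow> ('a, 'b) dsum"
  assume X: "Cauchy X"
  have le: "dist (dfst x) (dfst y) \<le> dist x y" "dist (dsnd x) (dsnd y) \<le> dist x y"
    for x y :: "('a, 'b) dsum"
    by (simp_all add: dist_norm dsum_defs)
  have "Cauchy (\<lambda>n. dfst (X n))"
  proof (rule metric_CauchyI)
    fix e :: real assume "e > 0"
    with X obtain M where "\<And>m n. m \<ge> M \<Longrightarrow> n \<ge> M \<Longrightarrow> dist (X m) (X n) < e"
      using metric_CauchyD by blast
    then show "\<exists>M. \<forall>m\<ge>M. \<forall>n\<ge>M. dist (dfst (X m)) (dfst (X n)) < e"
      using le(1) order_le_less_trans by blast
  qed
  then have "convergent (\<lambda>n. dfst (X n))"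
    by (rule Cauchy_convergent)
  then obtain l where l: "(\<lambda>n. dfst (X n)) \<longlonglongrightarrow> l"
    unfolding convergent_def by blast
  have "Cauchy (\<lambda>n. dsnd (X n))"
  proof (rule metric_CauchyI)
    fix e :: real assume "e > 0"
    with X obtain M where "\<And>m n. m \<ge> M \<Longrightarrow> n \<ge> M \<Longrightarrow> dist (X m) (X n) < e"
      using metric_CauchyD by blast
    then show "\<exists>M. \<forall>m\<ge>M. \<forall>n\<ge>M. dist (dsnd (X m)) (dsnd (X n)) < e"
      using le(2) order_le_less_trans by blast
  qed
  then have "convergent (\<lambda>n. dsnd (X n))"
    by (rule Cauchy_convergent)
  then obtain m where m: "(\<lambda>n. dsnd (X n)) \<longlonglongrightarrow> m"
    unfolding convergent_def by blast
  have "(\<lambda>n. max (norm (dfst (X n) - l)) (norm (dsnd (X n) - m))) \<longlonglongrightarrow>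
      max (norm (l - l)) (norm (m - m))"
    by (intro tendsto_max tendsto_norm tendsto_diff tendsto_const l m)
  then have "(\<lambda>n. norm (X n - (l \<oplus> m))) \<longlonglongrightarrow> 0"
    by (simp add: dsum_defs)
  then have "X \<longlonglongrightarrow> l \<oplus> m"
    by (rule LIM_zero_cancel[OF tendsto_norm_zero_cancel])
  then show "convergent X" by (auto simp: convergent_def)
qed

instantiation dsum :: (cstar_algebra, cstar_algebra) cstar_algebra
begin

definition scaleC_dsum :: "complex \<Rightarrow> ('a, 'b) dsum \<Rightarrow> ('a, 'b) dsum"
  where "scaleC_dsum c x = (c *\<^sub>C dfst x) \<oplus> (c *\<^sub>C dsnd x)"
definition star_dsum :: "('a, 'b) dsum \<Rightarrow> ('a, 'b) dsum"
  where "star_dsum x = (dfst x)\<^sup>\<star> \<oplus> (dsnd x)\<^sup>\<star>"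

instance
proof
  fix a b :: "('a, 'b) dsum" and c d :: complex and r :: real
  show "c *\<^sub>C (a + b) = c *\<^sub>C a + c *\<^sub>C b" "(c + d) *\<^sub>C a = c *\<^sub>C a + d *\<^sub>C a"
    "c *\<^sub>C d *\<^sub>C a = (c * d) *\<^sub>C a" "r *\<^sub>R a = complex_of_real r *\<^sub>C a"
    "(c *\<^sub>C a) * b = c *\<^sub>C (a * b)" "a * (c *\<^sub>C b) = c *\<^sub>C (a * b)"
    "(a + b)\<^sup>\<star> = a\<^sup>\<star> + b\<^sup>\<star>" "(c *\<^sub>C a)\<^sup>\<star> = cnj c *\<^sub>C a\<^sup>\<star>"
    "(a * b)\<^sup>\<star> = b\<^sup>\<star> * a\<^sup>\<star>" "(a\<^sup>\<star>)\<^sup>\<star> = a"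
    by (simp_all add: dsum_defs scaleC_dsum_def star_dsum_def scaleC_add_right scaleC_add_left
        scaleC_scaleC scaleR_scaleC mult_scaleC_left mult_scaleC_right star_add star_scaleC
        star_mult star_star)
  show "norm (c *\<^sub>C a) = cmod c * norm a"
    by (simp add: dsum_defs scaleC_dsum_def norm_scaleC max_mult_distrib_left)
  show "norm (a\<^sup>\<star> * a) = (norm a)\<^sup>2"
    by (auto simp: dsum_defs star_dsum_def cstar_identity max_def abs_le_square_iff[symmetric]
        intro: antisym)
qed

end


section \<open>The operator system\<close>

type_synonym M2 = "2 cmat"

definition \<sigma>\<^sub>1 :: M2
  where "\<sigma>\<^sub>1 = CMat (vector [vector [0, 1], vector [1, 0]])"

definition \<sigma>\<^sub>2 :: M2
  where "\<sigma>\<^sub>2 = CMat (vector [vector [0, - \<i>], vector [\<i>, 0]])"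

definition X\<^sub>\<sigma> :: "(M2, M2) dsum"
  where "X\<^sub>\<sigma> = \<sigma>\<^sub>1 \<oplus> (2 *\<^sub>C \<sigma>\<^sub>1)"

definition Y\<^sub>\<sigma> :: "(M2, M2) dsum"
  where "Y\<^sub>\<sigma> = \<sigma>\<^sub>2 \<oplus> ((1 / 2) *\<^sub>C \<sigma>\<^sub>2)"

definition E\<^sub>\<sigma> :: "(M2, M2) dsum set"
  where "E\<^sub>\<sigma> = cspan {1 \<oplus> 1, X\<^sub>\<sigma>, Y\<^sub>\<sigma>}"

end

(*
  Put W = X/3 - (2i/3) Y, with adjoint W'. Then E is spanned by 1, W and W', and the two summands
  of W are e21 + k e12 with k = -1/3 and k = 1/3.

  Envelope. A complete order embedding j preserves norms and adjoints on E. For either sign eps let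
  V = (3/4)(W + eps W'); then W and V are contractions with norm (W + V) = 2. This persists for
  j(W) in any B generated by j(E). A state of B attaining the norm of (W + V)'(W + V) has, in its
  GNS space, a cyclic vector v with W v = V v and W'W v = v, which forces v and W v to span a
  two-dimensional invariant subspace on which W acts as e21 + (eps/3) e12. The two resulting
  representations together map B onto A; no extension theorem for completely positive maps is
  needed.

  Components. A self-adjoint element a + b X + c Y has the eigenvalues a +- |(b, c)| and
  a +- |(2b, c/2)|. Removing the two double cones from R^3 leaves the regions above and below both,
  the region between both, and eight regions between one cone and the other: the norms compare
  differently on the four wedges cut out by |c| = 2|b|, each wedge contributing for a > 0 and for
  a < 0. For the invertible elements, a complex line through two of them meets the zero set of the
  determinant in finitely many points.
*)

theory Submission
  imports Defs
begin

text \<open>The constants make V tell the two summands apart. In the summand with k = eps/3, V is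
  e21 + eps e12, a unitary that agrees with W on the first basis vector. In the other summand V is
  half of that, and W + V has norm only 3/2 there. So a state attaining norm 2 sees a single
  summand, and the two signs recover both. The obstacle is that j controls no products, only norms
  of combinations of W and W'. Products reappear from equality cases: besides the relations for W,
  attaining the norm gives V'V v = v, and since V' = eps V this determines W' v and W W v. The GNS
  space itself is never built: the compression to v, W v is written down from values of the state,
  and multiplicativity spreads from W and W' to all that they generate. States that attain norms
  rest on the positivity of w'w in an abstract C*-algebra. It is proved here without spectra, from
  the binomial series for square roots and norm estimates.\<close>

section \<open>Elementary C*-algebra theory\<close>

lemma scaleC_one [simp]: "1 *\<^sub>C x = (x :: 'a::cstar_algebra)"
  using complex_vector.scale_one .

lemma scaleC_minus_left: "(- c) *\<^sub>C x = - (c *\<^sub>C (x :: 'a::cstar_algebra))"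
  by (rule complex_vector.scale_minus_left)

lemma scaleC_diff_right: "c *\<^sub>C (x - y) = c *\<^sub>C x - c *\<^sub>C (y :: 'a::cstar_algebra)"
  by (rule complex_vector.scale_right_diff_distrib)

lemma scaleC_scaleR: "c *\<^sub>C (r *\<^sub>R x) = (c * of_real r) *\<^sub>C (x :: 'a::cstar_algebra)"
  by (simp add: scaleR_scaleC scaleC_scaleC)

lemma scaleR_scaleC_mult: "r *\<^sub>R (c *\<^sub>C x) = (of_real r * c) *\<^sub>C (x :: 'a::cstar_algebra)"
  by (simp add: scaleR_scaleC scaleC_scaleC)

lemma bounded_linear_scaleC_left: "bounded_linear (\<lambda>c. c *\<^sub>C (x :: 'a::cstar_algebra))"
  by (rule bounded_linear_intro[where K = "norm x"])
    (simp_all add: scaleC_add_left scaleR_scaleC scaleC_scaleC norm_scaleC scaleR_conv_of_real)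

lemma star_one [simp]: "1\<^sup>\<star> = (1 :: 'a::cstar_algebra)"
  by (metis mult.left_neutral star_mult star_star)

lemma star_zero [simp]: "0\<^sup>\<star> = (0 :: 'a::cstar_algebra)"
  by (metis add_cancel_right_right star_add)

lemma star_minus: "(- x)\<^sup>\<star> = - (x\<^sup>\<star>)" for x :: "'a::cstar_algebra"
  by (metis add.right_inverse add_eq_0_iff star_add star_zero)

lemma star_diff: "(x - y)\<^sup>\<star> = x\<^sup>\<star> - y\<^sup>\<star>" for x y :: "'a::cstar_algebra"
  by (metis diff_conv_add_uminus star_add star_minus)

lemma star_scaleR: "(r *\<^sub>R x)\<^sup>\<star> = r *\<^sub>R x\<^sup>\<star>" for x :: "'a::cstar_algebra"
  by (simp add: scaleR_scaleC star_scaleC)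

lemma star_sum: "(\<Sum>i\<in>I. f i)\<^sup>\<star> = (\<Sum>i\<in>I. (f i)\<^sup>\<star>)" for f :: "'i \<Rightarrow> 'a::cstar_algebra"
  by (induction I rule: infinite_finite_induct) (simp_all add: star_add)

lemma star_power: "(x ^ n)\<^sup>\<star> = (x\<^sup>\<star>) ^ n" for x :: "'a::cstar_algebra"
  by (induction n) (simp_all add: star_mult power_commutes)

lemmas star_simps = star_add star_diff star_minus star_scaleR star_scaleC star_mult star_star

lemma norm_star [simp]: "norm (x\<^sup>\<star>) = norm x" for x :: "'a::cstar_algebra"
proof -
  have le: "norm x \<le> norm (x\<^sup>\<star>)" for x :: 'a
  proof (cases "x = 0")
    case False
    have "norm x * norm x \<le> norm (x\<^sup>\<star>) * norm x"
      using norm_mult_ineq[of "x\<^sup>\<star>" x] by (simp add: cstar_identity power2_eq_square)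
    with False show ?thesis by simp
  qed simp
  from le[of x] le[of "x\<^sup>\<star>"] show ?thesis by (simp add: star_star)
qed

lemma bounded_linear_star: "bounded_linear (star :: 'a::cstar_algebra \<Rightarrow> 'a)"
  by (rule bounded_linear_intro[where K = 1]) (simp_all add: star_add star_scaleR)

lemma norm_selfadjoint_square: "x\<^sup>\<star> = x \<Longrightarrow> norm (x * x) = (norm x)\<^sup>2" for x :: "'a::cstar_algebra"
  using cstar_identity[of x] by simp

subsection \<open>Square roots\<close>

text \<open>The coefficient of x^k in the power series of (1 - x)^(1/2).\<close>

definition sqrt_coeff :: "nat \<Rightarrow> real"
  where "sqrt_coeff k = (- 1) ^ k * ((1/2) gchoose k)"

lemma sqrt_coeff_0 [simp]: "sqrt_coeff 0 = 1"
  by (simp add: sqrt_coeff_def)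

text \<open>In the rising-factorial form the first factor is -1/2 and all later ones are
  positive.\<close>

lemma sqrt_coeff_nonpos: "k > 0 \<Longrightarrow> sqrt_coeff k \<le> 0"
proof -
  assume "k > 0"
  then obtain m where k: "k = Suc m" using gr0_implies_Suc by blast
  have "sqrt_coeff k = pochhammer (- (1/2)) k / fact k"
    by (simp add: sqrt_coeff_def gbinomial_pochhammer flip: power_mult_distrib mult.assoc)
  also have "\<dots> = - (1/2) * pochhammer (1/2) m / fact k"
    by (simp add: k pochhammer_rec)
  also have "\<dots> \<le> 0"
    using pochhammer_nonneg[of "1/2 :: real" m] by (simp add: divide_nonpos_pos)
  finally show ?thesis .
qed

text \<open>Partial sums are the coefficients of (1 - x)^(1/2) / (1 - x) = (1 - x)^(-1/2), and those
  are positive.\<close>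

lemma sqrt_coeff_partial_sum_nonneg: "(\<Sum>k\<le>n. sqrt_coeff k) \<ge> 0"
proof -
  have "(\<Sum>k\<le>n. sqrt_coeff k) = (- 1) ^ n * ((1/2 - 1) gchoose n)"
    unfolding sqrt_coeff_def using gbinomial_sum_lower_neg[of "1/2::real" n] by (simp add: mult.commute)
  also have "\<dots> = pochhammer (1/2) n / fact n"
    by (simp add: gbinomial_pochhammer flip: power_mult_distrib mult.assoc)
  also have "\<dots> \<ge> 0"
    using pochhammer_nonneg[of "1/2 :: real" n] by simp
  finally show ?thesis .
qed

text \<open>All coefficients after the first are nonpositive, so taking absolute values only flips
  the sign, and nonnegative partial sums cap the total at the leading coefficient 1.\<close>

lemma sqrt_coeff_abs_partial_sum_le: "(\<Sum>k<n. \<bar>sqrt_coeff (Suc k)\<bar>) \<le> 1"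
proof -
  have "(\<Sum>k<n. \<bar>sqrt_coeff (Suc k)\<bar>) = (\<Sum>k<n. - sqrt_coeff (Suc k))"
    by (intro sum.cong refl) (simp add: sqrt_coeff_nonpos abs_of_nonpos)
  also have "\<dots> = 1 - (\<Sum>k\<le>n. sqrt_coeff k)"
    unfolding lessThan_Suc_atMost[symmetric]
    by (subst sum.lessThan_Suc_shift) (simp add: sum_negf)
  also have "\<dots> \<le> 1" using sqrt_coeff_partial_sum_nonneg by simp
  finally show ?thesis .
qed

lemma summable_abs_sqrt_coeff: "summable (\<lambda>k. \<bar>sqrt_coeff k\<bar>)"
proof -
  have "summable (\<lambda>k. \<bar>sqrt_coeff (Suc k)\<bar>)"
    by (rule summableI_nonneg_bounded[where x = 1]) (simp_all add: sqrt_coeff_abs_partial_sum_le)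
  then show ?thesis by (subst summable_Suc_iff[symmetric])
qed

text \<open>Vandermonde's identity turns the convolution into the coefficients of (1 - x)^1, so the
  series squares to 1 - x.\<close>

lemma sqrt_coeff_convolution:
  "(\<Sum>i\<le>k. sqrt_coeff i * sqrt_coeff (k - i)) = (if k = 0 then 1 else if k = 1 then - 1 else 0)"
proof -
  have "(\<Sum>i\<le>k. sqrt_coeff i * sqrt_coeff (k - i))
      = (\<Sum>i\<le>k. (- 1) ^ k * (((1/2) gchoose i) * ((1/2) gchoose (k - i))))"
  proof (intro sum.cong refl)
    fix i assume "i \<in> {..k}"
    then have "(- 1 :: real) ^ k = (- 1) ^ i * (- 1) ^ (k - i)" by (simp flip: power_add)
    then show "sqrt_coeff i * sqrt_coeff (k - i)
        = (- 1) ^ k * (((1/2) gchoose i) * ((1/2) gchoose (k - i)))"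
      by (simp add: sqrt_coeff_def)
  qed
  also have "\<dots> = (- 1) ^ k * (1 gchoose k)"
    using gbinomial_Vandermonde[of "1/2::real" "1/2" k] by (simp add: atMost_atLeast0 flip: sum_distrib_left)
  also have "(1 :: real) gchoose k = of_nat (1 choose k)"
    by (metis binomial_gbinomial of_nat_1)
  also have "(- 1) ^ k * (of_nat (1 choose k) :: real) = (if k = 0 then 1 else if k = 1 then - 1 else 0)"
    by (cases k; cases "k - 1") (auto simp: binomial_eq_0)
  finally show ?thesis .
qed

text \<open>The binomial series of \<open>(1 - x)\<^bsup>1/2\<^esup>\<close> converges absolutely also for \<open>\<parallel>x\<parallel> = 1\<close>.\<close>

lemma cstar_sqrt_one_minus:
  fixes x :: "'a::cstar_algebra"
  assumes sa: "x\<^sup>\<star> = x" and le: "norm x \<le> 1"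
  obtains s where "s\<^sup>\<star> = s" "s * s = 1 - x" "norm (1 - s) \<le> 1"
    "\<And>y. y * x = x * y \<Longrightarrow> y * s = s * y"
proof -
  define f where "f k = sqrt_coeff k *\<^sub>R x ^ k" for k
  define s where "s = (\<Sum>k. f k)"
  have pw: "norm (x ^ k) \<le> 1" for k
    by (rule order_trans[OF norm_power_ineq]) (simp add: le power_le_one)
  have nf: "norm (f k) \<le> \<bar>sqrt_coeff k\<bar>" for k
    using mult_left_mono[OF pw abs_ge_zero] by (simp add: f_def)
  have sn: "summable (\<lambda>k. norm (f k))"
    by (rule summable_comparison_test'[OF summable_abs_sqrt_coeff]) (simp add: nf)
  then have sf: "summable f" by (rule summable_norm_cancel)
  have "s\<^sup>\<star> = (\<Sum>k. (f k)\<^sup>\<star>)"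
    unfolding s_def by (rule bounded_linear.suminf[OF bounded_linear_star sf, symmetric, THEN sym])
  then have 1: "s\<^sup>\<star> = s" by (simp add: s_def f_def star_scaleR star_power sa)
  have "(\<lambda>k. \<Sum>i\<le>k. f i * f (k - i)) sums (s * s)"
    unfolding s_def by (rule Cauchy_product_sums[OF sn sn])
  moreover have "(\<Sum>i\<le>k. f i * f (k - i)) = (if k = 0 then 1 else if k = 1 then - x else 0)" for k
  proof -
    have "(\<Sum>i\<le>k. f i * f (k - i)) = (\<Sum>i\<le>k. (sqrt_coeff i * sqrt_coeff (k - i)) *\<^sub>R x ^ k)"
      by (intro sum.cong refl) (simp add: f_def flip: power_add)
    also have "\<dots> = (\<Sum>i\<le>k. sqrt_coeff i * sqrt_coeff (k - i)) *\<^sub>R x ^ k"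
      by (simp add: scaleR_sum_left)
    also have "\<dots> = (if k = 0 then 1 else if k = 1 then - x else 0)"
      by (simp add: sqrt_coeff_convolution)
    finally show ?thesis .
  qed
  moreover have "(\<lambda>k. if k = 0 then 1 else if k = 1 then - x else 0) sums
      (\<Sum>k\<in>{0, 1::nat}. if k = 0 then 1 else if k = 1 then - x else 0)"
    by (rule sums_finite) auto
  ultimately have 2: "s * s = 1 - x" using sums_unique2 by fastforce
  have snS: "summable (\<lambda>k. norm (f (Suc k)))" using sn by (subst summable_Suc_iff)
  \<comment> \<open>The tail has total weight at most 1. The resulting bound on \<open>1 - s\<close>
    is the norm criterion for positivity of \<open>s\<close>, so that \<open>s\<close> has a root in
    its turn.\<close>
  have "s = 1 + (\<Sum>k. f (Suc k))"
    unfolding s_def using suminf_split_head[OF sf] by (simp add: f_def algebra_simps)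
  then have "norm (1 - s) = norm (\<Sum>k. f (Suc k))" by simp
  also have "\<dots> \<le> (\<Sum>k. norm (f (Suc k)))" by (rule summable_norm[OF snS])
  also have "\<dots> \<le> 1"
    by (rule suminf_le_const[OF snS])
      (rule order_trans[OF sum_mono sqrt_coeff_abs_partial_sum_le], rule nf)
  finally have 3: "norm (1 - s) \<le> 1" .
  have 4: "y * s = s * y" if "y * x = x * y" for y
  proof -
    have "y * x ^ k = x ^ k * y" for k
      by (induction k) (simp_all add: that, metis mult.assoc that)
    then have "y * f k = f k * y" for k by (simp add: f_def)
    then show ?thesis
      unfolding s_def by (simp add: suminf_mult[OF sf, symmetric] suminf_mult2[OF sf])
  qed
  from 1 2 3 4 show ?thesis by (rule that)
qed

subsection \<open>Positive elements\<close>

text \<open>A spectrum-free notion. By \<open>norm_diff_positive_le\<close> and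
  \<open>positive_elemI\<close> it amounts, for self-adjoint \<open>a\<close>, to the estimate
  \<open>norm (c *\<^sub>R 1 - a) \<le> c\<close> for some \<open>c\<close>; this norm criterion is
  what the later arguments handle.\<close>

definition positive_elem :: "'a::cstar_algebra \<Rightarrow> bool"
  where "positive_elem a \<longleftrightarrow> (\<exists>h. h\<^sup>\<star> = h \<and> a = h * h)"

lemma positive_elem_selfadjoint: "positive_elem a \<Longrightarrow> a\<^sup>\<star> = a"
  by (auto simp: positive_elem_def star_mult)

lemma positive_elem_square: "h\<^sup>\<star> = h \<Longrightarrow> positive_elem (h * h)"
  by (auto simp: positive_elem_def)

lemma positive_elem_scaleR: "r \<ge> 0 \<Longrightarrow> positive_elem a \<Longrightarrow> positive_elem (r *\<^sub>R a)"
proof -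
  assume "r \<ge> 0" "positive_elem a"
  then obtain h where h: "h\<^sup>\<star> = h" "a = h * h" by (auto simp: positive_elem_def)
  have "(sqrt r *\<^sub>R h)\<^sup>\<star> = sqrt r *\<^sub>R h" "r *\<^sub>R a = (sqrt r *\<^sub>R h) * (sqrt r *\<^sub>R h)"
    using \<open>r \<ge> 0\<close> by (simp_all add: h star_scaleR)
  then show ?thesis by (auto simp: positive_elem_def)
qed

text \<open>\<open>h + \<i> s\<close> with \<open>s\<^sup>2 = 1 - h\<^sup>2\<close> is unitary and \<open>s\<close> is its imaginary part.\<close>

lemma norm_one_minus_square_le:
  fixes h :: "'a::cstar_algebra"
  assumes h: "h\<^sup>\<star> = h" and le: "norm h \<le> 1"
  shows "norm (1 - h * h) \<le> 1"
proof -
  have "(h * h)\<^sup>\<star> = h * h" by (simp add: star_mult h)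
  moreover have "norm (h * h) \<le> 1"
    using le by (simp add: norm_selfadjoint_square[OF h] power_le_one)
  ultimately obtain s where s: "s\<^sup>\<star> = s" "s * s = 1 - h * h" "\<And>y. y * (h * h) = (h * h) * y \<Longrightarrow> y * s = s * y"
    by (rule cstar_sqrt_one_minus) metis
  have c: "h * s = s * h" by (rule s(3)) (simp add: mult.assoc)
  define u where "u = h + \<i> *\<^sub>C s"
  have us: "u\<^sup>\<star> = h - \<i> *\<^sub>C s" by (simp add: u_def star_simps h s scaleC_minus_left)
  have "u\<^sup>\<star> * u = h * h + s * s"
    unfolding us unfolding u_def
    by (simp add: algebra_simps mult_scaleC_left mult_scaleC_right scaleC_scaleC c scaleC_minus_left)
  then have "(norm u)\<^sup>2 = 1" by (simp add: s flip: cstar_identity)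
  then have "norm u = 1" by (simp add: power2_eq_1_iff) (use norm_ge_zero[of u] in linarith)
  have "u - u\<^sup>\<star> = (2 * \<i>) *\<^sub>C s"
    unfolding us unfolding u_def using scaleC_add_left[of \<i> \<i> s] by simp
  then have "2 * norm s = norm (u - u\<^sup>\<star>)" by (simp add: norm_scaleC norm_mult)
  also have "\<dots> \<le> 2" using norm_triangle_ineq4[of u "u\<^sup>\<star>"] \<open>norm u = 1\<close> by simp
  finally have "norm s \<le> 1" by simp
  then show ?thesis by (simp add: norm_selfadjoint_square[OF s(1)] power_le_one flip: s(2))
qed

text \<open>Scaling the root of \<open>a\<close> by \<open>1 / sqrt c\<close> reduces this to
  \<open>norm_one_minus_square_le\<close>.\<close>

lemma norm_diff_positive_le:
  fixes a :: "'a::cstar_algebra"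
  assumes "positive_elem a" "norm a \<le> c"
  shows "norm (c *\<^sub>R 1 - a) \<le> c"
proof (cases "c = 0")
  case False
  with assms(2) have c: "c > 0" using norm_ge_zero[of a] by linarith
  from assms(1) obtain h where h: "h\<^sup>\<star> = h" "a = h * h" by (auto simp: positive_elem_def)
  define g where "g = (1 / sqrt c) *\<^sub>R h"
  have g: "g\<^sup>\<star> = g" by (simp add: g_def star_scaleR h)
  have a: "a = c *\<^sub>R (g * g)" using c by (simp add: g_def h)
  have "c * (norm g)\<^sup>2 \<le> c"
    using assms(2) c by (simp add: a norm_selfadjoint_square[OF g])
  with c have "(norm g)\<^sup>2 \<le> 1" by simp
  then have "norm g \<le> 1" by (simp add: power_le_one_iff abs_square_le_1[symmetric])
  then have "norm (1 - g * g) \<le> 1" by (rule norm_one_minus_square_le[OF g])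
  moreover have "c *\<^sub>R 1 - a = c *\<^sub>R (1 - g * g)" by (simp add: a scaleR_diff_right)
  ultimately show ?thesis using c by simp
qed (use assms in simp)

text \<open>The norm criterion reproduces itself: the root of \<open>a\<close> satisfies it with
  \<open>sqrt c\<close> in place of \<open>c\<close>. Applying \<open>ex\<close> a second time, to
  the root, therefore shows that the root is positive.\<close>

lemma positive_elem_sqrt:
  fixes a :: "'a::cstar_algebra"
  assumes a: "a\<^sup>\<star> = a" and le: "norm (c *\<^sub>R 1 - a) \<le> c"
  obtains h where "h\<^sup>\<star> = h" "h * h = a" "positive_elem h" "\<And>y. y * a = a * y \<Longrightarrow> y * h = h * y"
proof -
  have ex: "\<exists>h. h\<^sup>\<star> = h \<and> h * h = a \<and> norm (d *\<^sub>R 1 - h) \<le> d \<and> (\<forall>y. y * a = a * y \<longrightarrow> y * h = h * y)"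
    if a: "a\<^sup>\<star> = a" and le: "norm (c *\<^sub>R 1 - a) \<le> c" and d: "d = sqrt c" for a :: 'a and c d
  proof (cases "c = 0")
    case True
    with le d show ?thesis by (intro exI[of _ 0]) simp
  next
    case False
    then have c: "c > 0" using le norm_ge_zero[of "c *\<^sub>R 1 - a"] by linarith
    define x where "x = 1 - (1 / c) *\<^sub>R a"
    have x: "x = (1 / c) *\<^sub>R (c *\<^sub>R 1 - a)" using c by (simp add: x_def scaleR_diff_right)
    have "x\<^sup>\<star> = x" by (simp add: x_def star_simps a)
    moreover have "norm x \<le> 1" using le c by (simp add: x)
    ultimately obtain s where s: "s\<^sup>\<star> = s" "s * s = 1 - x" "norm (1 - s) \<le> 1"
        "\<And>y. y * x = x * y \<Longrightarrow> y * s = s * y"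
      by (rule cstar_sqrt_one_minus) metis
    have "d *\<^sub>R 1 - d *\<^sub>R s = d *\<^sub>R (1 - s)" by (simp add: scaleR_diff_right)
    moreover have "d \<ge> 0" using c d by simp
    ultimately have "norm (d *\<^sub>R 1 - d *\<^sub>R s) \<le> d" using s(3) by (simp add: mult_left_le)
    moreover have "(d *\<^sub>R s) * (d *\<^sub>R s) = a" using c by (simp add: d s x_def)
    moreover have "y * (d *\<^sub>R s) = (d *\<^sub>R s) * y" if "y * a = a * y" for y
      using s(4)[of y] that by (simp add: x_def algebra_simps)
    ultimately show ?thesis by (intro exI[of _ "d *\<^sub>R s"]) (simp add: star_scaleR s)
  qed
  from ex[OF a le refl] obtain h where h: "h\<^sup>\<star> = h" "h * h = a" "norm (sqrt c *\<^sub>R 1 - h) \<le> sqrt c"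
    "\<And>y. y * a = a * y \<Longrightarrow> y * h = h * y" by blast
  from ex[OF h(1) h(3) refl] have "positive_elem h" unfolding positive_elem_def by metis
  with h that show ?thesis by blast
qed

lemma positive_elemI: "a\<^sup>\<star> = a \<Longrightarrow> norm (c *\<^sub>R 1 - a) \<le> c \<Longrightarrow> positive_elem a"
  by (metis positive_elem_sqrt positive_elem_square)

text \<open>A sum of two squares is not visibly a square, but the norm criterion adds up by the
  triangle inequality.\<close>

lemma positive_elem_add: "positive_elem a \<Longrightarrow> positive_elem b \<Longrightarrow> positive_elem (a + b)"
proof -
  assume a: "positive_elem a" and b: "positive_elem b"
  have "(norm a + norm b) *\<^sub>R 1 - (a + b) = (norm a *\<^sub>R 1 - a) + (norm b *\<^sub>R 1 - b)"
    by (simp add: algebra_simps)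
  then have "norm ((norm a + norm b) *\<^sub>R 1 - (a + b)) \<le> norm a + norm b"
    using norm_diff_positive_le[OF a order_refl] norm_diff_positive_le[OF b order_refl]
      norm_triangle_le by (metis add_mono)
  then show ?thesis
    by (rule positive_elemI[rotated]) (simp add: star_add a b positive_elem_selfadjoint)
qed

text \<open>With commuting roots \<open>b\<close> of \<open>a\<close> and \<open>e\<close> of \<open>c - a\<close>, the element \<open>b + \<i> e\<close> has norm \<open>c\<^bsup>1/2\<^esup>\<close>.\<close>

lemma norm_positive_le:
  fixes a :: "'a::cstar_algebra"
  assumes a: "positive_elem a" and ca: "positive_elem (c *\<^sub>R 1 - a)" and "c \<ge> 0"
  shows "norm a \<le> c"
proof -
  from a obtain b where b: "b\<^sup>\<star> = b" "a = b * b" by (auto simp: positive_elem_def)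
  obtain e where e: "e\<^sup>\<star> = e" "e * e = c *\<^sub>R 1 - a"
    "\<And>y. y * (c *\<^sub>R 1 - a) = (c *\<^sub>R 1 - a) * y \<Longrightarrow> y * e = e * y"
    using positive_elem_sqrt[OF positive_elem_selfadjoint[OF ca] norm_diff_positive_le[OF ca order_refl]]
    by metis
  have c: "b * e = e * b" by (rule e(3)) (simp add: b(2) algebra_simps)
  define u where "u = b + \<i> *\<^sub>C e"
  have us: "u\<^sup>\<star> = b - \<i> *\<^sub>C e" by (simp add: u_def star_simps b(1) e scaleC_minus_left)
  have "u\<^sup>\<star> * u = b * b + e * e"
    unfolding us unfolding u_def
    by (simp add: algebra_simps mult_scaleC_left mult_scaleC_right scaleC_scaleC c scaleC_minus_left)
  also have "\<dots> = c *\<^sub>R 1" by (simp add: e b(2))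
  finally have u: "(norm u)\<^sup>2 = c" using \<open>c \<ge> 0\<close> by (simp flip: cstar_identity)
  have "u + u\<^sup>\<star> = 2 *\<^sub>R b" unfolding us unfolding u_def by (simp add: scaleR_2)
  then have "2 * norm b \<le> 2 * norm u" using norm_triangle_ineq[of u "u\<^sup>\<star>"] by simp
  then have "(norm b)\<^sup>2 \<le> c" using u by (metis mult_le_cancel_left_pos norm_ge_zero power_mono zero_less_numeral)
  then show ?thesis by (simp add: b(2) norm_selfadjoint_square[OF b(1)])
qed

lemma positive_elem_norm_diff:
  fixes d :: "'a::cstar_algebra"
  assumes d: "positive_elem d"
  shows "positive_elem (norm d *\<^sub>R 1 - d)"
  by (rule positive_elemI[of _ "norm d"])
    (simp_all add: star_simps positive_elem_selfadjoint[OF d])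

lemma norm_mono_positive:
  fixes a d :: "'a::cstar_algebra"
  assumes a: "positive_elem a" and da: "positive_elem (d - a)"
  shows "norm a \<le> norm d"
proof (rule norm_positive_le[OF a])
  from positive_elem_add[OF da a] have "positive_elem d" by simp
  from positive_elem_add[OF positive_elem_norm_diff[OF this] da]
  show "positive_elem (norm d *\<^sub>R 1 - a)" by simp
qed simp

text \<open>Recovers the norm of \<open>p\<close> from that of a scalar shift: if
  \<open>p + m\<close> has norm at most \<open>k\<close>, then \<open>k - m - p\<close> passes the
  norm criterion with constant \<open>k\<close>.\<close>

lemma norm_positive_shift_le:
  fixes p :: "'a::cstar_algebra"
  assumes p: "positive_elem p" and m: "norm (p + m *\<^sub>R 1) \<le> k" "m \<le> k"
  shows "norm p \<le> k - m"
proof (rule norm_positive_le[OF p])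
  have "k *\<^sub>R 1 - ((k - m) *\<^sub>R 1 - p) = p + m *\<^sub>R 1"
    by (simp add: algebra_simps)
  with m(1) have "norm (k *\<^sub>R 1 - ((k - m) *\<^sub>R 1 - p)) \<le> k" by (simp only:)
  then show "positive_elem ((k - m) *\<^sub>R 1 - p)"
    by (rule positive_elemI[rotated]) (simp add: star_simps positive_elem_selfadjoint[OF p])
qed (use m in simp)

text \<open>Up to scaling, \<open>h\<close> and \<open>k\<close> are the Cartesian parts of
  \<open>t\<close>; in the sum of their squares \<open>t * t\<close> and its adjoint cancel.\<close>

lemma star_mult_self_add_mult_star_self_positive:
  fixes t :: "'a::cstar_algebra"
  shows "positive_elem (t\<^sup>\<star> * t + t * t\<^sup>\<star>)"
proof -
  define h k where "h = t + t\<^sup>\<star>" and "k = \<i> *\<^sub>C (t - t\<^sup>\<star>)"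
  have "h\<^sup>\<star> = h" "k\<^sup>\<star> = k"
    by (simp_all add: h_def k_def star_simps add.commute scaleC_minus_left scaleC_diff_right)
  then have "positive_elem ((1/2) *\<^sub>R (h * h + k * k))"
    by (intro positive_elem_scaleR positive_elem_add positive_elem_square) simp
  moreover have "h * h + k * k = 2 *\<^sub>R (t\<^sup>\<star> * t + t * t\<^sup>\<star>)"
    by (simp add: h_def k_def mult_scaleC_left mult_scaleC_right scaleC_scaleC scaleC_minus_left
        algebra_simps scaleR_2)
  ultimately show ?thesis by simp
qed

text \<open>A norm argument in place of comparing the spectra of t't and t t'. If t't is negative,
  then p = t t' is positive of norm N, and p^2 + N p ought to have norm 2 N^2. But it equals t (N +
  t't) t', whose middle factor has norm at most N, so its norm is at most N^2.\<close>

lemma star_mult_self_negative_imp_zero: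
  fixes t :: "'a::cstar_algebra"
  assumes q: "positive_elem (- (t\<^sup>\<star> * t))"
  shows "t = 0"
proof -
  define p N where "p = t * t\<^sup>\<star>" and "N = (norm t)\<^sup>2"
  have N0: "N \<ge> 0" by (simp add: N_def)
  from positive_elem_add[OF star_mult_self_add_mult_star_self_positive[of t] q]
  have p: "positive_elem p" by (simp add: p_def)
  have pN: "norm p = N" using cstar_identity[of "t\<^sup>\<star>"] by (simp add: p_def N_def star_star)
  have "norm (N *\<^sub>R 1 + t\<^sup>\<star> * t) \<le> N"
    using norm_diff_positive_le[OF q, of N] by (simp add: cstar_identity N_def)
  then have "norm t * norm (N *\<^sub>R 1 + t\<^sup>\<star> * t) * norm (t\<^sup>\<star>) \<le> norm t * N * norm t"
    by (intro mult_mono) (simp_all add: N0)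
  moreover have "p * p + N *\<^sub>R p = t * (N *\<^sub>R 1 + t\<^sup>\<star> * t) * t\<^sup>\<star>"
    by (simp add: p_def algebra_simps)
  then have "norm (p * p + N *\<^sub>R p) \<le> norm t * norm (N *\<^sub>R 1 + t\<^sup>\<star> * t) * norm (t\<^sup>\<star>)"
    by (simp only:) (rule order_trans[OF norm_mult_ineq mult_right_mono[OF norm_mult_ineq norm_ge_zero]])
  ultimately have pp: "norm (p * p + N *\<^sub>R p) \<le> N * N"
    by (simp add: N_def power2_eq_square mult.assoc)
  \<comment> \<open>Completing the square turns the estimate into one for a self-adjoint element. As
    \<open>p\<close> has norm N, \<open>g\<close> should have norm 3/2 N, so the crude bound 5/4 N
    already forces N = 0.\<close>
  define g where "g = p + (N / 2) *\<^sub>R 1"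
  have "g * g = (p * p + N *\<^sub>R p) + (N * N / 4) *\<^sub>R 1"
  proof -
    have "N *\<^sub>R p = (N / 2) *\<^sub>R p + (N / 2) *\<^sub>R p" by (simp flip: scaleR_add_left)
    then show ?thesis by (simp add: g_def distrib_left distrib_right scaleR_add_right add.assoc)
  qed
  then have "norm (g * g) \<le> N * N + N * N / 4"
    using pp norm_triangle_ineq[of "p * p + N *\<^sub>R p" "(N * N / 4) *\<^sub>R 1"] by simp
  also have "\<dots> \<le> (5 / 4 * N)\<^sup>2" by (simp add: power2_eq_square)
  finally have "norm (g * g) \<le> (5 / 4 * N)\<^sup>2" .
  moreover have "g\<^sup>\<star> = g"
    by (simp add: g_def star_add star_scaleR positive_elem_selfadjoint[OF p])
  ultimately have "(norm g)\<^sup>2 \<le> (5 / 4 * N)\<^sup>2"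
    using norm_selfadjoint_square by metis
  then have "norm g \<le> 5 / 4 * N" by (rule power2_le_imp_le) (simp add: N0)
  then have "norm p \<le> 5 / 4 * N - N / 2"
    unfolding g_def by (rule norm_positive_shift_le[OF p]) (use N0 in simp)
  with pN N0 have "N = 0" by simp
  then show ?thesis by (simp add: N_def)
qed

text \<open>Here \<open>m\<close> is the absolute value of a = w'w, and b = m - a is twice the
  negative part of a. Then (w b)'(w b) = b a b = - (n b)^2 is negative, so w b vanishes and a has no
  negative part.\<close>

theorem star_mult_self_positive: "positive_elem (w\<^sup>\<star> * w)" for w :: "'a::cstar_algebra"
proof -
  define a where "a = w\<^sup>\<star> * w"
  have a: "a\<^sup>\<star> = a" by (simp add: a_def star_simps)
  have aa: "positive_elem (a * a)" by (rule positive_elem_square[OF a])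
  obtain m where m: "m\<^sup>\<star> = m" "m * m = a * a" "positive_elem m"
    "\<And>y. y * (a * a) = (a * a) * y \<Longrightarrow> y * m = m * y"
    using positive_elem_sqrt[OF positive_elem_selfadjoint[OF aa] norm_diff_positive_le[OF aa order_refl]]
    by metis
  have am: "a * m = m * a" by (rule m(4)) (simp add: mult.assoc)
  obtain n where n: "n\<^sup>\<star> = n" "n * n = m" "\<And>y. y * m = m * y \<Longrightarrow> y * n = n * y"
    using positive_elem_sqrt[OF m(1) norm_diff_positive_le[OF m(3) order_refl]] by metis
  define b where "b = m - a"
  have b: "b\<^sup>\<star> = b" by (simp add: b_def star_simps m a)
  have bn: "b * n = n * b" by (rule n(3)) (simp add: b_def algebra_simps am)
  have "b * a * b = - (b * m * b)"
  proof -
    have "(m + a) * b = 0" by (simp add: b_def algebra_simps am m)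
    then have "b * ((m + a) * b) = 0" by simp
    then show ?thesis by (simp add: algebra_simps eq_neg_iff_add_eq_0 add.commute)
  qed
  also have "b * m * b = (n * b) * (n * b)" by (metis bn mult.assoc n(2))
  finally have "- ((w * b)\<^sup>\<star> * (w * b)) = (n * b) * (n * b)"
    by (simp add: star_mult b a_def mult.assoc)
  moreover have "positive_elem ((n * b) * (n * b))"
    by (rule positive_elem_square) (simp add: star_mult b n bn)
  ultimately have "w * b = 0" by (intro star_mult_self_negative_imp_zero) simp
  then have ab: "a * b = 0" by (simp add: a_def mult.assoc)
  \<comment> \<open>Since m^2 = a^2, the square of \<open>b\<close> is a multiple of a b.\<close>
  have "b * b = 2 *\<^sub>R (a * a - a * m)" by (simp add: b_def algebra_simps am m scaleR_2)
  also have "\<dots> = - 2 *\<^sub>R (a * b)" by (simp add: b_def algebra_simps)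
  finally have "b * b = 0" by (simp add: ab)
  then have "b = 0" using norm_selfadjoint_square[OF b] by simp
  then show ?thesis using m by (simp add: b_def a_def)
qed

lemma sum_star_mult_self_positive:
  fixes z :: "nat \<Rightarrow> 'a::cstar_algebra"
  shows "positive_elem (\<Sum>k<n. (z k)\<^sup>\<star> * z k)"
proof (induction n)
  case 0
  show ?case using positive_elem_square[of "0::'a"] by simp
qed (simp add: positive_elem_add star_mult_self_positive)

subsection \<open>The norm in terms of the matrix order\<close>

text \<open>The matrix with rows 1, x' and x, 1. It is positive exactly if x is a contraction, so
  the order on 2 by 2 matrices determines the norm.\<close>

definition norm_matrix :: "'a::cstar_algebra \<Rightarrow> nat \<Rightarrow> nat \<Rightarrow> 'a"
  where "norm_matrix x i k = (if i = k then 1 else if i < k then x\<^sup>\<star> else x)"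

text \<open>
  With \<open>x = \<langle>\<zeta>\<^sub>1, \<zeta>\<^sub>0\<rangle>\<close> for unit vectors \<open>\<zeta>\<^sub>0, \<zeta>\<^sub>1\<close> of the Hilbert module \<open>A\<^sup>2\<close>, the Cauchy--Schwarz
  inequality reads \<open>0 \<le> \<langle>\<zeta>\<^sub>1 x - \<zeta>\<^sub>0, \<zeta>\<^sub>1 x - \<zeta>\<^sub>0\<rangle> = 1 - x\<^sup>\<star> x\<close>.
\<close>

lemma matrix_pos_norm_matrix_imp_norm_le:
  fixes x :: "'a::cstar_algebra"
  assumes M: "matrix_pos 2 M" and d: "M 0 0 = 1" "M 1 1 = 1" and x: "M 1 0 = x"
  shows "norm x \<le> 1" "M 0 1 = x\<^sup>\<star>"
proof -
  from M obtain Z :: "nat \<Rightarrow> nat \<Rightarrow> 'a"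
    where Z: "\<And>i j. i < 2 \<Longrightarrow> j < 2 \<Longrightarrow> M i j = (\<Sum>k<2. (Z k i)\<^sup>\<star> * Z k j)"
    unfolding matrix_pos_def by blast
  have z: "1 = (\<Sum>k<2. (Z k 0)\<^sup>\<star> * Z k 0)" "1 = (\<Sum>k<2. (Z k 1)\<^sup>\<star> * Z k 1)"
    "x = (\<Sum>k<2. (Z k 1)\<^sup>\<star> * Z k 0)"
    using Z[of 0 0] Z[of 1 1] Z[of 1 0] d x by simp_all
  have z01: "x\<^sup>\<star> = (\<Sum>k<2. (Z k 0)\<^sup>\<star> * Z k 1)"
    unfolding z(3) by (simp add: star_sum star_simps)
  then show xs: "M 0 1 = x\<^sup>\<star>" using Z[of 0 1] by simp
  have "(\<Sum>k<2. (Z k 1 * x - Z k 0)\<^sup>\<star> * (Z k 1 * x - Z k 0))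
      = x\<^sup>\<star> * (\<Sum>k<2. (Z k 1)\<^sup>\<star> * Z k 1) * x - x\<^sup>\<star> * (\<Sum>k<2. (Z k 1)\<^sup>\<star> * Z k 0)
        - (\<Sum>k<2. (Z k 0)\<^sup>\<star> * Z k 1) * x + (\<Sum>k<2. (Z k 0)\<^sup>\<star> * Z k 0)"
    by (simp add: star_simps numeral_2_eq_2 algebra_simps)
  also have "\<dots> = 1 - x\<^sup>\<star> * x"
    by (simp only: z(1,2,3)[symmetric] z01[symmetric]) simp
  finally have "positive_elem (1 - x\<^sup>\<star> * x)"
    using sum_star_mult_self_positive[where z = "\<lambda>k. Z k 1 * x - Z k 0" and n = 2] by simp
  then have "norm (x\<^sup>\<star> * x) \<le> 1"
    by (intro norm_positive_le) (simp_all add: star_mult_self_positive)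
  then show "norm x \<le> 1" by (simp add: cstar_identity power_le_one_iff abs_square_le_1[symmetric])
qed

lemma matrix_pos_norm_matrixI:
  fixes x :: "'a::cstar_algebra"
  assumes "norm x \<le> 1"
  shows "matrix_pos 2 (norm_matrix x)"
proof -
  have "(x\<^sup>\<star> * x)\<^sup>\<star> = x\<^sup>\<star> * x" "norm (x\<^sup>\<star> * x) \<le> 1"
    using assms by (simp_all add: star_simps cstar_identity power_le_one)
  then obtain s where s: "s\<^sup>\<star> = s" "s * s = 1 - x\<^sup>\<star> * x"
    by (rule cstar_sqrt_one_minus) metis
  \<comment> \<open>The triangular factor with rows \<open>s\<close>, 0 and \<open>x\<close>, 1; its
    Gram matrix is the norm matrix because s^2 + x'x = 1.\<close>
  define Z :: "nat \<Rightarrow> nat \<Rightarrow> 'a"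
    where "Z k i = (if k = 0 then if i = 0 then s else 0 else if i = 0 then x else 1)" for k i
  have "norm_matrix x i j = (\<Sum>k<2. (Z k i)\<^sup>\<star> * Z k j)" if "i < 2" "j < 2" for i j
    using that by (auto simp: norm_matrix_def Z_def numeral_2_eq_2 less_Suc_eq s)
  then show ?thesis unfolding matrix_pos_def by blast
qed

text \<open>Only 2 by 2 matrices enter. A positive matrix is self-adjoint, so positivity of the
  image of the norm matrix forces its corner j(x') to be the adjoint of j(x). Scaling extends both
  conclusions from contractions to all of \<open>E\<close>.\<close>

lemma unital_complete_order_embedding_star_isometry:
  fixes j :: "'a::cstar_algebra \<Rightarrow> 'b::cstar_algebra"
  assumes E: "operator_system E" and j: "unital_complete_order_embedding E j" and x: "x \<in> E"
  shows "j (x\<^sup>\<star>) = (j x)\<^sup>\<star>" "norm (j x) = norm x"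
proof -
  have scC: "j (c *\<^sub>C y) = c *\<^sub>C j y" if "y \<in> E" for c y
    using j that unfolding unital_complete_order_embedding_def by blast
  then have sc: "j (r *\<^sub>R y) = r *\<^sub>R j y" if "y \<in> E" for r y
    using that by (simp add: scaleR_scaleC)
  have E1: "1 \<in> E" and Es: "y \<in> E \<Longrightarrow> y\<^sup>\<star> \<in> E" and Esc: "y \<in> E \<Longrightarrow> r *\<^sub>R y \<in> E" for y r
    using E unfolding operator_system_def by (auto simp: scaleR_scaleC complex_vector.subspace_def)
  have j1: "j 1 = 1" using j unfolding unital_complete_order_embedding_def by blast
  have pos: "matrix_pos 2 (norm_matrix y) \<longleftrightarrow> matrix_pos 2 (\<lambda>i k. j (norm_matrix y i k))" if "y \<in> E" for y
    using j that E1 Es[OF that] unfolding unital_complete_order_embedding_def norm_matrix_def by auto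
  have contr: "norm (j y) \<le> 1 \<and> j (y\<^sup>\<star>) = (j y)\<^sup>\<star>" if y: "y \<in> E" "norm y \<le> 1" for y
  proof -
    have M: "matrix_pos 2 (\<lambda>i k. j (norm_matrix y i k))"
      using pos[OF y(1)] matrix_pos_norm_matrixI[OF y(2)] by simp
    from matrix_pos_norm_matrix_imp_norm_le[OF M, of "j y"] show ?thesis
      by (simp add: norm_matrix_def j1)
  qed
  have js: "j (y\<^sup>\<star>) = (j y)\<^sup>\<star>" if y: "y \<in> E" for y
  proof (cases "y = 0")
    case True
    with sc[OF y, of 0] show ?thesis by simp
  next
    case False
    define r where "r = 1 / norm y"
    have "r \<noteq> 0" "norm (r *\<^sub>R y) \<le> 1" using False by (simp_all add: r_def)
    with contr[OF Esc[OF y, of r]] show ?thesis by (simp add: star_scaleR sc y Es)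
  qed
  then show "j (x\<^sup>\<star>) = (j x)\<^sup>\<star>" using x .
  have iso: "norm y \<le> 1 \<longleftrightarrow> norm (j y) \<le> 1" if y: "y \<in> E" for y
  proof
    assume "norm (j y) \<le> 1"
    then have "matrix_pos 2 (norm_matrix (j y))" by (rule matrix_pos_norm_matrixI)
    moreover have "norm_matrix (j y) = (\<lambda>i k. j (norm_matrix y i k))"
      by (simp add: norm_matrix_def fun_eq_iff j1 js[OF y])
    ultimately have "matrix_pos 2 (norm_matrix y)" using pos[OF y] by simp
    from matrix_pos_norm_matrix_imp_norm_le(1)[OF this] show "norm y \<le> 1"
      by (simp add: norm_matrix_def)
  qed (simp add: contr[OF y])
  \<comment> \<open>Scaling by \<open>1 / r\<close> requires \<open>r > 0\<close>; passing to the
    limit with \<open>dense_ge\<close> also covers norm zero.\<close>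
  have eq: "norm x \<le> r \<longleftrightarrow> norm (j x) \<le> r" if "r > 0" for r
    using iso[OF Esc[OF x, of "1 / r"]] that by (simp add: sc[OF x])
  show "norm (j x) = norm x"
  proof (rule order_antisym)
    show "norm (j x) \<le> norm x"
    proof (rule dense_ge)
      fix r assume "norm x < r"
      with norm_ge_zero[of x] have "r > 0" by linarith
      with eq[of r] \<open>norm x < r\<close> show "norm (j x) \<le> r" by simp
    qed
    show "norm x \<le> norm (j x)"
    proof (rule dense_ge)
      fix r assume "norm (j x) < r"
      with norm_ge_zero[of "j x"] have "r > 0" by linarith
      with eq[of r] \<open>norm (j x) < r\<close> show "norm x \<le> r" by simp
    qed
  qed
qed

subsection \<open>The Hahn--Banach theorem\<close>

definition sublinear :: "('v::real_vector \<Rightarrow> real) \<Rightarrow> bool"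
  where "sublinear q \<longleftrightarrow> (\<forall>x y. q (x + y) \<le> q x + q y) \<and> (\<forall>r x. r \<ge> 0 \<longrightarrow> q (r *\<^sub>R x) = r * q x)"

lemma sublinear_zero: "sublinear q \<Longrightarrow> q 0 = 0"
  unfolding sublinear_def by (elim conjE allE[of _ "0::real"]) simp

lemma sublinear_minus: "sublinear q \<Longrightarrow> - q (- x) \<le> q x"
proof -
  assume q: "sublinear q"
  then have "q (x + - x) \<le> q x + q (- x)" unfolding sublinear_def by blast
  then show ?thesis using sublinear_zero[OF q] by simp
qed

text \<open>Serves two infima: over the shifts along a ray, and over a chain in Zorn's lemma.
  Subadditivity needs one index that does as well as two given ones, namely the sum of the shifts or
  the smaller functional.\<close>

lemma sublinear_cINF:
  fixes q :: "'i \<Rightarrow> 'v::real_vector \<Rightarrow> real"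
  assumes ne: "I \<noteq> {}" and bdd: "\<And>x. bdd_below ((\<lambda>i. q i x) ` I)"
    and add: "\<And>i k x y. i \<in> I \<Longrightarrow> k \<in> I \<Longrightarrow> \<exists>l\<in>I. q l (x + y) \<le> q i x + q k y"
    and scale: "\<And>i r x. i \<in> I \<Longrightarrow> r > 0 \<Longrightarrow> \<exists>l\<in>I. q l (r *\<^sub>R x) \<le> r * q i x"
    and zero: "(INF i\<in>I. q i 0) = 0"
  shows "sublinear (\<lambda>x. INF i\<in>I. q i x)"
proof -
  let ?p = "\<lambda>x. INF i\<in>I. q i x"
  have "?p (x + y) \<le> ?p x + ?p y" for x y
  proof -
    have "?p (x + y) - q k y \<le> q i x" if ik: "i \<in> I" "k \<in> I" for i k
    proof -
      from add[OF ik] obtain l where l: "l \<in> I" "q l (x + y) \<le> q i x + q k y" by blast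
      with cINF_lower[OF bdd l(1), of "x + y"] show ?thesis by linarith
    qed
    then have "?p (x + y) - q k y \<le> ?p x" if "k \<in> I" for k
      using that by (intro cINF_greatest[OF ne]) auto
    then have "?p (x + y) - ?p x \<le> q k y" if "k \<in> I" for k using that by fastforce
    then have "?p (x + y) - ?p x \<le> ?p y" by (intro cINF_greatest[OF ne])
    then show ?thesis by simp
  qed
  moreover have le: "?p (r *\<^sub>R x) \<le> r * ?p x" if r: "r > 0" for r x
  proof -
    have "?p (r *\<^sub>R x) / r \<le> q i x" if i: "i \<in> I" for i
    proof -
      from scale[OF i r] obtain l where l: "l \<in> I" "q l (r *\<^sub>R x) \<le> r * q i x" by blast
      with cINF_lower[OF bdd l(1), of "r *\<^sub>R x"] have "?p (r *\<^sub>R x) \<le> r * q i x" by linarith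
      with r show ?thesis by (simp add: field_simps)
    qed
    then have "?p (r *\<^sub>R x) / r \<le> ?p x" by (intro cINF_greatest[OF ne])
    with r show ?thesis by (simp add: field_simps)
  qed
  moreover have "?p (r *\<^sub>R x) = r * ?p x" if "r \<ge> 0" for r x
  proof (cases "r = 0")
    case False
    with that have r: "r > 0" by simp
    have "r * ?p x \<le> ?p (r *\<^sub>R x)"
      using le[of "1 / r" "r *\<^sub>R x"] r by (simp add: field_simps)
    with le[OF r] show ?thesis by (simp add: order_antisym)
  qed (simp add: zero)
  ultimately show ?thesis unfolding sublinear_def by blast
qed

text \<open>Takes the infimum over t >= 0 of q(x + t y) - t q(y). At x = -y the last property gives
  p(-y) <= - q(y), so a linear functional below \<open>p\<close> takes at least the value q(y) at
  y.\<close>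

lemma sublinear_directional_decrease:
  fixes q :: "'v::real_vector \<Rightarrow> real"
  assumes q: "sublinear q"
  obtains p where "sublinear p" "p \<le> q" "\<And>x. p x \<le> q (x + y) - q y"
proof -
  let ?p = "\<lambda>x. INF t\<in>{0..}. q (x + t *\<^sub>R y) - t * q y"
  have add: "q (x + z) \<le> q x + q z" for x z using q unfolding sublinear_def by blast
  have sc: "r \<ge> 0 \<Longrightarrow> q (r *\<^sub>R x) = r * q x" for r x using q unfolding sublinear_def by blast
  have low: "- q (- x) \<le> q (x + t *\<^sub>R y) - t * q y" if "t \<ge> 0" for t x
    using add[of "x + t *\<^sub>R y" "- x"] by (simp add: sc[OF that])
  have bdd: "bdd_below ((\<lambda>t. q (x + t *\<^sub>R y) - t * q y) ` {0..})" for x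
    by (rule bdd_belowI2[where m = "- q (- x)"]) (simp add: low)
  have le: "?p x \<le> q (x + t *\<^sub>R y) - t * q y" if "t \<ge> 0" for t x
    by (rule cINF_lower[OF bdd]) (simp add: that)
  have "sublinear ?p"
  proof (rule sublinear_cINF[OF _ bdd])
    fix s t :: real and x z assume st: "s \<in> {0..}" "t \<in> {0..}"
    have "x + z + (s + t) *\<^sub>R y = (x + s *\<^sub>R y) + (z + t *\<^sub>R y)" by (simp add: algebra_simps)
    with add[of "x + s *\<^sub>R y" "z + t *\<^sub>R y"] st
    show "\<exists>l\<in>{0..}. q (x + z + l *\<^sub>R y) - l * q y
        \<le> q (x + s *\<^sub>R y) - s * q y + (q (z + t *\<^sub>R y) - t * q y)"
      by (intro bexI[of _ "s + t"]) (simp_all add: algebra_simps)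
  next
    fix t r :: real and x assume t: "t \<in> {0..}" and r: "r > 0"
    have "r *\<^sub>R x + (r * t) *\<^sub>R y = r *\<^sub>R (x + t *\<^sub>R y)"
      by (simp add: scaleR_add_right)
    then have "q (r *\<^sub>R x + (r * t) *\<^sub>R y) = r * q (x + t *\<^sub>R y)" using sc r by simp
    then show "\<exists>l\<in>{0..}. q (r *\<^sub>R x + l *\<^sub>R y) - l * q y \<le> r * (q (x + t *\<^sub>R y) - t * q y)"
      using t r by (intro bexI[of _ "r * t"]) (simp_all add: right_diff_distrib)
  next
    have "(INF t\<in>{0..}. q (0 + t *\<^sub>R y) - t * q y) = (INF t\<in>{0::real..}. 0)"
      by (intro INF_cong refl) (simp add: sc)
    then show "(INF t\<in>{0..}. q (0 + t *\<^sub>R y) - t * q y) = 0" by simp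
  qed simp
  moreover have "?p \<le> q" using le[of 0] by (intro le_funI) simp
  moreover have "?p x \<le> q (x + y) - q y" for x using le[of 1] by simp
  ultimately show ?thesis by (rule that)
qed

text \<open>A minimal sublinear functional is linear.\<close>

lemma sublinear_dominates_linear:
  fixes p :: "'v::real_vector \<Rightarrow> real"
  assumes p: "sublinear p"
  obtains f where "linear f" "f \<le> p"
proof -
  define A where "A = {q. sublinear q \<and> q \<le> p}"
  \<comment> \<open>The order is reversed, since \<open>predicate_Zorn\<close> produces maximal
    elements and a minimal functional is wanted.\<close>
  define P where "P = (\<lambda>f g :: 'v \<Rightarrow> real. g \<le> f)"
  have "\<exists>m\<in>A. \<forall>a\<in>A. P m a \<longrightarrow> a = m"
  proof (rule predicate_Zorn)
    show "partial_order_on A (relation_of P A)"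
      by (rule partial_order_on_relation_ofI) (auto simp: P_def)
    fix C assume C: "C \<in> Chains (relation_of P A)"
    then have CA: "C \<subseteq> A" by (auto simp: Chains_def relation_of_def)
    have ch: "q \<le> r \<or> r \<le> q" if "q \<in> C" "r \<in> C" for q r
      using C that by (auto simp: Chains_def relation_of_def P_def)
    show "\<exists>u\<in>A. \<forall>a\<in>C. P a u"
    proof (cases "C = {}")
      case True
      with p show ?thesis by (auto simp: A_def)
    next
      case False
      let ?u = "\<lambda>x. INF q\<in>C. q x"
      have sub: "sublinear q" "q \<le> p" if "q \<in> C" for q using that CA by (auto simp: A_def)
      have bdd: "bdd_below ((\<lambda>q. q x) ` C)" for x
      proof (rule bdd_belowI2[where m = "- p (- x)"])
        fix q assume q: "q \<in> C"
        then show "- p (- x) \<le> q x"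
          using sublinear_minus[OF sub(1)[OF q], of x] le_funD[OF sub(2)[OF q], of "- x"] by linarith
      qed
      have "sublinear ?u"
      proof (rule sublinear_cINF[OF False bdd])
        fix q r x y assume qr: "q \<in> C" "r \<in> C"
        have "\<exists>l\<in>C. l \<le> q \<and> l \<le> r" using ch[OF qr] qr by blast
        then obtain l where l: "l \<in> C" "l \<le> q" "l \<le> r" by blast
        have "l (x + y) \<le> l x + l y" using sub(1)[OF l(1)] unfolding sublinear_def by blast
        with l le_funD[OF l(2), of x] le_funD[OF l(3), of y]
        show "\<exists>l\<in>C. l (x + y) \<le> q x + r y" by (intro bexI[of _ l]) auto
      next
        fix q r x assume "q \<in> C" "(r::real) > 0"
        then show "\<exists>l\<in>C. l (r *\<^sub>R x) \<le> r * q x"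
          using sub(1) unfolding sublinear_def by (intro bexI[of _ q]) auto
      next
        have "(INF q\<in>C. q 0) = (INF q\<in>C. 0)"
          by (intro INF_cong refl) (simp add: sub sublinear_zero)
        with False show "(INF q\<in>C. q 0) = 0" by simp
      qed
      moreover have le: "?u \<le> q" if "q \<in> C" for q
        by (rule le_funI) (rule cINF_lower[OF bdd that])
      moreover have "?u \<le> p" using le sub(2) False by fastforce
      ultimately show ?thesis by (intro bexI[of _ ?u]) (auto simp: P_def A_def)
    qed
  qed
  then obtain m where m: "sublinear m" "m \<le> p" and min: "\<And>a. sublinear a \<Longrightarrow> a \<le> m \<Longrightarrow> a = m"
    unfolding A_def P_def by (metis (mono_tags, lifting) mem_Collect_eq order_trans)
  \<comment> \<open>By minimality the decrease of \<open>m\<close> in direction \<open>y\<close> is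
    \<open>m\<close> again, which yields superadditivity.\<close>
  have add: "m (x + y) = m x + m y" for x y
  proof -
    obtain a where a: "sublinear a" "a \<le> m" "\<And>x. a x \<le> m (x + y) - m y"
      using sublinear_directional_decrease[OF m(1)] by blast
    with min have "m x \<le> m (x + y) - m y" by metis
    moreover have "m (x + y) \<le> m x + m y" using m(1) unfolding sublinear_def by blast
    ultimately show ?thesis by simp
  qed
  have neg: "m (- x) = - m x" for x using add[of x "- x"] sublinear_zero[OF m(1)] by simp
  have "m (r *\<^sub>R x) = r * m x" for r x
  proof (cases "r \<ge> 0")
    case False
    then have "m ((- r) *\<^sub>R x) = (- r) * m x" using m(1) unfolding sublinear_def by (metis linear neg_0_le_iff_le)
    then show ?thesis using neg[of "r *\<^sub>R x"] by simp
  qed (use m(1) in \<open>simp add: sublinear_def\<close>)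
  then have "linear m" by (intro linearI) (simp_all add: add)
  then show ?thesis using m(2) by (rule that)
qed

text \<open>Decreasing the norm in direction \<open>y\<close> before choosing a linear functional
  below it forces the value at \<open>y\<close>, so nothing has to be extended from a
  subspace.\<close>

lemma norming_functional:
  fixes y :: "'v::real_normed_vector"
  obtains f where "linear f" "\<And>x. f x \<le> norm x" "f y = norm y"
proof -
  have "sublinear (norm :: 'v \<Rightarrow> real)" by (auto simp: sublinear_def norm_triangle_ineq)
  then obtain p where p: "sublinear p" "p \<le> norm" "\<And>x. p x \<le> norm (x + y) - norm y"
    using sublinear_directional_decrease[of norm y] by blast
  from sublinear_dominates_linear[OF p(1)] obtain f where f: "linear f" "f \<le> p" .
  have le: "f x \<le> norm x" for x using f(2) p(2) by (meson le_funD order_trans)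
  have "f (- y) \<le> - norm y" using le_funD[OF f(2), of "- y"] p(3)[of "- y"] by simp
  then have "f y = norm y" using le[of y] linear_neg[OF f(1), of y] by simp
  with f(1) le show ?thesis by (rule that)
qed

subsection \<open>States\<close>

text \<open>Stated as a contractive unital functional, which is what the Hahn--Banach argument
  delivers; positivity is derived from it.\<close>

locale cstar_state =
  fixes \<phi> :: "'a::cstar_algebra \<Rightarrow> complex"
  assumes add: "\<phi> (x + y) = \<phi> x + \<phi> y"
    and scaleC: "\<phi> (c *\<^sub>C x) = c * \<phi> x"
    and bound: "cmod (\<phi> x) \<le> norm x"
    and one: "\<phi> 1 = 1"
begin

lemma minus: "\<phi> (- x) = - \<phi> x"
  using scaleC[of "- 1" x] by (simp add: scaleC_minus_left)

lemma diff: "\<phi> (x - y) = \<phi> x - \<phi> y"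
  using add[of x "- y"] by (simp add: minus)

lemma zero: "\<phi> 0 = 0"
  using diff[of 0 0] by simp

lemma scaleR: "\<phi> (r *\<^sub>R x) = of_real r * \<phi> x"
  by (simp add: scaleR_scaleC scaleC)

lemmas linear_simps = add minus diff zero scaleC scaleR one

text \<open>Shifting x by i t raises the square of the norm by at most t^2, but the square of the
  imaginary part b by 2 b t + t^2.\<close>

lemma Im_selfadjoint: 
  assumes x: "x\<^sup>\<star> = x"
  shows "Im (\<phi> x) = 0"
proof (rule ccontr)
  let ?b = "Im (\<phi> x)"
  assume b: "?b \<noteq> 0"
  have le: "(?b + t)\<^sup>2 \<le> (norm x)\<^sup>2 + t\<^sup>2" for t
  proof -
    define y where "y = x + (\<i> * of_real t) *\<^sub>C 1"
    have ys: "y\<^sup>\<star> = x - (\<i> * of_real t) *\<^sub>C 1"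
      by (simp add: y_def star_simps x scaleC_minus_left)
    have "y\<^sup>\<star> * y = x * x + t\<^sup>2 *\<^sub>R 1"
      unfolding ys unfolding y_def
      by (simp add: algebra_simps mult_scaleC_left mult_scaleC_right scaleC_scaleC scaleR_scaleC
          power2_eq_square complex_vector.scale_minus_left)
    then have "(norm y)\<^sup>2 \<le> (norm x)\<^sup>2 + t\<^sup>2"
      using norm_triangle_ineq[of "x * x" "t\<^sup>2 *\<^sub>R 1"]
      by (simp add: norm_selfadjoint_square[OF x] flip: cstar_identity)
    moreover have "\<bar>?b + t\<bar> \<le> norm y"
      using abs_Im_le_cmod[of "\<phi> y"] bound[of y] by (simp add: y_def linear_simps)
    then have "(?b + t)\<^sup>2 \<le> (norm y)\<^sup>2" by (metis abs_ge_zero power2_abs power_mono)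
    ultimately show ?thesis by simp
  qed
  \<comment> \<open>With this t, the term 2 b t is the square of the norm of x plus 1.\<close>
  from le[of "((norm x)\<^sup>2 + 1) / (2 * ?b)"] b zero_le_power2[of ?b] show False
    by (simp add: power2_sum)
qed

lemma star: "\<phi> (x\<^sup>\<star>) = cnj (\<phi> x)"
proof -
  have "Im (\<phi> (x + x\<^sup>\<star>)) = 0" by (rule Im_selfadjoint) (simp add: star_simps add.commute)
  moreover have "Im (\<phi> (\<i> *\<^sub>C (x - x\<^sup>\<star>))) = 0"
    by (rule Im_selfadjoint) (simp add: star_simps scaleC_minus_left scaleC_diff_right)
  ultimately show ?thesis by (simp add: linear_simps complex_eq_iff)
qed

text \<open>The value lies in the disc of radius \<open>norm a\<close> about
  \<open>norm a\<close>.\<close>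

lemma Re_positive: "positive_elem a \<Longrightarrow> 0 \<le> Re (\<phi> a)"
proof -
  assume a: "positive_elem a"
  have "cmod (of_real (norm a) - \<phi> a) \<le> norm a"
    using order_trans[OF bound norm_diff_positive_le[OF a order_refl]]
    by (simp add: linear_simps)
  then show ?thesis using abs_Re_le_cmod[of "of_real (norm a) - \<phi> a"] by simp
qed

lemma Re_star_mult_self: "0 \<le> Re (\<phi> (x\<^sup>\<star> * x))"
  by (rule Re_positive[OF star_mult_self_positive])

lemma Re_star_mult_self_le: "norm x \<le> 1 \<Longrightarrow> Re (\<phi> (x\<^sup>\<star> * x)) \<le> 1"
  using complex_Re_le_cmod[of "\<phi> (x\<^sup>\<star> * x)"] bound[of "x\<^sup>\<star> * x"]
  by (simp add: cstar_identity power_le_one order_trans[of _ "(norm x)\<^sup>2" 1])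

text \<open>Cauchy--Schwarz at a null vector: moving x by - s c b', where c is the value at b x,
  gives the form the value |c|^2 (s^2 M - 2 s), which is negative for small s > 0 unless c =
  0.\<close>

lemma null_left_ideal:
  assumes x: "Re (\<phi> (x\<^sup>\<star> * x)) = 0"
  shows "\<phi> (b * x) = 0"
proof (rule ccontr)
  define c where "c = \<phi> (b * x)"
  define M where "M = Re (\<phi> (b * b\<^sup>\<star>))"
  assume "\<phi> (b * x) \<noteq> 0"
  then have c: "(cmod c)\<^sup>2 > 0" by (simp add: c_def)
  have le: "2 * s \<le> s\<^sup>2 * M" for s
  proof -
    define t where "t = - (of_real s * c)"
    have "\<phi> ((x + t *\<^sub>C b\<^sup>\<star>)\<^sup>\<star> * (x + t *\<^sub>C b\<^sup>\<star>))
        = \<phi> (x\<^sup>\<star> * x) + t * \<phi> (x\<^sup>\<star> * b\<^sup>\<star>) + cnj t * c + t * cnj t * \<phi> (b * b\<^sup>\<star>)"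
      by (simp add: star_simps distrib_left distrib_right mult_scaleC_left mult_scaleC_right
          scaleC_scaleC linear_simps c_def algebra_simps)
    moreover have "\<phi> (x\<^sup>\<star> * b\<^sup>\<star>) = cnj c" using star[of "b * x"] by (simp add: star_mult c_def)
    moreover have cc: "c * cnj c = of_real ((cmod c)\<^sup>2)" by (rule complex_norm_square[symmetric])
    have "t * cnj c = - of_real s * (c * cnj c)" "cnj t * c = - of_real s * (c * cnj c)"
      "t * cnj t = of_real (s\<^sup>2) * (c * cnj c)"
      by (simp_all add: t_def power2_eq_square)
    note this[unfolded cc]
    ultimately have "Re (\<phi> ((x + t *\<^sub>C b\<^sup>\<star>)\<^sup>\<star> * (x + t *\<^sub>C b\<^sup>\<star>)))
        = - 2 * s * (cmod c)\<^sup>2 + s\<^sup>2 * (cmod c)\<^sup>2 * M"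
      by (simp add: x M_def)
    with Re_star_mult_self[of "x + t *\<^sub>C b\<^sup>\<star>"]
    have "0 \<le> (cmod c)\<^sup>2 * (s\<^sup>2 * M - 2 * s)" by (simp add: algebra_simps)
    with c show ?thesis by (simp add: zero_le_mult_iff)
  qed
  have "M \<ge> 0" using Re_star_mult_self[of "b\<^sup>\<star>"] by (simp add: M_def star_star)
  then have "(1 / (M + 1))\<^sup>2 * M < 2 * (1 / (M + 1))"
    by (simp add: power2_eq_square field_simps add_nonneg_pos add_pos_nonneg)
  with le[of "1 / (M + 1)"] show False by linarith
qed

text \<open>If s^2 = 1 - x'x, then \<open>s\<close> is null for the state; in GNS terms x'x fixes
  the cyclic vector.\<close>

lemma absorb_isometric:
  assumes x: "norm x \<le> 1" and "Re (\<phi> (x\<^sup>\<star> * x)) = 1"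
  shows "\<phi> (b * (x\<^sup>\<star> * x)) = \<phi> b"
proof -
  have "(x\<^sup>\<star> * x)\<^sup>\<star> = x\<^sup>\<star> * x" "norm (x\<^sup>\<star> * x) \<le> 1"
    using x by (simp_all add: star_simps cstar_identity power_le_one)
  then obtain s where s: "s\<^sup>\<star> = s" "s * s = 1 - x\<^sup>\<star> * x"
    by (rule cstar_sqrt_one_minus) metis
  have "Re (\<phi> (s\<^sup>\<star> * s)) = 0" using assms(2) by (simp add: s linear_simps)
  then have "\<phi> (b * s * s) = 0" by (rule null_left_ideal)
  also have "b * s * s = b - b * (x\<^sup>\<star> * x)" using s(2) by (simp add: mult.assoc right_diff_distrib)
  finally show ?thesis by (simp add: linear_simps)
qed

end

text \<open>A functional of norm one that is norming for \<open>1 + a\<close> is a state and norming for \<open>a\<close>.\<close>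

lemma norming_state:
  fixes a :: "'a::cstar_algebra"
  assumes a: "positive_elem a"
  obtains \<phi> where "cstar_state \<phi>" "\<phi> a = of_real (norm a)"
proof -
  obtain f where f: "linear f" "\<And>x. f x \<le> norm x" "f (1 + a) = norm (1 + a)"
    by (rule norming_functional[of "1 + a"]) metis
  define \<phi> where "\<phi> x = Complex (f x) (- f (\<i> *\<^sub>C x))" for x
  have add: "\<phi> (x + y) = \<phi> x + \<phi> y" for x y
    by (simp add: \<phi>_def complex_eq_iff linear_add[OF f(1)] scaleC_add_right)
  have sc: "\<phi> (c *\<^sub>C x) = c * \<phi> x" for c x
  proof -
    have "c = of_real (Re c) + of_real (Im c) * \<i>" "\<i> * c = of_real (Re c) * \<i> - of_real (Im c)"
      by (simp_all add: complex_eq_iff)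
    then have "c *\<^sub>C x = (of_real (Re c) + of_real (Im c) * \<i>) *\<^sub>C x"
      "\<i> *\<^sub>C c *\<^sub>C x = (of_real (Re c) * \<i> - of_real (Im c)) *\<^sub>C x"
      by (simp_all add: scaleC_scaleC)
    then have "c *\<^sub>C x = Re c *\<^sub>R x + Im c *\<^sub>R (\<i> *\<^sub>C x)"
      "\<i> *\<^sub>C c *\<^sub>C x = Re c *\<^sub>R (\<i> *\<^sub>C x) - Im c *\<^sub>R x"
      by (simp_all add: scaleR_scaleC scaleC_scaleC scaleC_add_left complex_vector.scale_left_diff_distrib)
    then show ?thesis
      by (simp add: \<phi>_def complex_eq_iff linear_add[OF f(1)] linear_diff[OF f(1)] linear_scale[OF f(1)])
  qed
  have bd: "cmod (\<phi> x) \<le> norm x" for x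
  proof (cases "\<phi> x = 0")
    case False
    define c where "c = cnj (\<phi> x) / of_real (cmod (\<phi> x))"
    have c: "cmod c = 1" using False by (simp add: c_def norm_divide)
    have "c * \<phi> x = of_real (cmod (\<phi> x))"
      using False complex_norm_square[of "\<phi> x"]
      by (simp add: c_def power2_eq_square mult.commute[of "cnj _"] divide_eq_eq)
    then have "cmod (\<phi> x) = Re (\<phi> (c *\<^sub>C x))" by (simp add: sc)
    also have "\<dots> = f (c *\<^sub>C x)" by (simp add: \<phi>_def)
    also have "\<dots> \<le> norm x" using f(2)[of "c *\<^sub>C x"] by (simp add: norm_scaleC c)
    finally show ?thesis .
  qed simp
  \<comment> \<open>For positive \<open>a\<close> the norm of \<open>1 + a\<close> is at least
    \<open>1 + norm a\<close>, so \<open>f\<close> must reach its bound at 1 and at \<open>a\<close>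
    together.\<close>
  have "norm a \<le> norm (1 + a) - 1"
    using norm_positive_shift_le[OF a, of 1 "norm (1 + a)"] norm_mono_positive[of 1 "1 + a"] a
      positive_elem_square[of "1 :: 'a"] by (simp add: add.commute)
  then have "f 1 + f a \<ge> 1 + norm a" using f(3) linear_add[OF f(1)] by simp
  with f(2)[of 1] f(2)[of a] have "f 1 = 1" "f a = norm a" by simp_all
  moreover have cplx: "z = of_real r" if "Re z = r" "cmod z \<le> r" for z r
  proof -
    have "(Re z)\<^sup>2 + (Im z)\<^sup>2 \<le> r\<^sup>2" using that(2) power_mono[OF that(2), of 2] by (simp add: cmod_power2)
    with that(1) show ?thesis by (simp add: complex_eq_iff)
  qed
  ultimately have "\<phi> 1 = 1" "\<phi> a = of_real (norm a)"
    using cplx[of "\<phi> 1" 1] cplx[of "\<phi> a" "norm a"] bd[of 1] bd[of a] by (simp_all add: \<phi>_def)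
  with add sc bd show ?thesis by (intro that[of \<phi>]) (simp_all add: cstar_state_def)
qed

section \<open>Two-by-two matrices\<close>

definition mat2 :: "complex \<Rightarrow> complex \<Rightarrow> complex \<Rightarrow> complex \<Rightarrow> M2"
  where "mat2 a b c d = CMat (vector [vector [a, b], vector [c, d]])"

lemma entries_mat2 [simp]:
  "entries (mat2 a b c d) $ 1 $ 1 = a" "entries (mat2 a b c d) $ 1 $ 2 = b"
  "entries (mat2 a b c d) $ 2 $ 1 = c" "entries (mat2 a b c d) $ 2 $ 2 = d"
  by (simp_all add: mat2_def CMat_inverse)

lemma M2_eqI:
  fixes x y :: M2
  assumes "entries x $ 1 $ 1 = entries y $ 1 $ 1" "entries x $ 1 $ 2 = entries y $ 1 $ 2"
    "entries x $ 2 $ 1 = entries y $ 2 $ 1" "entries x $ 2 $ 2 = entries y $ 2 $ 2"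
  shows "x = y"
  using assms by (simp add: vec_eq_iff forall_2 flip: entries_inject)

lemma mat2_entries: "mat2 (entries x $ 1 $ 1) (entries x $ 1 $ 2) (entries x $ 2 $ 1) (entries x $ 2 $ 2) = x"
  by (rule M2_eqI) simp_all

lemma mat2_cases: obtains a b c d where "x = mat2 a b c d"
  by (metis mat2_entries)

lemma mat2_eq_iff [simp]: "mat2 a b c d = mat2 a' b' c' d' \<longleftrightarrow> a = a' \<and> b = b' \<and> c = c' \<and> d = d'"
  by (metis entries_mat2)

lemma mat2_add: "mat2 a b c d + mat2 a' b' c' d' = mat2 (a + a') (b + b') (c + c') (d + d')"
  by (rule M2_eqI) (simp_all add: plus_cmat.rep_eq)

lemma mat2_diff: "mat2 a b c d - mat2 a' b' c' d' = mat2 (a - a') (b - b') (c - c') (d - d')"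
  by (rule M2_eqI) (simp_all add: minus_cmat.rep_eq)

lemma mat2_scaleC: "k *\<^sub>C mat2 a b c d = mat2 (k * a) (k * b) (k * c) (k * d)"
  by (rule M2_eqI) (simp_all add: scaleC_cmat.rep_eq)

lemma mat2_scaleR: "r *\<^sub>R mat2 a b c d = mat2 (r *\<^sub>R a) (r *\<^sub>R b) (r *\<^sub>R c) (r *\<^sub>R d)"
  by (rule M2_eqI) (simp_all add: scaleR_cmat.rep_eq)

lemma mat2_mult: "mat2 a b c d * mat2 a' b' c' d'
    = mat2 (a * a' + b * c') (a * b' + b * d') (c * a' + d * c') (c * b' + d * d')"
  by (rule M2_eqI) (simp_all add: times_cmat.rep_eq matrix_matrix_mult_def sum_2)

lemma mat2_star: "(mat2 a b c d)\<^sup>\<star> = mat2 (cnj a) (cnj c) (cnj b) (cnj d)"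
  by (rule M2_eqI) (simp_all add: star_cmat.rep_eq adjoint_matrix_def)

lemma mat2_one: "1 = mat2 1 0 0 1"
  by (rule M2_eqI) (simp_all add: one_cmat.rep_eq mat_def)

lemma mat2_zero: "0 = mat2 0 0 0 0"
  by (rule M2_eqI) (simp_all add: zero_cmat.rep_eq)

lemmas mat2_simps = mat2_add mat2_diff mat2_scaleC mat2_scaleR mat2_mult mat2_star mat2_one mat2_zero

lemma norm_mat2_le: "norm (mat2 a b c d) \<le> cmod a + cmod b + cmod c + cmod d"
  using norm_cmat_le_sum[of "mat2 a b c d"] by (simp add: sum_2 add.assoc)

section \<open>Representations from norm conditions\<close>

text \<open>
  In the GNS space of a state attaining \<open>\<phi> ((W + V)\<^sup>\<star> (W + V)) = 4\<close>, the cyclic vector \<open>v\<close> satisfies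
  \<open>W v = V v\<close> by strict convexity, and then \<open>v\<close>, \<open>W v\<close> span an invariant subspace. The map \<open>\<rho>\<close> is
  the compression to it.
\<close>

lemma two_dimensional_representation:
  fixes W :: "'a::cstar_algebra" and \<epsilon> :: real
  assumes eps: "\<epsilon> * \<epsilon> = 1"
    and W: "norm W \<le> 1" and V: "norm (W + \<epsilon> *\<^sub>R W\<^sup>\<star>) \<le> 4/3"
    and WV: "norm ((7/4) *\<^sub>R W + (3/4 * \<epsilon>) *\<^sub>R W\<^sup>\<star>) = 2"
    and gen: "\<And>S. csubspace S \<Longrightarrow> closed S \<Longrightarrow> (\<forall>x\<in>S. \<forall>y\<in>S. x * y \<in> S) \<Longrightarrow> (\<forall>x\<in>S. x\<^sup>\<star> \<in> S) \<Longrightarrow>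
      1 \<in> S \<Longrightarrow> W \<in> S \<Longrightarrow> S = UNIV"
  obtains \<rho> :: "'a \<Rightarrow> M2" where "star_hom \<rho>" "\<rho> 1 = 1" "\<rho> W = mat2 0 (\<epsilon> / 3) 1 0"
proof -
  define e where "e = complex_of_real \<epsilon>"
  have ee: "e * e = 1" using eps by (simp add: e_def flip: of_real_mult)
  have ce: "cnj e = e" by (simp add: e_def)
  define V where "V = (3/4) *\<^sub>R (W + \<epsilon> *\<^sub>R W\<^sup>\<star>)"
  have nV: "norm V \<le> 1" using V by (simp add: V_def)
  define D where "D = W + V"
  have D: "D = (7/4) *\<^sub>R W + (3/4 * \<epsilon>) *\<^sub>R W\<^sup>\<star>"
  proof -
    have "(7/4) *\<^sub>R W = W + (3/4) *\<^sub>R W"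
      using scaleR_add_left[of 1 "3/4" W] by simp
    then show ?thesis by (simp add: D_def V_def scaleR_add_right)
  qed
  have nD: "norm (D\<^sup>\<star> * D) = 4" using WV by (simp add: D cstar_identity)
  obtain \<phi> where "cstar_state \<phi>" and phiD: "\<phi> (D\<^sup>\<star> * D) = of_real (norm (D\<^sup>\<star> * D))"
    using norming_state[OF star_mult_self_positive[of D]] by metis
  then interpret cstar_state \<phi> by simp
  \<comment> \<open>Parallelogram law: D'D has the value 4, which two contractions allow only if W'W
    and V'V both have value 1 and W - V is null.\<close>
  have "(W - V)\<^sup>\<star> * (W - V) = 2 *\<^sub>R (W\<^sup>\<star> * W) + 2 *\<^sub>R (V\<^sup>\<star> * V) - D\<^sup>\<star> * D"
    by (simp add: D_def star_simps scaleR_2 algebra_simps)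
  then have par: "Re (\<phi> ((W - V)\<^sup>\<star> * (W - V))) = 2 * Re (\<phi> (W\<^sup>\<star> * W)) + 2 * Re (\<phi> (V\<^sup>\<star> * V)) - 4"
    by (simp add: linear_simps phiD nD)
  have "Re (\<phi> (W\<^sup>\<star> * W)) \<le> 1" "Re (\<phi> (V\<^sup>\<star> * V)) \<le> 1"
    using W nV by (simp_all add: Re_star_mult_self_le)
  with par Re_star_mult_self[of "W - V"]
  have *: "Re (\<phi> (W\<^sup>\<star> * W)) = 1" "Re (\<phi> (V\<^sup>\<star> * V)) = 1" "Re (\<phi> ((W - V)\<^sup>\<star> * (W - V))) = 0"
    by linarith+
  have bW: "\<phi> (b * W) = \<phi> (b * V)" for b
    using null_left_ideal[OF *(3), of b] by (simp add: right_diff_distrib linear_simps)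
  have bWW: "\<phi> (b * (W\<^sup>\<star> * W)) = \<phi> b" and bVV: "\<phi> (b * (V\<^sup>\<star> * V)) = \<phi> b" for b
    using absorb_isometric[OF W *(1)] absorb_isometric[OF nV *(2)] by simp_all
  have eps': "\<epsilon> * (k * \<epsilon>) = k" for k using eps by (simp add: mult.left_commute)
  have Ws: "W\<^sup>\<star> = \<epsilon> *\<^sub>R ((4/3) *\<^sub>R V - W)"
    using eps by (simp add: V_def scaleR_diff_right scaleR_add_right)
  have Vs: "V\<^sup>\<star> = \<epsilon> *\<^sub>R V"
    by (simp add: V_def star_simps scaleR_add_right add.commute eps' mult.commute[of \<epsilon> 3])
  have V': "V = \<epsilon> *\<^sub>R V\<^sup>\<star>" using eps by (simp add: Vs)
  have W': "W = (4/3) *\<^sub>R V - \<epsilon> *\<^sub>R W\<^sup>\<star>" using eps by (simp add: Ws)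
  \<comment> \<open>In GNS terms W' v = (eps/3) W v, by replacing V v with W v in the expression of
    W' through V and W.\<close>
  have bWs: "\<phi> (b * W\<^sup>\<star>) = e / 3 * \<phi> (b * W)" for b
    unfolding Ws by (simp add: right_diff_distrib linear_simps bW e_def)
  \<comment> \<open>Writing the left factor W as (4/3) V - eps W' turns W W v into (4/3) V V v - eps
    W'W v, and V V v = eps V'V v = eps v.\<close>
  have bW2: "\<phi> (b * (W * W)) = e / 3 * \<phi> b" for b
  proof -
    have "b * (W * W) = (4/3) *\<^sub>R (b * V * W) - \<epsilon> *\<^sub>R (b * (W\<^sup>\<star> * W))"
      by (subst (1) W') (simp add: algebra_simps)
    moreover have "\<phi> (b * V * W) = \<phi> (b * V * V)" by (rule bW)
    moreover have "b * V * V = \<epsilon> *\<^sub>R (b * (V\<^sup>\<star> * V))"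
      by (subst (1) V') (simp add: mult.assoc)
    ultimately show ?thesis by (simp add: linear_simps bVV bWW e_def)
  qed
  \<comment> \<open>Orthogonality of v and W v: by the relation for W', the modulus of
    \<open>\<phi> W\<close> is a third of itself.\<close>
  have phiW: "\<phi> W = 0"
  proof -
    have "cnj (\<phi> W) = e / 3 * \<phi> W" using bWs[of 1] by (simp add: star)
    then have "cmod (cnj (\<phi> W)) = cmod (e / 3 * \<phi> W)" by (rule arg_cong)
    then have "cmod (\<phi> W) = cmod e / 3 * cmod (\<phi> W)"
      by (simp only: norm_mult norm_divide complex_mod_cnj) simp
    moreover have "cmod e * cmod e = 1" using ee by (metis norm_mult norm_one)
    then have "cmod e = 1" by (metis norm_ge_zero real_sqrt_abs2 real_sqrt_one abs_of_nonneg)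
    ultimately show ?thesis by simp
  qed
  \<comment> \<open>The matrix of the compression of \<open>b\<close> to the orthonormal pair v, W
    v.\<close>
  define \<rho> where "\<rho> b = mat2 (\<phi> b) (\<phi> (b * W)) (\<phi> (W\<^sup>\<star> * b)) (\<phi> (W\<^sup>\<star> * b * W))" for b
  have r_add: "\<rho> (x + y) = \<rho> x + \<rho> y" for x y
    by (simp add: \<rho>_def distrib_left distrib_right linear_simps mat2_simps)
  have r_sc: "\<rho> (c *\<^sub>C x) = c *\<^sub>C \<rho> x" for c x
    by (simp add: \<rho>_def mult_scaleC_left mult_scaleC_right linear_simps mat2_simps)
  have r_star: "\<rho> (x\<^sup>\<star>) = (\<rho> x)\<^sup>\<star>" for x
    by (simp add: \<rho>_def mat2_simps star_simps mult.assoc flip: star)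
  have r_one: "\<rho> 1 = 1"
    using bWW[of 1] bWs[of 1] by (simp add: \<rho>_def mat2_one one phiW)
  have r_W: "\<rho> W = mat2 0 (e / 3) 1 0"
    using bWW[of 1] bW2[of 1] bW2[of "W\<^sup>\<star>"] bWs[of 1] by (simp add: \<rho>_def one phiW mult.assoc)
  have r_mult_W: "\<rho> (b * W) = \<rho> b * \<rho> W" for b
    unfolding r_W using bW2[of b] bW2[of "W\<^sup>\<star> * b"]
    by (simp add: \<rho>_def mat2_mult mult.assoc)
  have r_mult_Ws: "\<rho> (b * W\<^sup>\<star>) = \<rho> b * \<rho> (W\<^sup>\<star>)" for b
    unfolding r_star r_W
    using bWs[of b] bWs[of "W\<^sup>\<star> * b"] bWW[of b] bWW[of "W\<^sup>\<star> * b"]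
    by (simp add: \<rho>_def mat2_simps ce mult.assoc)
  \<comment> \<open>Continuity of \<open>\<rho>\<close> makes the set \<open>S\<close> below
    closed.\<close>
  have r_bl: "bounded_linear \<rho>"
  proof (rule bounded_linear_intro[where K = 4])
    fix x
    have l: "cmod (\<phi> (x * W)) \<le> norm x" for x
      by (rule order_trans[OF bound order_trans[OF norm_mult_ineq]]) (simp add: W mult_left_le)
    have r: "norm (W\<^sup>\<star> * x) \<le> norm x"
      by (rule order_trans[OF norm_mult_ineq]) (simp add: W mult_left_le_one_le)
    show "norm (\<rho> x) \<le> norm x * 4"
      using norm_mat2_le[of "\<phi> x" "\<phi> (x * W)" "\<phi> (W\<^sup>\<star> * x)" "\<phi> (W\<^sup>\<star> * x * W)"]
        bound[of x] l[of x] order_trans[OF bound r] order_trans[OF l[of "W\<^sup>\<star> * x"] r]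
      by (simp add: \<rho>_def)
  qed (simp_all add: r_add scaleR_scaleC r_sc)
  \<comment> \<open>The right factors for which \<open>\<rho>\<close> is multiplicative form a
    subalgebra; imposing the condition on \<open>c\<close> and on its adjoint makes it self-adjoint,
    so that it contains all that W generates.\<close>
  define S where "S = {c. \<forall>b. \<rho> (b * c) = \<rho> b * \<rho> c} \<inter> {c. \<forall>b. \<rho> (b * c\<^sup>\<star>) = \<rho> b * \<rho> (c\<^sup>\<star>)}"
  have "S = UNIV"
  proof (rule gen)
    have r_zero: "\<rho> 0 = 0" using r_add[of 0 0] by simp
    show "csubspace S"
      by (rule complex_vector.subspaceI)
        (auto simp: S_def r_zero distrib_left r_add mult_scaleC_right r_sc star_simps)
    have c: "continuous_on UNIV \<rho>" "continuous_on UNIV (star :: 'a \<Rightarrow> 'a)"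
      by (rule linear_continuous_on[OF r_bl], rule linear_continuous_on[OF bounded_linear_star])
    have "closed {c. \<rho> (b * c) = \<rho> b * \<rho> c}" for b
      by (intro closed_Collect_eq continuous_intros continuous_on_compose2[OF c(1)]) auto
    moreover have "closed {c. \<rho> (b * c\<^sup>\<star>) = \<rho> b * \<rho> (c\<^sup>\<star>)}" for b
      by (intro closed_Collect_eq continuous_intros continuous_on_compose2[OF c(1)]
          continuous_on_compose2[OF c(2)]) auto
    ultimately show "closed S" unfolding S_def by (intro closed_Int closed_Collect_all)
    show "\<forall>x\<in>S. \<forall>y\<in>S. x * y \<in> S"
      by (auto simp: S_def star_mult mult.assoc) (metis mult.assoc)+
    show "\<forall>x\<in>S. x\<^sup>\<star> \<in> S" by (simp add: S_def star_star)
    show "1 \<in> S" by (simp add: S_def r_one)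
    show "W \<in> S" by (simp add: S_def r_mult_W r_mult_Ws)
  qed
  then have "\<rho> (b * c) = \<rho> b * \<rho> c" for b c unfolding S_def by blast
  with r_add r_sc r_star have "star_hom \<rho>" by (simp add: star_hom_def)
  with r_one r_W show ?thesis by (intro that[of \<rho>]) (simp_all add: e_def)
qed

lemma norm_antidiagonal_le:
  assumes "cmod b \<le> m" "cmod c \<le> m"
  shows "norm (mat2 0 b c 0) \<le> m"
proof -
  have m: "m \<ge> 0" using assms(1) norm_ge_zero[of b] by linarith
  have "onorm ((*v) (entries (mat2 0 b c 0))) \<le> m"
  proof (rule onorm_le)
    fix x :: "complex^2"
    have "norm (entries (mat2 0 b c 0) *v x) = sqrt ((cmod b * cmod (x $ 2))\<^sup>2 + (cmod c * cmod (x $ 1))\<^sup>2)"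
      by (simp add: norm_vec_def L2_set_def sum_2 matrix_vector_mult_def norm_mult)
    also have "\<dots> \<le> sqrt ((m * cmod (x $ 2))\<^sup>2 + (m * cmod (x $ 1))\<^sup>2)"
      by (intro real_sqrt_le_mono add_mono power_mono mult_right_mono assms) simp_all
    also have "\<dots> = sqrt (m\<^sup>2 * ((cmod (x $ 1))\<^sup>2 + (cmod (x $ 2))\<^sup>2))"
      by (simp add: power_mult_distrib algebra_simps)
    also have "\<dots> = m * norm x"
      using m by (simp add: real_sqrt_mult norm_vec_def L2_set_def sum_2)
    finally show "norm (entries (mat2 0 b c 0) *v x) \<le> m * norm x" .
  qed
  then show ?thesis by (simp add: norm_cmat.rep_eq)
qed

section \<open>The C*-envelope\<close>

lemmas dsum_simps = dsum_defs scaleC_dsum_def star_dsum_def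

lemma sigma_mat2: "\<sigma>\<^sub>1 = mat2 0 1 1 0" "\<sigma>\<^sub>2 = mat2 0 (- \<i>) \<i> 0"
  by (simp_all add: \<sigma>\<^sub>1_def \<sigma>\<^sub>2_def mat2_def)

definition W\<^sub>\<sigma> :: "(M2, M2) dsum"
  where "W\<^sub>\<sigma> = mat2 0 (- 1/3) 1 0 \<oplus> mat2 0 (1/3) 1 0"

lemma mem_E\<^sub>\<sigma>_iff: "x \<in> E\<^sub>\<sigma> \<longleftrightarrow> (\<exists>a b c. x = a *\<^sub>C 1 + b *\<^sub>C X\<^sub>\<sigma> + c *\<^sub>C Y\<^sub>\<sigma>)"
proof -
  have "x \<in> E\<^sub>\<sigma> \<longleftrightarrow> (\<exists>a b c. x - a *\<^sub>C 1 - b *\<^sub>C X\<^sub>\<sigma> - c *\<^sub>C Y\<^sub>\<sigma> = 0)"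
    unfolding E\<^sub>\<sigma>_def one_dsum_def[symmetric] by (simp add: complex_vector.span_breakdown_eq)
  also have "\<dots> \<longleftrightarrow> (\<exists>a b c. x = a *\<^sub>C 1 + b *\<^sub>C X\<^sub>\<sigma> + c *\<^sub>C Y\<^sub>\<sigma>)"
    by (simp add: diff_diff_eq)
  finally show ?thesis .
qed

lemma E\<^sub>\<sigma>_element: "a *\<^sub>C 1 + b *\<^sub>C X\<^sub>\<sigma> + c *\<^sub>C Y\<^sub>\<sigma>
    = mat2 a (b - \<i> * c) (b + \<i> * c) a \<oplus> mat2 a (2 * b - \<i> * c / 2) (2 * b + \<i> * c / 2) a"
  by (simp add: X\<^sub>\<sigma>_def Y\<^sub>\<sigma>_def sigma_mat2 dsum_simps mat2_simps)

lemma E\<^sub>\<sigma>_element_W: "a *\<^sub>C 1 + b *\<^sub>C X\<^sub>\<sigma> + c *\<^sub>C Y\<^sub>\<sigma>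
    = a *\<^sub>C 1 + (3/2 * b + 3/4 * \<i> * c) *\<^sub>C W\<^sub>\<sigma> + (3/2 * b - 3/4 * \<i> * c) *\<^sub>C W\<^sub>\<sigma>\<^sup>\<star>"
  unfolding E\<^sub>\<sigma>_element by (simp add: W\<^sub>\<sigma>_def dsum_simps mat2_simps field_simps)

lemma W\<^sub>\<sigma>_mem: "W\<^sub>\<sigma> \<in> E\<^sub>\<sigma>"
proof -
  have "W\<^sub>\<sigma> = 0 *\<^sub>C 1 + (1/3) *\<^sub>C X\<^sub>\<sigma> + (- (2/3) * \<i>) *\<^sub>C Y\<^sub>\<sigma>"
    unfolding E\<^sub>\<sigma>_element by (simp add: W\<^sub>\<sigma>_def complex_eq_iff)
  then show ?thesis unfolding mem_E\<^sub>\<sigma>_iff by blast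
qed

lemma mem_E\<^sub>\<sigma>_cases:
  assumes "x \<in> E\<^sub>\<sigma>"
  obtains a b c where "x = a *\<^sub>C 1 + b *\<^sub>C W\<^sub>\<sigma> + c *\<^sub>C W\<^sub>\<sigma>\<^sup>\<star>"
  using assms unfolding mem_E\<^sub>\<sigma>_iff E\<^sub>\<sigma>_element_W by blast

lemma bounded_linear_dfst: "bounded_linear (dfst :: ('a::cstar_algebra, 'b::cstar_algebra) dsum \<Rightarrow> 'a)"
  by (rule bounded_linear_intro[where K = 1]) (simp_all add: dsum_defs)

lemma bounded_linear_dsnd: "bounded_linear (dsnd :: ('a::cstar_algebra, 'b::cstar_algebra) dsum \<Rightarrow> 'b)"
  by (rule bounded_linear_intro[where K = 1]) (simp_all add: dsum_defs)

lemma bounded_linear_entry: "bounded_linear (\<lambda>x :: 'n::finite cmat. entries x $ i $ j)"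
  by (rule bounded_linear_intro[where K = 1])
    (simp_all add: plus_cmat.rep_eq scaleR_cmat.rep_eq norm_cmat_entry_le)

lemma continuous_on_entry_dfst: "continuous_on S (\<lambda>x :: ('n::finite cmat, 'b::cstar_algebra) dsum. entries (dfst x) $ i $ j)"
  by (rule linear_continuous_on[OF bounded_linear_compose[OF bounded_linear_entry bounded_linear_dfst]])

lemma continuous_on_entry_dsnd: "continuous_on S (\<lambda>x :: ('a::cstar_algebra, 'n::finite cmat) dsum. entries (dsnd x) $ i $ j)"
  by (rule linear_continuous_on[OF bounded_linear_compose[OF bounded_linear_entry bounded_linear_dsnd]])

text \<open>Passing to the second summand scales the symmetric part of the off-diagonal pair by 2
  and the antisymmetric part by 1/2, whence 5/4 = (2 + 1/2)/2 and 3/4 = (2 - 1/2)/2. In this form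
  the span is the solution set of linear equations, hence closed.\<close>

lemma mem_E\<^sub>\<sigma>_entries_iff: "mat2 p11 p12 p21 p22 \<oplus> mat2 q11 q12 q21 q22 \<in> E\<^sub>\<sigma> \<longleftrightarrow>
    p22 = p11 \<and> q11 = p11 \<and> q22 = p11 \<and>
    q12 = 5/4 * p12 + 3/4 * p21 \<and> q21 = 3/4 * p12 + 5/4 * p21" (is "?L \<longleftrightarrow> ?R")
proof
  assume ?R
  then have "mat2 p11 p12 p21 p22 \<oplus> mat2 q11 q12 q21 q22
      = p11 *\<^sub>C 1 + ((p12 + p21) / 2) *\<^sub>C X\<^sub>\<sigma> + (\<i> * (p12 - p21) / 2) *\<^sub>C Y\<^sub>\<sigma>"
    unfolding E\<^sub>\<sigma>_element by (auto simp: complex_eq_iff field_simps)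
  then show ?L unfolding mem_E\<^sub>\<sigma>_iff by blast
next
  assume ?L
  then obtain a b c where "mat2 p11 p12 p21 p22 \<oplus> mat2 q11 q12 q21 q22
      = mat2 a (b - \<i> * c) (b + \<i> * c) a \<oplus> mat2 a (2 * b - \<i> * c / 2) (2 * b + \<i> * c / 2) a"
    unfolding mem_E\<^sub>\<sigma>_iff E\<^sub>\<sigma>_element by blast
  then have "p22 = p11" "q11 = p11" "q22 = p11" and p: "p12 = b - \<i> * c" "p21 = b + \<i> * c"
    and q: "q12 = 2 * b - \<i> * c / 2" "q21 = 2 * b + \<i> * c / 2"
    by auto
  then show ?R unfolding p q by (auto simp: complex_eq_iff field_simps)
qed

lemma dsum_mat2_cases:
  obtains p11 p12 p21 p22 q11 q12 q21 q22
  where "x = mat2 p11 p12 p21 p22 \<oplus> mat2 q11 q12 q21 q22"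
  by (metis dsum.collapse mat2_entries)

lemma operator_system_E\<^sub>\<sigma>: "operator_system E\<^sub>\<sigma>"
proof -
  have one: "1 \<in> E\<^sub>\<sigma>" by (simp add: one_dsum_def mat2_one mem_E\<^sub>\<sigma>_entries_iff)
  have star: "x\<^sup>\<star> \<in> E\<^sub>\<sigma>" if "x \<in> E\<^sub>\<sigma>" for x
    using that by (cases x rule: dsum_mat2_cases)
      (auto simp: mem_E\<^sub>\<sigma>_entries_iff star_dsum_def mat2_star add.commute)
  have "E\<^sub>\<sigma> = {x. entries (dfst x) $ 2 $ 2 = entries (dfst x) $ 1 $ 1
      \<and> entries (dsnd x) $ 1 $ 1 = entries (dfst x) $ 1 $ 1
      \<and> entries (dsnd x) $ 2 $ 2 = entries (dfst x) $ 1 $ 1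
      \<and> entries (dsnd x) $ 1 $ 2 = 5/4 * entries (dfst x) $ 1 $ 2 + 3/4 * entries (dfst x) $ 2 $ 1
      \<and> entries (dsnd x) $ 2 $ 1 = 3/4 * entries (dfst x) $ 1 $ 2 + 5/4 * entries (dfst x) $ 2 $ 1}"
    (is "_ = ?S")
  proof -
    have "x \<in> E\<^sub>\<sigma> \<longleftrightarrow> x \<in> ?S" for x
      by (cases x rule: dsum_mat2_cases) (simp add: mem_E\<^sub>\<sigma>_entries_iff)
    then show ?thesis by blast
  qed
  moreover have "closed ?S"
    by (intro closed_Collect_conj closed_Collect_eq continuous_on_add continuous_on_mult continuous_on_const
        continuous_on_entry_dfst continuous_on_entry_dsnd)
  ultimately have "closed E\<^sub>\<sigma>" by (simp only:)
  moreover have "csubspace E\<^sub>\<sigma>" unfolding E\<^sub>\<sigma>_def by (rule complex_vector.subspace_span)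
  ultimately show ?thesis using one star unfolding operator_system_def by blast
qed

lemma subalgebra_containing_W\<^sub>\<sigma>:
  assumes S: "csubspace S" and mult: "\<And>x y. x \<in> S \<Longrightarrow> y \<in> S \<Longrightarrow> x * y \<in> S"
    and W: "W\<^sub>\<sigma> \<in> S" "W\<^sub>\<sigma>\<^sup>\<star> \<in> S"
  shows "S = UNIV"
proof -
  note sc = complex_vector.subspace_scale[OF S] and ad = complex_vector.subspace_add[OF S]
    and di = complex_vector.subspace_diff[OF S]
  note sm = W\<^sub>\<sigma>_def dsum_simps mat2_simps
  \<comment> \<open>In both summands W'W has the diagonal 1, 1/9 and W W' the diagonal 1/9, 1; the
    factor 81/80 is the inverse of 1 - 1/81.\<close>
  have "(81/80) *\<^sub>C (W\<^sub>\<sigma>\<^sup>\<star> * W\<^sub>\<sigma> - (1/9) *\<^sub>C (W\<^sub>\<sigma> * W\<^sub>\<sigma>\<^sup>\<star>)) \<in> S"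
    by (intro sc di mult W)
  then have P1: "mat2 1 0 0 0 \<oplus> mat2 1 0 0 0 \<in> S" by (simp add: sm)
  have "(81/80) *\<^sub>C (W\<^sub>\<sigma> * W\<^sub>\<sigma>\<^sup>\<star> - (1/9) *\<^sub>C (W\<^sub>\<sigma>\<^sup>\<star> * W\<^sub>\<sigma>)) \<in> S"
    by (intro sc di mult W)
  then have P2: "mat2 0 0 0 1 \<oplus> mat2 0 0 0 1 \<in> S" by (simp add: sm)
  from mult[OF P2 mult[OF W(1) P1]] have F: "mat2 0 0 1 0 \<oplus> mat2 0 0 1 0 \<in> S" by (simp add: sm)
  \<comment> \<open>The e12 corner carries the sign that distinguishes the summands: the product of
    \<open>G\<close> with the e21 corner is -e11 in the first and e11 in the second, and this
    separates them.\<close>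
  from sc[OF mult[OF P1 mult[OF W(1) P2]], of 3]
  have G: "mat2 0 (- 1) 0 0 \<oplus> mat2 0 1 0 0 \<in> S" by (simp add: sm)
  from sc[OF di[OF P1 mult[OF G F]], of "1/2"] sc[OF ad[OF P1 mult[OF G F]], of "1/2"]
  have Q: "mat2 1 0 0 0 \<oplus> 0 \<in> S" "0 \<oplus> mat2 1 0 0 0 \<in> S" by (simp_all add: sm)
  from mult[OF F Q(1)] mult[OF F Q(2)]
  have Q21: "mat2 0 0 1 0 \<oplus> 0 \<in> S" "0 \<oplus> mat2 0 0 1 0 \<in> S" by (simp_all add: sm)
  from sc[OF mult[OF Q(1) G], of "- 1"] mult[OF Q(2) G]
  have Q12: "mat2 0 1 0 0 \<oplus> 0 \<in> S" "0 \<oplus> mat2 0 1 0 0 \<in> S" by (simp_all add: sm)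
  from mult[OF Q21(1) Q12(1)] mult[OF Q21(2) Q12(2)]
  have Q22: "mat2 0 0 0 1 \<oplus> 0 \<in> S" "0 \<oplus> mat2 0 0 0 1 \<in> S" by (simp_all add: sm)
  have "x \<in> S" for x
  proof (cases x rule: dsum_mat2_cases)
    case (1 p11 p12 p21 p22 q11 q12 q21 q22)
    have "p11 *\<^sub>C (mat2 1 0 0 0 \<oplus> 0) + p12 *\<^sub>C (mat2 0 1 0 0 \<oplus> 0)
        + p21 *\<^sub>C (mat2 0 0 1 0 \<oplus> 0) + p22 *\<^sub>C (mat2 0 0 0 1 \<oplus> 0)
        + q11 *\<^sub>C (0 \<oplus> mat2 1 0 0 0) + q12 *\<^sub>C (0 \<oplus> mat2 0 1 0 0)
        + q21 *\<^sub>C (0 \<oplus> mat2 0 0 1 0) + q22 *\<^sub>C (0 \<oplus> mat2 0 0 0 1) \<in> S"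
      by (intro ad sc Q Q12 Q21 Q22)
    then show ?thesis by (simp add: 1 dsum_simps mat2_simps)
  qed
  then show ?thesis by blast
qed

section \<open>Norms of combinations of W and its adjoint\<close>

lemma norm_antidiagonal_dsum_le:
  assumes "cmod a \<le> m" "cmod b \<le> m" "cmod c \<le> m" "cmod d \<le> m"
  shows "norm (mat2 0 a b 0 \<oplus> mat2 0 c d 0) \<le> m"
  using assms by (simp add: norm_dsum_def norm_antidiagonal_le)

lemma norm_W\<^sub>\<sigma>_conditions:
  assumes eps: "\<epsilon> = 1 \<or> \<epsilon> = (- 1 :: real)"
  shows "norm W\<^sub>\<sigma> \<le> 1" "norm (W\<^sub>\<sigma> + \<epsilon> *\<^sub>R W\<^sub>\<sigma>\<^sup>\<star>) \<le> 4/3"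
    "norm ((7/4) *\<^sub>R W\<^sub>\<sigma> + (3/4 * \<epsilon>) *\<^sub>R W\<^sub>\<sigma>\<^sup>\<star>) = 2"
proof -
  have comb: "r *\<^sub>R W\<^sub>\<sigma> + s *\<^sub>R W\<^sub>\<sigma>\<^sup>\<star>
      = mat2 0 (of_real (s - r / 3)) (of_real (r - s / 3)) 0
        \<oplus> mat2 0 (of_real (s + r / 3)) (of_real (r + s / 3)) 0" for r s
    by (simp add: W\<^sub>\<sigma>_def dsum_simps mat2_simps complex_eq_iff)
  show "norm W\<^sub>\<sigma> \<le> 1"
    unfolding W\<^sub>\<sigma>_def by (rule norm_antidiagonal_dsum_le) (simp_all add: norm_divide)
  have "norm (1 *\<^sub>R W\<^sub>\<sigma> + \<epsilon> *\<^sub>R W\<^sub>\<sigma>\<^sup>\<star>) \<le> 4/3"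
    unfolding comb by (rule norm_antidiagonal_dsum_le; unfold norm_of_real) (use eps in auto)
  then show "norm (W\<^sub>\<sigma> + \<epsilon> *\<^sub>R W\<^sub>\<sigma>\<^sup>\<star>) \<le> 4/3" by simp
  show "norm ((7/4) *\<^sub>R W\<^sub>\<sigma> + (3/4 * \<epsilon>) *\<^sub>R W\<^sub>\<sigma>\<^sup>\<star>) = 2" (is "norm ?D = 2")
  proof (rule order_antisym)
    show "norm ?D \<le> 2"
      unfolding comb by (rule norm_antidiagonal_dsum_le; unfold norm_of_real) (use eps in auto)
    \<comment> \<open>The value 2 = 7/4 + 1/4 is the lower left entry of the summand whose sign is
      \<open>\<epsilon>\<close>: the first one for -1, the second for 1.\<close>
    have "norm ?D \<ge> norm (dfst ?D)" "norm ?D \<ge> norm (dsnd ?D)" by (simp_all add: norm_dsum_def)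
    moreover have "\<bar>7/4 - (3/4 * \<epsilon>) / 3\<bar> \<le> norm (dfst ?D)"
      using norm_cmat_entry_le[of "dfst ?D" 2 1]
      unfolding comb dsum.sel entries_mat2 norm_of_real .
    moreover have "\<bar>7/4 + (3/4 * \<epsilon>) / 3\<bar> \<le> norm (dsnd ?D)"
      using norm_cmat_entry_le[of "dsnd ?D" 2 1]
      unfolding comb dsum.sel entries_mat2 norm_of_real .
    ultimately show "2 \<le> norm ?D" using eps by (elim disjE) linarith+
  qed
qed

theorem is_cstar_envelope_E\<^sub>\<sigma>: "is_cstar_envelope TYPE('b::cstar_algebra) E\<^sub>\<sigma> (\<lambda>x. x)"
  unfolding is_cstar_envelope_def
proof (intro conjI allI impI)
  show "operator_system E\<^sub>\<sigma>" by (rule operator_system_E\<^sub>\<sigma>)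
  show "unital_complete_order_embedding E\<^sub>\<sigma> (\<lambda>x. x)"
    by (simp add: unital_complete_order_embedding_def)
  show "generates ((\<lambda>x. x) ` E\<^sub>\<sigma>)"
    unfolding generates_def
  proof (rule equalityI[OF subset_UNIV], unfold hull_def, rule Inter_greatest, clarify)
    fix S and x :: "(M2, M2) dsum" assume S: "cstar_subalgebra S" "(\<lambda>x. x) ` E\<^sub>\<sigma> \<subseteq> S"
    then have "S = UNIV"
      using W\<^sub>\<sigma>_mem by (intro subalgebra_containing_W\<^sub>\<sigma>) (auto simp: cstar_subalgebra_def)
    then show "x \<in> S" by simp
  qed
  fix j :: "(M2, M2) dsum \<Rightarrow> 'b"
  assume "unital_complete_order_embedding E\<^sub>\<sigma> j \<and> generates (j ` E\<^sub>\<sigma>)"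
  then have j: "unital_complete_order_embedding E\<^sub>\<sigma> j" and gen: "generates (j ` E\<^sub>\<sigma>)" by auto
  note E = operator_system_E\<^sub>\<sigma>
  have E_add: "x \<in> E\<^sub>\<sigma> \<Longrightarrow> y \<in> E\<^sub>\<sigma> \<Longrightarrow> x + y \<in> E\<^sub>\<sigma>" and E_sc: "x \<in> E\<^sub>\<sigma> \<Longrightarrow> c *\<^sub>C x \<in> E\<^sub>\<sigma>"
    and E_star: "x \<in> E\<^sub>\<sigma> \<Longrightarrow> x\<^sup>\<star> \<in> E\<^sub>\<sigma>" and E_one: "1 \<in> E\<^sub>\<sigma>" for x y c
    using E by (auto simp: operator_system_def complex_vector.subspace_def)
  have j_add: "x \<in> E\<^sub>\<sigma> \<Longrightarrow> y \<in> E\<^sub>\<sigma> \<Longrightarrow> j (x + y) = j x + j y"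
    and j_sc: "x \<in> E\<^sub>\<sigma> \<Longrightarrow> j (c *\<^sub>C x) = c *\<^sub>C j x" and j_one: "j 1 = 1" for x y c
    using j by (auto simp: unital_complete_order_embedding_def)
  have j_star: "x \<in> E\<^sub>\<sigma> \<Longrightarrow> j (x\<^sup>\<star>) = (j x)\<^sup>\<star>" and j_norm: "x \<in> E\<^sub>\<sigma> \<Longrightarrow> norm (j x) = norm x" for x
    using unital_complete_order_embedding_star_isometry[OF E j] by auto
  define W where "W = j W\<^sub>\<sigma>"
  have j_lin: "j (a *\<^sub>C 1 + b *\<^sub>C W\<^sub>\<sigma> + c *\<^sub>C W\<^sub>\<sigma>\<^sup>\<star>) = a *\<^sub>C 1 + b *\<^sub>C W + c *\<^sub>C W\<^sup>\<star>" for a b c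
    by (simp add: j_add j_sc j_star j_one E_add E_sc E_star E_one W\<^sub>\<sigma>_mem W_def)
  \<comment> \<open>The image of the operator system is spanned by 1, W and W', so it lies in every
    such \<open>S\<close>.\<close>
  have gen_W: "S = UNIV" if "csubspace S" "closed S" "\<forall>x\<in>S. \<forall>y\<in>S. x * y \<in> S" "\<forall>x\<in>S. x\<^sup>\<star> \<in> S"
    "1 \<in> S" "W \<in> S" for S
  proof -
    have "cstar_subalgebra S" using that by (simp add: cstar_subalgebra_def)
    moreover have "j x \<in> S" if "x \<in> E\<^sub>\<sigma>" for x
      using that
    proof (cases rule: mem_E\<^sub>\<sigma>_cases)
      case (1 a b c)
      have "a *\<^sub>C 1 + b *\<^sub>C W + c *\<^sub>C W\<^sup>\<star> \<in> S"
        using \<open>csubspace S\<close> \<open>1 \<in> S\<close> \<open>W \<in> S\<close> \<open>\<forall>x\<in>S. x\<^sup>\<star> \<in> S\<close>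
        by (intro complex_vector.subspace_add complex_vector.subspace_scale) auto
      then show ?thesis by (simp add: 1 j_lin)
    qed
    ultimately have "cstar_subalgebra hull (j ` E\<^sub>\<sigma>) \<subseteq> S" by (intro hull_minimal) auto
    with gen show ?thesis by (auto simp: generates_def)
  qed
  have rep: "\<exists>\<rho> :: 'b \<Rightarrow> M2. star_hom \<rho> \<and> \<rho> 1 = 1 \<and> \<rho> W = mat2 0 (\<epsilon> / 3) 1 0"
    if eps: "\<epsilon> = 1 \<or> \<epsilon> = (- 1 :: real)" for \<epsilon>
  proof -
    have j_comb: "norm (r *\<^sub>R W + s *\<^sub>R W\<^sup>\<star>) = norm (r *\<^sub>R W\<^sub>\<sigma> + s *\<^sub>R W\<^sub>\<sigma>\<^sup>\<star>)" for r s
      using j_norm[of "0 *\<^sub>C 1 + of_real r *\<^sub>C W\<^sub>\<sigma> + of_real s *\<^sub>C W\<^sub>\<sigma>\<^sup>\<star>"]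
      by (simp only: j_lin E_add E_sc E_star E_one W\<^sub>\<sigma>_mem)
        (simp add: scaleR_scaleC complex_vector.scale_zero_left)
    note n = norm_W\<^sub>\<sigma>_conditions[OF eps]
    obtain \<rho> :: "'b \<Rightarrow> M2" where "star_hom \<rho>" "\<rho> 1 = 1" "\<rho> W = mat2 0 (\<epsilon> / 3) 1 0"
    proof (rule two_dimensional_representation[of \<epsilon> W])
      show "\<epsilon> * \<epsilon> = 1" using eps by auto
      show "norm W \<le> 1" using n(1) by (simp add: W_def j_norm W\<^sub>\<sigma>_mem)
      show "norm (W + \<epsilon> *\<^sub>R W\<^sup>\<star>) \<le> 4/3" using n(2) j_comb[of 1 \<epsilon>] by simp
      show "norm ((7/4) *\<^sub>R W + (3/4 * \<epsilon>) *\<^sub>R W\<^sup>\<star>) = 2" using n(3) j_comb by simp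
    qed (use gen_W in blast)+
    then show ?thesis by blast
  qed
  from rep[of "- 1"] obtain \<rho>\<^sub>1 :: "'b \<Rightarrow> M2"
    where r1: "star_hom \<rho>\<^sub>1" "\<rho>\<^sub>1 1 = 1" "\<rho>\<^sub>1 W = mat2 0 (- 1/3) 1 0" by auto
  from rep[of 1] obtain \<rho>\<^sub>2 :: "'b \<Rightarrow> M2"
    where r2: "star_hom \<rho>\<^sub>2" "\<rho>\<^sub>2 1 = 1" "\<rho>\<^sub>2 W = mat2 0 (1/3) 1 0" by auto
  define \<rho> where "\<rho> b = \<rho>\<^sub>1 b \<oplus> \<rho>\<^sub>2 b" for b
  have hom: "star_hom \<rho>" using r1(1) r2(1) by (simp add: star_hom_def \<rho>_def dsum_simps)
  then have \<rho>: "\<rho> (x + y) = \<rho> x + \<rho> y" "\<rho> (c *\<^sub>C x) = c *\<^sub>C \<rho> x" "\<rho> (x * y) = \<rho> x * \<rho> y"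
    "\<rho> (x\<^sup>\<star>) = (\<rho> x)\<^sup>\<star>" for x y c
    by (simp_all add: star_hom_def)
  have \<rho>W: "\<rho> W = W\<^sub>\<sigma>" "\<rho> 1 = 1" by (simp_all add: \<rho>_def r1 r2 W\<^sub>\<sigma>_def one_dsum_def)
  have "\<rho> (j x) = x" if "x \<in> E\<^sub>\<sigma>" for x
    using that by (cases rule: mem_E\<^sub>\<sigma>_cases) (simp add: j_lin \<rho> \<rho>W)
  moreover have "range \<rho> = UNIV"
  proof (rule subalgebra_containing_W\<^sub>\<sigma>)
    show "csubspace (range \<rho>)"
    proof (rule complex_vector.subspaceI)
      show "0 \<in> range \<rho>" by (metis \<rho>(2) complex_vector.scale_zero_left rangeI)
    qed (auto simp: \<rho>(1,2)[symmetric])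
    show "W\<^sub>\<sigma> \<in> range \<rho>" "W\<^sub>\<sigma>\<^sup>\<star> \<in> range \<rho>" by (auto simp: \<rho>(4)[symmetric] \<rho>W(1)[symmetric])
  qed (auto simp: \<rho>(3)[symmetric])
  ultimately show "\<exists>\<rho> :: 'b \<Rightarrow> (M2, M2) dsum. star_hom \<rho> \<and> surj \<rho> \<and> (\<forall>x\<in>E\<^sub>\<sigma>. \<rho> (j x) = x)"
    using hom by blast
qed

section \<open>Counting path components\<close>

text \<open>The complement of a piece is the union of the other open pieces. So each piece is
  clopen, and a path component that meets it cannot leave it.\<close>

lemma pi0_disjoint_open_cover:
  assumes cover: "\<Union>\<U> = S"
    and disj: "\<And>U V. U \<in> \<U> \<Longrightarrow> V \<in> \<U> \<Longrightarrow> U \<noteq> V \<Longrightarrow> U \<inter> V = {}"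
    and ne: "{} \<notin> \<U>"
    and pc: "\<And>U. U \<in> \<U> \<Longrightarrow> path_connected U"
    and op: "\<And>U. U \<in> \<U> \<Longrightarrow> openin (top_of_set S) U"
  shows "pi0 S = \<U>"
proof -
  let ?C = "\<lambda>x. Collect (path_component_of (top_of_set S) x)"
  have eq: "?C x = U" if U: "U \<in> \<U>" and x: "x \<in> U" for x U
  proof
    have "path_connectedin (top_of_set S) U"
      using pc[OF U] U cover by (auto simp: path_connectedin_subtopology)
    then show "U \<subseteq> ?C x" using x by (rule path_component_of_maximal)
    have "S - U = \<Union>(\<U> - {U})" using disj[OF U] cover U by blast
    then have "openin (top_of_set S) (S - U)" using op by (metis DiffD1 openin_Union)
    then have cl: "closedin (top_of_set S) U" using U cover by (auto simp: closedin_def)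
    have "x \<in> ?C x" using x U cover by (auto simp: path_component_of_refl)
    then have "\<not> disjnt (?C x) U" using x by (auto simp: disjnt_def)
    then show "?C x \<subseteq> U"
      using connectedin_clopen_cases[OF path_connectedin_imp_connectedin[OF
            path_connectedin_path_component_of] cl op[OF U]] by blast
  qed
  have "pi0 S = ?C ` S" by (simp add: pi0_def path_components_of_def)
  also have "\<dots> = \<U>"
  proof
    show "?C ` S \<subseteq> \<U>" using eq cover by fastforce
    show "\<U> \<subseteq> ?C ` S"
    proof
      fix U assume U: "U \<in> \<U>"
      with ne obtain x where "x \<in> U" by fastforce
      with U eq cover show "U \<in> ?C ` S" by (intro image_eqI[of _ _ x]) auto
    qed
  qed
  finally show ?thesis .
qed

lemma card_pi0_path_connected: "path_connected S \<Longrightarrow> S \<noteq> {} \<Longrightarrow> card (pi0 S) = 1"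
proof -
  assume "path_connected S" "S \<noteq> {}"
  then have "pi0 S = {S}" by (intro pi0_disjoint_open_cover) auto
  then show ?thesis by simp
qed

text \<open>The continuous left inverse makes \<open>\<psi>\<close> a homeomorphism onto its image,
  so all conditions can be checked in parameter space. The function \<open>lab\<close> encodes
  disjointness and distinctness of the regions with one check per region instead of one per
  pair.\<close>

lemma card_pi0_parametrized:
  fixes \<psi> :: "'p::topological_space \<Rightarrow> 'x::topological_space" and P :: "'i \<Rightarrow> 'p set"
  assumes S: "S = \<psi> ` (\<Union>i\<in>I. P i)"
    and \<psi>: "continuous_on UNIV \<psi>" and \<kappa>: "continuous_on UNIV \<kappa>" and inv: "\<And>p. \<kappa> (\<psi> p) = p"
    and P: "\<And>i. i \<in> I \<Longrightarrow> open (P i) \<and> path_connected (P i) \<and> P i \<noteq> {}"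
    and lab: "\<And>i p. i \<in> I \<Longrightarrow> p \<in> P i \<Longrightarrow> lab p = i"
  shows "card (pi0 S) = card I"
proof -
  have inj: "inj \<psi>" by (metis inv injI)
  have "pi0 S = (\<lambda>i. \<psi> ` P i) ` I"
  proof (rule pi0_disjoint_open_cover)
    show "\<Union>((\<lambda>i. \<psi> ` P i) ` I) = S" by (auto simp: S)
    fix U V assume "U \<in> (\<lambda>i. \<psi> ` P i) ` I" "V \<in> (\<lambda>i. \<psi> ` P i) ` I" "U \<noteq> V"
    then obtain i k where ik: "i \<in> I" "k \<in> I" "i \<noteq> k" and UV: "U = \<psi> ` P i" "V = \<psi> ` P k" by blast
    then have "P i \<inter> P k = {}" using lab by blast
    then show "U \<inter> V = {}" unfolding UV by (simp add: image_Int[OF inj, symmetric])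
  next
    show "{} \<notin> (\<lambda>i. \<psi> ` P i) ` I" using P by auto
    fix U assume "U \<in> (\<lambda>i. \<psi> ` P i) ` I"
    then obtain i where i: "i \<in> I" "U = \<psi> ` P i" by blast
    show "path_connected U"
      unfolding i(2) using P[OF i(1)] continuous_on_subset[OF \<psi>]
      by (intro path_connected_continuous_image) auto
    have "U = S \<inter> \<kappa> -` P i" using i inv by (auto simp: S)
    then show "openin (top_of_set S) U"
      using continuous_openin_preimage_gen[OF continuous_on_subset[OF \<kappa> subset_UNIV]] P[OF i(1)] by simp
  qed
  moreover have "inj_on (\<lambda>i. \<psi> ` P i) I"
  proof (rule inj_onI)
    fix i k assume ik: "i \<in> I" "k \<in> I" and "\<psi> ` P i = \<psi> ` P k"
    then have "P i = P k" using inj by (simp add: inj_image_eq_iff)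
    moreover obtain p where "p \<in> P i" using P[OF ik(1)] by blast
    ultimately show "i = k" using lab ik by metis
  qed
  ultimately show ?thesis by (simp add: card_image)
qed

subsection \<open>Regions between graphs\<close>

definition above_graph :: "('v \<Rightarrow> real) \<Rightarrow> (real \<times> 'v) set"
  where "above_graph \<phi> = {(a, v). \<phi> v < a}"

definition below_graph :: "('v \<Rightarrow> real) \<Rightarrow> (real \<times> 'v) set"
  where "below_graph \<phi> = {(a, v). a < \<phi> v}"

definition strip :: "('v \<Rightarrow> real) \<Rightarrow> ('v \<Rightarrow> real) \<Rightarrow> 'v set \<Rightarrow> (real \<times> 'v) set"
  where "strip \<phi> \<theta> C = {(a, v). v \<in> C \<and> \<phi> v < a \<and> a < \<theta> v}"

text \<open>A shear carries a convex half-space onto the region above the graph.\<close>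

lemma above_region:
  fixes \<phi> :: "'v::real_normed_vector \<Rightarrow> real"
  assumes \<phi>: "continuous_on UNIV \<phi>"
  shows "open (above_graph \<phi>) \<and> path_connected (above_graph \<phi>) \<and> above_graph \<phi> \<noteq> {}"
proof (intro conjI)
  have c: "continuous_on UNIV (\<lambda>p :: real \<times> 'v. \<phi> (snd p))"
    by (intro continuous_on_compose2[OF \<phi>] continuous_intros) auto
  show "open (above_graph \<phi>)"
    unfolding above_graph_def split_beta by (intro open_Collect_less c continuous_intros)
  have "above_graph \<phi> = (\<lambda>p. (\<phi> (snd p) + fst p, snd p)) ` ({0<..} \<times> UNIV)"
  proof (intro equalityI subsetI)
    fix p assume "p \<in> above_graph \<phi>"
    then show "p \<in> (\<lambda>p. (\<phi> (snd p) + fst p, snd p)) ` ({0<..} \<times> UNIV)"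
      by (intro image_eqI[of _ _ "(fst p - \<phi> (snd p), snd p)"]) (auto simp: above_graph_def)
  qed (auto simp: above_graph_def)
  moreover have "path_connected ((\<lambda>p. (\<phi> (snd p) + fst p, snd p)) ` ({0<..} \<times> (UNIV :: 'v set)))"
  proof (rule path_connected_continuous_image)
    show "continuous_on ({0<..} \<times> UNIV) (\<lambda>p. (\<phi> (snd p) + fst p, snd p))"
      by (rule continuous_on_subset[OF _ subset_UNIV]) (intro continuous_intros c)
    show "path_connected ({0::real<..} \<times> (UNIV :: 'v set))"
      by (intro convex_imp_path_connected convex_Times) auto
  qed
  ultimately show "path_connected (above_graph \<phi>)" by simp
  have "(\<phi> 0 + 1, 0) \<in> above_graph \<phi>" by (simp add: above_graph_def)
  then show "above_graph \<phi> \<noteq> {}" by blast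
qed

lemma below_region:
  fixes \<phi> :: "'v::real_normed_vector \<Rightarrow> real"
  assumes \<phi>: "continuous_on UNIV \<phi>"
  shows "open (below_graph \<phi>) \<and> path_connected (below_graph \<phi>) \<and> below_graph \<phi> \<noteq> {}"
proof (intro conjI)
  have c: "continuous_on UNIV (\<lambda>p :: real \<times> 'v. \<phi> (snd p))"
    by (intro continuous_on_compose2[OF \<phi>] continuous_intros) auto
  show "open (below_graph \<phi>)"
    unfolding below_graph_def split_beta by (intro open_Collect_less c continuous_intros)
  have "continuous_on UNIV (\<lambda>v. - \<phi> v)" by (intro continuous_intros \<phi>)
  then have *: "path_connected (above_graph (\<lambda>v. - \<phi> v))" "above_graph (\<lambda>v. - \<phi> v) \<noteq> {}"
    using above_region by blast+
  have eq: "below_graph \<phi> = (\<lambda>p. (- fst p, snd p)) ` above_graph (\<lambda>v. - \<phi> v)"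
  proof (intro equalityI subsetI)
    fix p assume "p \<in> below_graph \<phi>"
    then show "p \<in> (\<lambda>p. (- fst p, snd p)) ` above_graph (\<lambda>v. - \<phi> v)"
      by (intro image_eqI[of _ _ "(- fst p, snd p)"]) (auto simp: above_graph_def below_graph_def)
  qed (auto simp: above_graph_def below_graph_def)
  show "path_connected (below_graph \<phi>)" "below_graph \<phi> \<noteq> {}"
    unfolding eq using * by (auto intro!: path_connected_continuous_image continuous_intros)
qed

text \<open>The fibres are intervals; rescaling each to the unit interval presents the strip as a
  continuous image of a product with \<open>C\<close>.\<close>

lemma strip_region:
  fixes \<phi> \<theta> :: "'v::real_normed_vector \<Rightarrow> real"
  assumes \<phi>: "continuous_on UNIV \<phi>" and \<theta>: "continuous_on UNIV \<theta>"
    and C: "open C" "path_connected C" "C \<noteq> {}" and less: "\<And>v. v \<in> C \<Longrightarrow> \<phi> v < \<theta> v"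
  shows "open (strip \<phi> \<theta> C) \<and> path_connected (strip \<phi> \<theta> C) \<and> strip \<phi> \<theta> C \<noteq> {}"
proof (intro conjI)
  have c: "continuous_on UNIV (\<lambda>p :: real \<times> 'v. \<phi> (snd p))" "continuous_on UNIV (\<lambda>p :: real \<times> 'v. \<theta> (snd p))"
    by (intro continuous_on_compose2[OF \<phi>] continuous_on_compose2[OF \<theta>] continuous_intros; simp)+
  have "strip \<phi> \<theta> C = (UNIV \<times> C) \<inter> {p. \<phi> (snd p) < fst p} \<inter> {p. fst p < \<theta> (snd p)}"
    by (auto simp: strip_def)
  moreover have "open {p. \<phi> (snd p) < fst p}" "open {p. fst p < \<theta> (snd p)}"
    by (intro open_Collect_less c continuous_intros)+
  ultimately show "open (strip \<phi> \<theta> C)" using C(1) by (simp add: open_Int open_Times)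
  let ?h = "\<lambda>p. (\<phi> (snd p) + fst p * (\<theta> (snd p) - \<phi> (snd p)), snd p)"
  have "strip \<phi> \<theta> C = ?h ` ({0<..<1} \<times> C)"
  proof (intro equalityI subsetI)
    fix p assume "p \<in> strip \<phi> \<theta> C"
    then obtain a v where p: "p = (a, v)" "v \<in> C" "\<phi> v < a" "a < \<theta> v" by (auto simp: strip_def)
    then have "p = ?h ((a - \<phi> v) / (\<theta> v - \<phi> v), v)" "(a - \<phi> v) / (\<theta> v - \<phi> v) \<in> {0<..<1}"
      by (simp_all add: field_simps)
    with p(2) show "p \<in> ?h ` ({0<..<1} \<times> C)" by blast
  next
    fix p assume "p \<in> ?h ` ({0<..<1} \<times> C)"
    then obtain t v where tv: "t > 0" "t < 1" "v \<in> C" and p: "p = (\<phi> v + t * (\<theta> v - \<phi> v), v)" by auto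
    have d: "\<theta> v - \<phi> v > 0" using less[OF tv(3)] by simp
    have "t * (\<theta> v - \<phi> v) > 0" using d tv by simp
    moreover have "t * (\<theta> v - \<phi> v) < 1 * (\<theta> v - \<phi> v)" using d tv by (intro mult_strict_right_mono)
    ultimately show "p \<in> strip \<phi> \<theta> C" using tv by (simp add: strip_def p)
  qed
  moreover have "path_connected (?h ` ({0<..<1} \<times> C))"
    by (intro path_connected_continuous_image path_connected_Times continuous_on_Pair continuous_on_add
        continuous_on_mult continuous_on_diff continuous_on_subset[OF c(1)] continuous_on_subset[OF c(2)] 
        continuous_on_fst continuous_on_snd continuous_on_id convex_imp_path_connected C) auto
  ultimately show "path_connected (strip \<phi> \<theta> C)" by simp
  obtain v where "v \<in> C" using C(3) by blast
  with less[OF this] have "((\<phi> v + \<theta> v) / 2, v) \<in> strip \<phi> \<theta> C" by (simp add: strip_def)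
  then show "strip \<phi> \<theta> C \<noteq> {}" by blast
qed

section \<open>Invertible elements\<close>

definition det2 :: "M2 \<Rightarrow> complex"
  where "det2 x = entries x $ 1 $ 1 * entries x $ 2 $ 2 - entries x $ 1 $ 2 * entries x $ 2 $ 1"

lemma det2_mat2 [simp]: "det2 (mat2 a b c d) = a * d - b * c"
  by (simp add: det2_def)

lemma invertible_M2_iff: "invertible_elem (x :: M2) \<longleftrightarrow> det2 x \<noteq> 0"
proof
  assume "invertible_elem x"
  then obtain y where "x * y = 1" by (auto simp: invertible_elem_def)
  moreover have "det2 (x * y) = det2 x * det2 y"
    by (cases x rule: mat2_cases; cases y rule: mat2_cases) (simp add: mat2_mult algebra_simps)
  ultimately have "det2 x * det2 y = 1" by (simp add: mat2_one)
  then show "det2 x \<noteq> 0" by auto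
next
  assume d: "det2 x \<noteq> 0"
  obtain a b c e where x: "x = mat2 a b c e" by (rule mat2_cases)
  let ?y = "(1 / det2 x) *\<^sub>C mat2 e (- b) (- c) a"
  have "x * ?y = (1 / det2 x) *\<^sub>C mat2 (det2 x) 0 0 (det2 x)"
    "?y * x = (1 / det2 x) *\<^sub>C mat2 (det2 x) 0 0 (det2 x)"
    by (simp_all add: x mat2_mult mult_scaleC_left mult_scaleC_right algebra_simps)
  then have "x * ?y = 1" "?y * x = 1" using d by (simp_all add: mat2_scaleC mat2_one)
  then show "invertible_elem x" unfolding invertible_elem_def by blast
qed

lemma invertible_dsum_iff: "invertible_elem x \<longleftrightarrow> invertible_elem (dfst x) \<and> invertible_elem (dsnd x)"
proof
  assume "invertible_elem (dfst x) \<and> invertible_elem (dsnd x)"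
  then obtain y z where "dfst x * y = 1" "y * dfst x = 1" "dsnd x * z = 1" "z * dsnd x = 1"
    by (auto simp: invertible_elem_def)
  then have "x * (y \<oplus> z) = 1 \<and> (y \<oplus> z) * x = 1" by (simp add: dsum_defs)
  then show "invertible_elem x" unfolding invertible_elem_def by blast
qed (auto simp: invertible_elem_def dsum_defs)

text \<open>The line parameter is complex: finitely many zeros do not disconnect the plane, whereas
  they would cut a real line.\<close>

lemma path_connected_nonvanishing:
  fixes F :: "'a::cstar_algebra \<Rightarrow> complex"
  assumes E: "csubspace E" and F: "\<And>x d. \<exists>p. \<forall>t. F (x + t *\<^sub>C d) = poly p t"
  shows "path_connected {x \<in> E. F x \<noteq> 0}" (is "path_connected ?S")
  unfolding path_connected_component
proof (intro ballI)
  fix x y assume x: "x \<in> ?S" and y: "y \<in> ?S"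
  define l where "l t = x + t *\<^sub>C (y - x)" for t
  obtain p where p: "\<And>t. F (l t) = poly p t" using F[of x "y - x"] unfolding l_def by blast
  have "poly p 0 \<noteq> 0" using x p[of 0] by (simp add: l_def)
  then have "finite {t. poly p t = 0}" by (metis poly_0 poly_roots_finite)
  then have "path_connected (- {t. poly p t = 0})"
    by (intro path_connected_complement_countable) (simp_all add: countable_finite)
  moreover have "continuous_on T l" for T
    unfolding l_def by (intro continuous_intros linear_continuous_on[OF bounded_linear_scaleC_left])
  ultimately have "path_connected (l ` (- {t. poly p t = 0}))"
    by (intro path_connected_continuous_image)
  moreover have "x \<in> l ` (- {t. poly p t = 0})"
    using x p[of 0] by (intro image_eqI[of _ _ 0]) (auto simp: l_def)
  moreover have "y \<in> l ` (- {t. poly p t = 0})"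
    using y p[of 1] by (intro image_eqI[of _ _ 1]) (auto simp: l_def)
  moreover have "l ` (- {t. poly p t = 0}) \<subseteq> ?S"
    using x y E p by (auto simp: l_def intro!: complex_vector.subspace_add complex_vector.subspace_scale
        complex_vector.subspace_diff)
  ultimately show "path_component ?S x y"
    unfolding path_connected_component by (meson path_component_of_subset)
qed

lemma card_pi0_invertible:
  fixes E :: "(M2, M2) dsum set"
  assumes E: "csubspace E" and "1 \<in> E"
  shows "card (pi0 {x \<in> E. invertible_elem x}) = 1"
proof -
  define F where "F x = det2 (dfst x) * det2 (dsnd x)" for x :: "(M2, M2) dsum"
  have inv: "invertible_elem x \<longleftrightarrow> F x \<noteq> 0" for x
    by (simp add: F_def invertible_dsum_iff invertible_M2_iff)
  have det: "\<exists>p. \<forall>t. det2 (x + t *\<^sub>C d) = poly p t" for x d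
  proof -
    define e where "e i j = [:entries x $ i $ j, entries d $ i $ j:]" for i j
    have "entries (x + t *\<^sub>C d) $ i $ j = poly (e i j) t" for t i j
      by (simp add: e_def plus_cmat.rep_eq scaleC_cmat.rep_eq)
    then have "det2 (x + t *\<^sub>C d) = poly (e 1 1 * e 2 2 - e 1 2 * e 2 1) t" for t
      by (simp add: det2_def)
    then show ?thesis by blast
  qed
  have "\<exists>p. \<forall>t. F (x + t *\<^sub>C d) = poly p t" for x d
  proof -
    obtain p q where "\<And>t. det2 (dfst x + t *\<^sub>C dfst d) = poly p t" "\<And>t. det2 (dsnd x + t *\<^sub>C dsnd d) = poly q t"
      using det by metis
    then have "F (x + t *\<^sub>C d) = poly (p * q) t" for t
      by (simp add: F_def dsum_simps)
    then show ?thesis by blast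
  qed
  from path_connected_nonvanishing[OF E this] have "path_connected {x \<in> E. invertible_elem x}"
    by (simp add: inv)
  moreover have "invertible_elem (1 :: (M2, M2) dsum)"
    unfolding invertible_elem_def by (rule exI[of _ 1]) simp
  ultimately show ?thesis using \<open>1 \<in> E\<close> by (intro card_pi0_path_connected) auto
qed

section \<open>Invertible self-adjoint elements\<close>

text \<open>Coordinates along the identity and the three Pauli matrices; the eigenvalues are a plus
  or minus the norm of (b, c, d).\<close>

definition hermitian2 :: "real \<times> real \<times> real \<times> real \<Rightarrow> M2"
  where "hermitian2 = (\<lambda>(a, b, c, d). mat2 (of_real (a + d)) (Complex b (- c)) (Complex b c) (of_real (a - d)))"

lemma linear_hermitian2: "linear hermitian2"
  by (rule linearI) (auto simp: hermitian2_def mat2_simps complex_eq_iff algebra_simps)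

lemma star_hermitian2 [simp]: "(hermitian2 p)\<^sup>\<star> = hermitian2 p"
  by (cases p) (simp add: hermitian2_def mat2_star complex_eq_iff)

lemma M2_selfadjointE:
  fixes x :: M2
  assumes "x\<^sup>\<star> = x"
  obtains p where "x = hermitian2 p"
proof -
  obtain a b c d where x: "x = mat2 a b c d" by (rule mat2_cases)
  with assms have "cnj a = a" "cnj d = d" and b: "b = cnj c" by (simp_all add: mat2_star)
  then have "Im a = 0" "Im d = 0" by (simp_all add: complex_eq_iff)
  then have "x = hermitian2 ((Re a + Re d) / 2, Re c, Im c, (Re a - Re d) / 2)"
    unfolding x b by (simp add: hermitian2_def complex_eq_iff field_simps)
  then show ?thesis by (rule that)
qed

lemma invertible_hermitian2_iff: "invertible_elem (hermitian2 (a, v)) \<longleftrightarrow> \<bar>a\<bar> \<noteq> norm v"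
proof -
  obtain b c d where v: "v = (b, c, d)" by (cases v)
  have "det2 (hermitian2 (a, v)) = of_real (a\<^sup>2 - (norm v)\<^sup>2)"
    by (simp add: v hermitian2_def norm_prod_def complex_eq_iff power2_eq_square algebra_simps)
  then have "invertible_elem (hermitian2 (a, v)) \<longleftrightarrow> a\<^sup>2 \<noteq> (norm v)\<^sup>2"
    unfolding invertible_M2_iff by (metis of_real_eq_0_iff eq_iff_diff_eq_0)
  also have "a\<^sup>2 = (norm v)\<^sup>2 \<longleftrightarrow> \<bar>a\<bar> = norm v"
    by (metis abs_norm_cancel power2_eq_iff_nonneg abs_ge_zero norm_ge_zero power2_abs)
  finally show ?thesis .
qed

text \<open>The three signatures of an invertible Hermitian 2 by 2 matrix: positive, negative,
  indefinite. Two summands choose independently, whence 9. The base of the indefinite region omits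
  0, over which the fibre would be empty.\<close>

definition cone_regions :: "(real \<times> 'v::real_normed_vector) set list"
  where "cone_regions = [above_graph norm, below_graph (\<lambda>v. - norm v), strip (\<lambda>v. - norm v) norm (- {0})]"

definition cone_label :: "real \<times> 'v::real_normed_vector \<Rightarrow> nat"
  where "cone_label = (\<lambda>(a, v). if norm v < a then 0 else if a < - norm v then 1 else 2)"

lemma cone_regions_topology:
  assumes "U \<in> set (cone_regions :: (real \<times> 'v::euclidean_space) set list)" "2 \<le> DIM('v)"
  shows "open U \<and> path_connected U \<and> U \<noteq> {}"
proof -
  have c: "continuous_on UNIV (norm :: 'v \<Rightarrow> real)" "continuous_on UNIV (\<lambda>v :: 'v. - norm v)"
    by (intro continuous_intros)+
  obtain b :: 'v where "b \<in> Basis" using nonempty_Basis by blast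
  then have "- {0 :: 'v} \<noteq> {}" using nonzero_Basis by blast
  then have "open (strip (\<lambda>v. - norm v) norm (- {0 :: 'v})) \<and>
      path_connected (strip (\<lambda>v. - norm v) norm (- {0 :: 'v})) \<and> strip (\<lambda>v. - norm v) norm (- {0 :: 'v}) \<noteq> {}"
    using assms(2) by (intro strip_region c path_connected_punctured_universe) auto
  with assms(1) above_region[OF c(1)] below_region[OF c(2)] show ?thesis
    by (auto simp: cone_regions_def)
qed

lemma cone_label_region: "i < 3 \<Longrightarrow> (a, v) \<in> cone_regions ! i \<Longrightarrow> cone_label (a, v) = i"
  using norm_ge_zero[of v]
  by (auto simp: cone_regions_def cone_label_def above_graph_def below_graph_def strip_def less_Suc_eq numeral_3_eq_3
      simp del: norm_ge_zero)

lemma UN_nth: "(\<Union>i<length xs. xs ! i) = \<Union>(set xs)"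
  by (auto simp: set_conv_nth)

lemma length_cone_regions: "length cone_regions = 3"
  by (simp add: cone_regions_def)

lemma Union_cone_regions: "(\<Union>i<3. cone_regions ! i) = {(a, v). \<bar>a\<bar> \<noteq> norm v}"
proof -
  have "(a, v) \<in> \<Union>(set cone_regions) \<longleftrightarrow> \<bar>a\<bar> \<noteq> norm v" for a and v :: 'a
  proof -
    have "(a, v) \<in> \<Union>(set cone_regions)
        \<longleftrightarrow> norm v < a \<or> a < - norm v \<or> (v \<noteq> 0 \<and> - norm v < a \<and> a < norm v)"
      by (simp add: cone_regions_def above_graph_def below_graph_def strip_def)
    then show ?thesis using norm_ge_zero[of v] norm_eq_zero[of v] by argo
  qed
  then have "\<Union>(set cone_regions) = {(a, v :: 'a). \<bar>a\<bar> \<noteq> norm v}" by auto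
  then show ?thesis using UN_nth[of "cone_regions :: (real \<times> 'a) set list"] by (simp add: length_cone_regions)
qed

lemma card_pi0_selfadjoint_invertible:
  "card (pi0 {x :: (M2, M2) dsum. invertible_elem x \<and> x\<^sup>\<star> = x}) = 9"
proof -
  define \<psi> where "\<psi> = (\<lambda>(p, q). hermitian2 p \<oplus> hermitian2 q)"
  define \<kappa>1 where "\<kappa>1 x = ((Re (entries x $ 1 $ 1) + Re (entries x $ 2 $ 2)) / 2,
      Re (entries x $ 2 $ 1), Im (entries x $ 2 $ 1), (Re (entries x $ 1 $ 1) - Re (entries x $ 2 $ 2)) / 2)"
    for x :: M2
  define P where "P = (\<lambda>(i, k). (cone_regions ! i) \<times> (cone_regions ! k)
      :: ((real \<times> real \<times> real \<times> real) \<times> (real \<times> real \<times> real \<times> real)) set)"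
  have "card (pi0 {x :: (M2, M2) dsum. invertible_elem x \<and> x\<^sup>\<star> = x}) = card ({..<3::nat} \<times> {..<3::nat})"
  proof (rule card_pi0_parametrized)
    have "(\<Union>i\<in>{..<3} \<times> {..<3}. P i) = (\<Union>i<3. cone_regions ! i) \<times> (\<Union>i<3. cone_regions ! i)"
      by (auto simp: P_def)
    then have UP: "(\<Union>i\<in>{..<3} \<times> {..<3}. P i) = {(p, q). \<bar>fst p\<bar> \<noteq> norm (snd p) \<and> \<bar>fst q\<bar> \<noteq> norm (snd q)}"
      unfolding Union_cone_regions by auto
    show "{x. invertible_elem x \<and> x\<^sup>\<star> = x} = \<psi> ` (\<Union>i\<in>{..<3} \<times> {..<3}. P i)"
    proof (intro equalityI subsetI)
      fix x :: "(M2, M2) dsum" assume "x \<in> {x. invertible_elem x \<and> x\<^sup>\<star> = x}"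
      moreover obtain y z where x: "x = y \<oplus> z" by (cases x)
      ultimately have inv: "invertible_elem y" "invertible_elem z" and "y\<^sup>\<star> = y" "z\<^sup>\<star> = z"
        by (simp_all add: invertible_dsum_iff star_dsum_def)
      then obtain p q where pq: "y = hermitian2 p" "z = hermitian2 q" by (metis M2_selfadjointE)
      with inv have "(p, q) \<in> (\<Union>i\<in>{..<3} \<times> {..<3}. P i)"
        unfolding UP by (cases p; cases q) (simp add: invertible_hermitian2_iff)
      then show "x \<in> \<psi> ` (\<Union>i\<in>{..<3} \<times> {..<3}. P i)"
        by (rule rev_image_eqI) (simp add: x pq \<psi>_def)
    next
      fix x assume "x \<in> \<psi> ` (\<Union>i\<in>{..<3} \<times> {..<3}. P i)"
      then obtain p q where "\<bar>fst p\<bar> \<noteq> norm (snd p)" "\<bar>fst q\<bar> \<noteq> norm (snd q)" "x = hermitian2 p \<oplus> hermitian2 q"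
        unfolding UP by (auto simp: \<psi>_def)
      then show "x \<in> {x. invertible_elem x \<and> x\<^sup>\<star> = x}"
        by (cases p; cases q) (simp add: invertible_dsum_iff star_dsum_def invertible_hermitian2_iff)
    qed
    have "linear \<psi>"
      by (rule linearI)
        (auto simp: \<psi>_def dsum_simps linear_add[OF linear_hermitian2, symmetric] linear_scale[OF linear_hermitian2, symmetric])
    then show "continuous_on UNIV \<psi>" by (simp add: linear_conv_bounded_linear linear_continuous_on)
    show "continuous_on UNIV (\<lambda>x :: (M2, M2) dsum. (\<kappa>1 (dfst x), \<kappa>1 (dsnd x)))"
      unfolding \<kappa>1_def
      by (intro continuous_on_Pair continuous_on_divide continuous_on_add continuous_on_diff continuous_on_Re
          continuous_on_Im continuous_on_const continuous_on_entry_dfst continuous_on_entry_dsnd) simp_all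
    show "(\<kappa>1 (dfst (\<psi> p)), \<kappa>1 (dsnd (\<psi> p))) = p" for p
      by (auto simp: \<kappa>1_def \<psi>_def hermitian2_def split: prod.splits)
    show "open (P i) \<and> path_connected (P i) \<and> P i \<noteq> {}" if "i \<in> {..<3} \<times> {..<3}" for i
    proof -
      have *: "open U \<and> path_connected U \<and> U \<noteq> {}"
        if "k < 3" "U = cone_regions ! k" for k and U :: "(real \<times> real \<times> real \<times> real) set"
        using that by (intro cone_regions_topology) (simp_all add: length_cone_regions)
      show ?thesis using that * by (auto simp: P_def intro!: open_Times path_connected_Times)
    qed
    show "(case p of (p, q) \<Rightarrow> (cone_label p, cone_label q)) = i" if "i \<in> {..<3} \<times> {..<3}" "p \<in> P i" for i p
      using that by (auto simp: P_def cone_label_region)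
  qed
  then show ?thesis by simp
qed

subsection \<open>The operator system\<close>

definition E_param :: "real \<times> real \<times> real \<Rightarrow> (M2, M2) dsum"
  where "E_param = (\<lambda>(a, b, c). mat2 (of_real a) (Complex b (- c)) (Complex b c) (of_real a)
      \<oplus> mat2 (of_real a) (Complex (2 * b) (- c / 2)) (Complex (2 * b) (c / 2)) (of_real a))"

definition stretched_norm :: "real \<times> real \<Rightarrow> real"
  where "stretched_norm v = norm (2 * fst v, snd v / 2)"

lemma E_param_hermitian2: "E_param (a, b, c) = hermitian2 (a, b, c, 0) \<oplus> hermitian2 (a, 2 * b, c / 2, 0)"
  by (simp add: E_param_def hermitian2_def)

lemma linear_E_param: "linear E_param"
  by (rule linearI) (auto simp: E_param_def dsum_simps mat2_simps complex_eq_iff algebra_simps)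

lemma invertible_E_param_iff:
  "invertible_elem (E_param (a, v)) \<longleftrightarrow> \<bar>a\<bar> \<noteq> norm v \<and> \<bar>a\<bar> \<noteq> stretched_norm v"
  by (cases v) (simp add: E_param_hermitian2 invertible_dsum_iff invertible_hermitian2_iff
      stretched_norm_def norm_prod_def)

lemma selfadjoint_E\<^sub>\<sigma>_iff: "x \<in> E\<^sub>\<sigma> \<and> x\<^sup>\<star> = x \<longleftrightarrow> x \<in> range E_param"
proof
  assume x: "x \<in> E\<^sub>\<sigma> \<and> x\<^sup>\<star> = x"
  show "x \<in> range E_param"
  proof (cases x rule: dsum_mat2_cases)
    case (1 p11 p12 p21 p22 q11 q12 q21 q22)
    from x have "cnj p11 = p11" and p12: "p12 = cnj p21" and e: "p22 = p11" "q11 = p11" "q22 = p11"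
      "q12 = 5/4 * p12 + 3/4 * p21" "q21 = 3/4 * p12 + 5/4 * p21"
      unfolding 1 mem_E\<^sub>\<sigma>_entries_iff by (auto simp: star_dsum_def mat2_star)
    then have "Im p11 = 0" by (simp add: complex_eq_iff)
    then have "x = E_param (Re p11, Re p21, Im p21)"
      unfolding 1 e p12 by (simp add: E_param_def complex_eq_iff)
    then show ?thesis by simp
  qed
next
  assume "x \<in> range E_param"
  then obtain a b c where x: "x = E_param (a, b, c)" by auto
  have "x \<in> E\<^sub>\<sigma>" unfolding x E_param_def by (simp add: mem_E\<^sub>\<sigma>_entries_iff complex_eq_iff)
  moreover have "x\<^sup>\<star> = x" by (simp add: x E_param_hermitian2 star_dsum_def)
  ultimately show "x \<in> E\<^sub>\<sigma> \<and> x\<^sup>\<star> = x" ..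
qed

text \<open>The difference of the squares is 4 b^2 + c^2/4 - b^2 - c^2 = 3/4 (4 b^2 - c^2).\<close>

lemma norm_less_stretched_norm_iff: "norm v < stretched_norm v \<longleftrightarrow> \<bar>snd v\<bar> < 2 * \<bar>fst v\<bar>"
proof -
  have "norm v < stretched_norm v \<longleftrightarrow> (snd v)\<^sup>2 < (2 * fst v)\<^sup>2"
    by (cases v) (simp add: stretched_norm_def norm_prod_def power2_eq_square field_simps)
  also have "\<dots> \<longleftrightarrow> \<bar>snd v\<bar> < \<bar>2 * fst v\<bar>" by (metis abs_le_square_iff not_le)
  finally show ?thesis by (simp add: abs_mult)
qed

lemma stretched_norm_less_norm_iff: "stretched_norm v < norm v \<longleftrightarrow> 2 * \<bar>fst v\<bar> < \<bar>snd v\<bar>"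
proof -
  have "stretched_norm v < norm v \<longleftrightarrow> (2 * fst v)\<^sup>2 < (snd v)\<^sup>2"
    by (cases v) (simp add: stretched_norm_def norm_prod_def power2_eq_square field_simps)
  also have "\<dots> \<longleftrightarrow> \<bar>2 * fst v\<bar> < \<bar>snd v\<bar>" by (metis abs_le_square_iff not_le)
  finally show ?thesis by (simp add: abs_mult)
qed

lemma stretched_norm_nonneg: "0 \<le> stretched_norm v"
  by (simp add: stretched_norm_def)

lemma stretched_norm_pos: "v \<noteq> 0 \<Longrightarrow> 0 < stretched_norm v"
  by (cases v) (auto simp: stretched_norm_def zero_prod_def)

lemma continuous_stretched_norm: "continuous_on UNIV stretched_norm"
  unfolding stretched_norm_def by (intro continuous_intros) simp

text \<open>An intersection of two open half-planes, so that convexity gives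
  path-connectedness.\<close>

definition wedge :: "real \<times> real \<Rightarrow> real \<times> real \<Rightarrow> (real \<times> real) set"
  where "wedge p q = {v. inner p v < 0} \<inter> {v. inner q v < 0}"

lemma wedge_topology: "open (wedge p q)" "path_connected (wedge p q)"
  unfolding wedge_def
  by (simp_all add: open_Int open_halfspace_lt convex_imp_path_connected convex_Int convex_halfspace_lt)

lemma mem_wedge: "(b, c) \<in> wedge (p1, p2) (q1, q2) \<longleftrightarrow> p1 * b + p2 * c < 0 \<and> q1 * b + q2 * c < 0"
  by (simp add: wedge_def)

text \<open>\<open>R\<close>, \<open>L\<close>, \<open>T\<close>, \<open>B\<close> are the right,
  left, top and bottom wedges cut out by |c| = 2 |b|. In the last eight strips one summand is
  definite and the other indefinite. Four of them have \<open>a > 0\<close>; the other four are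
  their mirror images under \<open>a \<mapsto> - a\<close> in the same order, which gives the offset
  4 in \<open>E_label\<close>.\<close>

definition E_regions :: "(real \<times> real \<times> real) set list"
  where "E_regions =
   (let f = norm; g = stretched_norm; f' = (\<lambda>v. - norm v); g' = (\<lambda>v. - stretched_norm v);
        R = wedge (- 2, 1) (- 2, - 1); L = wedge (2, 1) (2, - 1);
        T = wedge (2, - 1) (- 2, - 1); B = wedge (2, 1) (- 2, 1) in
    [above_graph (\<lambda>v. max (f v) (g v)), below_graph (\<lambda>v. - max (f v) (g v)),
     strip (\<lambda>v. - min (f v) (g v)) (\<lambda>v. min (f v) (g v)) (- {0}),
     strip f g R, strip f g L, strip g f T, strip g f B,
     strip g' f' R, strip g' f' L, strip f' g' T, strip f' g' B])"

definition E_label :: "real \<times> real \<times> real \<Rightarrow> nat"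
  where "E_label = (\<lambda>(a, v). let f = norm v; g = stretched_norm v in
    if f < a \<and> g < a then 0 else if a < - f \<and> a < - g then 1 else if \<bar>a\<bar> < f \<and> \<bar>a\<bar> < g then 2
    else (if a > 0 then 0 else 4) + (if f < g then if fst v > 0 then 3 else 4 else if snd v > 0 then 5 else 6))"

lemma E_regions_topology:
  assumes "U \<in> set E_regions"
  shows "open U \<and> path_connected U \<and> U \<noteq> {}"
proof -
  have c: "continuous_on UNIV (norm :: real \<times> real \<Rightarrow> real)" "continuous_on UNIV (\<lambda>v :: real \<times> real. - norm v)"
    "continuous_on UNIV (\<lambda>v. - stretched_norm v)"
    "continuous_on UNIV (\<lambda>v. max (norm v) (stretched_norm v))" "continuous_on UNIV (\<lambda>v. - max (norm v) (stretched_norm v))"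
    "continuous_on UNIV (\<lambda>v. min (norm v) (stretched_norm v))" "continuous_on UNIV (\<lambda>v. - min (norm v) (stretched_norm v))"
    by (intro continuous_intros continuous_stretched_norm)+
  note c = c continuous_stretched_norm
  have "(1, 0) \<in> wedge (- 2, 1) (- 2, - 1)" "(- 1, 0) \<in> wedge (2, 1) (2, - 1)"
    "(0, 1) \<in> wedge (2, - 1) (- 2, - 1)" "(0, - 1) \<in> wedge (2, 1) (- 2, 1)"
    by (simp_all add: mem_wedge)
  then have ne: "wedge (- 2, 1) (- 2, - 1) \<noteq> {}" "wedge (2, 1) (2, - 1) \<noteq> {}"
    "wedge (2, - 1) (- 2, - 1) \<noteq> {}" "wedge (2, 1) (- 2, 1) \<noteq> {}"
    by blast+
  have ne0: "- {0 :: real \<times> real} \<noteq> {}"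
    using \<open>(1, 0) \<in> wedge (- 2, 1) (- 2, - 1)\<close> by (auto simp: zero_prod_def)
  have lt: "v \<in> wedge (- 2, 1) (- 2, - 1) \<Longrightarrow> norm v < stretched_norm v"
    "v \<in> wedge (2, 1) (2, - 1) \<Longrightarrow> norm v < stretched_norm v"
    "v \<in> wedge (2, - 1) (- 2, - 1) \<Longrightarrow> stretched_norm v < norm v"
    "v \<in> wedge (2, 1) (- 2, 1) \<Longrightarrow> stretched_norm v < norm v" for v
    by (cases v; auto simp: norm_less_stretched_norm_iff stretched_norm_less_norm_iff mem_wedge)+
  have pc0: "path_connected (- {0 :: real \<times> real})" by (rule path_connected_punctured_universe) simp
  have mid: "open (strip (\<lambda>v. - min (norm v) (stretched_norm v)) (\<lambda>v. min (norm v) (stretched_norm v)) (- {0})) \<and>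
      path_connected (strip (\<lambda>v. - min (norm v) (stretched_norm v)) (\<lambda>v. min (norm v) (stretched_norm v)) (- {0})) \<and>
      strip (\<lambda>v. - min (norm v) (stretched_norm v)) (\<lambda>v. min (norm v) (stretched_norm v)) (- {0}) \<noteq> {}"
    by (rule strip_region[OF c(7,6) _ pc0 ne0]) (auto simp: min_def stretched_norm_pos)
  note regions = above_region[OF c(4)] below_region[OF c(5)] mid
    strip_region[OF c(1,8) wedge_topology ne(1) lt(1)] strip_region[OF c(1,8) wedge_topology ne(2) lt(2)]
    strip_region[OF c(8,1) wedge_topology ne(3) lt(3)] strip_region[OF c(8,1) wedge_topology ne(4) lt(4)]
    strip_region[OF c(3,2) wedge_topology ne(1) neg_less_iff_less[THEN iffD2, OF lt(1)]]
    strip_region[OF c(3,2) wedge_topology ne(2) neg_less_iff_less[THEN iffD2, OF lt(2)]]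
    strip_region[OF c(2,3) wedge_topology ne(3) neg_less_iff_less[THEN iffD2, OF lt(3)]]
    strip_region[OF c(2,3) wedge_topology ne(4) neg_less_iff_less[THEN iffD2, OF lt(4)]]
  show ?thesis
    by (insert assms, unfold E_regions_def Let_def list.set insert_iff empty_iff,
        elim disjE FalseE; hypsubst; rule regions; assumption?)
qed

lemma E_label_region: "i < 11 \<Longrightarrow> (a, b, c) \<in> E_regions ! i \<Longrightarrow> E_label (a, b, c) = i"
proof -
  assume i: "i < 11" and p: "(a, b, c) \<in> E_regions ! i"
  define f g where "f = norm (b, c)" and "g = stretched_norm (b, c)"
  have fg: "f \<ge> 0" "g \<ge> 0" by (simp_all add: f_def g_def stretched_norm_nonneg)
  have "i = 0 \<or> i = 1 \<or> i = 2 \<or> i = 3 \<or> i = 4 \<or> i = 5 \<or> i = 6 \<or> i = 7 \<or> i = 8 \<or> i = 9 \<or> i = 10"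
    using i by presburger
  then show ?thesis
    using p fg
    by (elim disjE) (auto simp: E_regions_def E_label_def Let_def above_graph_def below_graph_def strip_def mem_wedge
        abs_less_iff simp flip: f_def g_def)
qed

lemma Union_E_regions: "(\<Union>i<11. E_regions ! i) = {(a, v). \<bar>a\<bar> \<noteq> norm v \<and> \<bar>a\<bar> \<noteq> stretched_norm v}"
proof -
  have "(a, b, c) \<in> \<Union>(set E_regions) \<longleftrightarrow> \<bar>a\<bar> \<noteq> norm (b, c) \<and> \<bar>a\<bar> \<noteq> stretched_norm (b, c)" for a b c
  proof -
    define f g where "f = norm (b, c)" and "g = stretched_norm (b, c)"
    have fg: "f \<ge> 0" "g \<ge> 0" "(b, c) \<noteq> 0 \<longleftrightarrow> f > 0" "(b, c) \<noteq> 0 \<longrightarrow> g > 0" 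
      by (simp_all add: f_def g_def stretched_norm_nonneg stretched_norm_pos)
    \<comment> \<open>On the lines |c| = 2 |b| between the wedges the two norms agree, so nothing
      lies strictly between them and the eight strips miss no point.\<close>
    have less: "f < g \<longleftrightarrow> \<bar>c\<bar> < 2 * \<bar>b\<bar>" "g < f \<longleftrightarrow> 2 * \<bar>b\<bar> < \<bar>c\<bar>"
      by (simp_all add: f_def g_def norm_less_stretched_norm_iff stretched_norm_less_norm_iff)
    have "(a, b, c) \<in> \<Union>(set E_regions) \<longleftrightarrow>
        max f g < a \<or> a < - max f g \<or> ((b, c) \<noteq> 0 \<and> - min f g < a \<and> a < min f g) \<or>
        (\<bar>c\<bar> < 2 * b \<and> f < a \<and> a < g) \<or> (\<bar>c\<bar> < - 2 * b \<and> f < a \<and> a < g) \<or>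
        (2 * \<bar>b\<bar> < c \<and> g < a \<and> a < f) \<or> (2 * \<bar>b\<bar> < - c \<and> g < a \<and> a < f) \<or>
        (\<bar>c\<bar> < 2 * b \<and> - g < a \<and> a < - f) \<or> (\<bar>c\<bar> < - 2 * b \<and> - g < a \<and> a < - f) \<or>
        (2 * \<bar>b\<bar> < c \<and> - f < a \<and> a < - g) \<or> (2 * \<bar>b\<bar> < - c \<and> - f < a \<and> a < - g)"
      by (simp add: E_regions_def Let_def above_graph_def below_graph_def strip_def mem_wedge abs_less_iff
          flip: f_def g_def) argo
    then show ?thesis
      using fg less unfolding f_def[symmetric] g_def[symmetric] by (smt (verit))
  qed
  then have "\<Union>(set E_regions) = {(a, v). \<bar>a\<bar> \<noteq> norm v \<and> \<bar>a\<bar> \<noteq> stretched_norm v}" by auto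
  moreover have "length E_regions = 11" by (simp add: E_regions_def Let_def)
  ultimately show ?thesis using UN_nth[of E_regions] by simp
qed

lemma card_pi0_env_units_h: "card (pi0 (env_units_h (\<lambda>x. x) E\<^sub>\<sigma>)) = 11"
proof -
  define \<kappa> where "\<kappa> x = (Re (entries (dfst x) $ 1 $ 1), Re (entries (dfst x) $ 2 $ 1), Im (entries (dfst x) $ 2 $ 1))"
    for x :: "(M2, M2) dsum"
  have "card (pi0 (env_units_h (\<lambda>x. x) E\<^sub>\<sigma>)) = card {..<11::nat}"
  proof (rule card_pi0_parametrized)
    have "env_units_h (\<lambda>x. x) E\<^sub>\<sigma> = {x \<in> range E_param. invertible_elem x}"
      unfolding env_units_h_def env_units_def using selfadjoint_E\<^sub>\<sigma>_iff by blast
    also have "\<dots> = E_param ` {(a, v). \<bar>a\<bar> \<noteq> norm v \<and> \<bar>a\<bar> \<noteq> stretched_norm v}"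
      by (auto simp: invertible_E_param_iff)
    finally show "env_units_h (\<lambda>x. x) E\<^sub>\<sigma> = E_param ` (\<Union>i<11. E_regions ! i)"
      by (simp only: Union_E_regions)
    show "continuous_on UNIV E_param"
      using linear_E_param by (simp add: linear_conv_bounded_linear linear_continuous_on)
    show "continuous_on UNIV \<kappa>"
      unfolding \<kappa>_def
      by (intro continuous_on_Pair continuous_on_Re continuous_on_Im continuous_on_entry_dfst)
    show "\<kappa> (E_param p) = p" for p by (cases p) (simp add: \<kappa>_def E_param_def)
    have "length E_regions = 11" by (simp add: E_regions_def Let_def)
    then show "open (E_regions ! i) \<and> path_connected (E_regions ! i) \<and> E_regions ! i \<noteq> {}" if "i \<in> {..<11}" for i
      using that by (intro E_regions_topology nth_mem) auto
    show "E_label p = i" if "i \<in> {..<11}" "p \<in> E_regions ! i" for i p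
      using that by (cases p) (simp add: E_label_region)
  qed
  then show ?thesis by simp
qed

theorem mainTheorem5:
  shows "is_cstar_envelope TYPE('b::cstar_algebra) E\<^sub>\<sigma> (\<lambda>x :: (M2, M2) dsum. x) \<and>
    card (pi0 (env_units_h (\<lambda>x :: (M2, M2) dsum. x) E\<^sub>\<sigma>)) = 11 \<and>
    card (pi0 {x :: (M2, M2) dsum. invertible_elem x \<and> x\<^sup>\<star> = x}) = 9 \<and>
    card (pi0 (env_units (\<lambda>x :: (M2, M2) dsum. x) E\<^sub>\<sigma>)) = 1 \<and>
    card (pi0 {x :: (M2, M2) dsum. invertible_elem x}) = 1"
proof (intro conjI)
  show "is_cstar_envelope TYPE('b) E\<^sub>\<sigma> (\<lambda>x. x)" by (rule is_cstar_envelope_E\<^sub>\<sigma>)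
  show "card (pi0 (env_units_h (\<lambda>x. x) E\<^sub>\<sigma>)) = 11" by (rule card_pi0_env_units_h)
  show "card (pi0 {x :: (M2, M2) dsum. invertible_elem x \<and> x\<^sup>\<star> = x}) = 9"
    by (rule card_pi0_selfadjoint_invertible)
  show "card (pi0 (env_units (\<lambda>x. x) E\<^sub>\<sigma>)) = 1"
    using card_pi0_invertible operator_system_E\<^sub>\<sigma> by (simp add: env_units_def operator_system_def)
  show "card (pi0 {x :: (M2, M2) dsum. invertible_elem x}) = 1"
    using card_pi0_invertible[OF complex_vector.subspace_UNIV UNIV_I] by simp
qed

end
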